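(* Let $(X_{n,k}, n\ge1,k\le n)$ be a triangular array of independent centred random variables such that there exists a continuous function $\sigma:[0,1]\to(0,+\infty)$ with $\mathbf{E}(X_{n,k}^2)=\sigma^2_{k/n}$ for all $n\in\mathbb{N}$ and $k\le n$, and such that there exists $\mu>0$ with $\sup_{n\ge1,k\le n}\mathbf{E}\big[e^{\mu|X_{n,k}|}\big]<+\infty$. Write $S^{(n)}_k=\sum_{j=1}^kX_{n,j}$. Then for any continuous function $g:[0,1]\to\mathbb{R}$ with $g(0)>0$ and any absolutely continuous increasing function $h:[0,1]\to\mathbb{R}$ with a Riemann-integrable derivative $\dot h$, $$\lim_{n\to+\infty}\frac1{n^{1/3}}\log\mathbf{E}\Big[\exp\Big(\sum_{j=1}^n(h_{j/n}-h_{(j-1)/n})S^{(n)}_j\Big);\ S^{(n)}_j\le g_{j/n}n^{1/3},\ j\le n\Big]=\int_0^1\Big(\dot h_sg_s+\frac{\alpha_1}{2^{1/3}}(\dot h_s\sigma_s)^{2/3}\Big)ds,$$ where $\alpha_1$ is the largest zero of the Airy function of first kind $\mathrm{Ai}$.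
   Context: For an event $A$, $\mathbf{E}(\,\cdot\,;A)=\mathbf{E}(\,\cdot\,\mathbf{1}_A)$. Functions of time are written with the time as index, $h_t=h(t)$. The zeros of $\mathrm{Ai}$ are all negative; $\alpha_1\approx-2.3381$. *)

theory Defs
  imports "HOL-Probability.Probability"
begin

text \<open>The defining integral of the Airy function is only conditionally convergent, hence the
  improper integral as a limit.\<close>

definition airy_Ai :: "real \<Rightarrow> real" where
  "airy_Ai x = 1 / pi * Lim at_top (\<lambda>t. integral {0..t} (\<lambda>s. cos (s ^ 3 / 3 + x * s)))"

definition airy_\<alpha>\<^sub>1 :: real where
  "airy_\<alpha>\<^sub>1 = (GREATEST x. airy_Ai x = 0)"

text \<open>A division consists of finitely many nondegenerate or degenerate compact intervals with
  pairwise disjoint interiors; \<^term>\<open>Inf k\<close> and \<^term>\<open>Sup k\<close> are the endpoints of \<^term>\<open>k\<close>.\<close>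

definition absolutely_continuous_fun :: "real \<Rightarrow> real \<Rightarrow> (real \<Rightarrow> real) \<Rightarrow> bool" where
  "absolutely_continuous_fun a b f \<longleftrightarrow>
     (\<forall>\<epsilon>>0. \<exists>\<delta>>0. \<forall>d s. d division_of s \<and> s \<subseteq> {a..b} \<and> (\<Sum>k\<in>d. Sup k - Inf k) < \<delta> \<longrightarrow>
        (\<Sum>k\<in>d. \<bar>f (Sup k) - f (Inf k)\<bar>) < \<epsilon>)"

text \<open>Convergence of Riemann sums as the mesh tends to 0. The library's
  \<^const>\<open>integrable_on\<close> is Henstock-Kurzweil integrability, where the constant radius
  \<^term>\<open>\<delta>\<close> is replaced by an arbitrary gauge.\<close>

definition riemann_integrable :: "real \<Rightarrow> real \<Rightarrow> (real \<Rightarrow> real) \<Rightarrow> bool" where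
  "riemann_integrable a b f \<longleftrightarrow>
     (\<exists>I. \<forall>\<epsilon>>0. \<exists>\<delta>>0. \<forall>p. p tagged_division_of {a..b} \<and> (\<lambda>x. ball x \<delta>) fine p \<longrightarrow>
        \<bar>(\<Sum>(x, k)\<in>p. (Sup k - Inf k) * f x) - I\<bar> < \<epsilon>)"

text \<open>The derivative of an absolutely continuous function exists almost everywhere only, so
  \<^term>\<open>h'\<close> is any function which agrees with it almost everywhere.\<close>

definition ae_derivative :: "real \<Rightarrow> real \<Rightarrow> (real \<Rightarrow> real) \<Rightarrow> (real \<Rightarrow> real) \<Rightarrow> bool" where
  "ae_derivative a b h h' \<longleftrightarrow>
     (AE t in lborel. t \<in> {a..b} \<longrightarrow> (h has_real_derivative h' t) (at t within {a..b}))"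

definition row_sum :: "(nat \<Rightarrow> nat \<Rightarrow> 'a \<Rightarrow> real) \<Rightarrow> nat \<Rightarrow> nat \<Rightarrow> 'a \<Rightarrow> real" where
  "row_sum X n k w = (\<Sum>j=1..k. X n j w)"

end

(* The walk is compared with test functions instead of a Brownian motion. In the variable
   y = g - S / n^(1/3) the weighted and killed walk has, on the time scale n^(2/3), the generator
   sigma^2 / 2 d^2/dy^2 - h' y with killing at y = 0, whose principal eigenfunction is Ai (c y + alpha_1)
   with c = (2 h' / sigma^2)^(1/3) and whose eigenvalue is alpha_1 (h' sigma)^(2/3) / 2^(1/3).
   A small shift of Ai plus a constant is a strict supersolution; a solution of the Airy equation
   that vanishes slightly to the left of alpha_1 has by Sturm comparison a second zero further to the right
   and yields a compactly supported strict subsolution. As the increments have mean zero and bounded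
   third moments, Taylor's formula transfers both to one step of the walk up to a factor exp (O(1/n)),
   and multiplying over the n steps gives the two bounds, once g and c are replaced by Lipschitz
   functions of time. *)
theory Submission
  imports Defs "HOL-Complex_Analysis.Complex_Analysis" "HOL-Real_Asymp.Real_Asymp"
begin

section \<open>The Airy equation\<close>

text \<open>Each step may lose a factor exp (O(1/n)), because n such factors amount to O(1) while
  the exponent is of order n^(1/3). Two obstacles shape the estimates. \<open>h'\<close> is Riemann
  integrable, hence merely bounded off a finite set, and it may vanish; so the natural scale c is in
  general neither Lipschitz nor positive. It is replaced by a Lipschitz one, and the error is
  carried along as the integral of |c^2 \<sigma>^2 / 2 - h' / c|. In one step this mismatch is
  multiplied by the Airy coordinate z, which is unbounded. Hence the supersolution satisfies its
  inequality with min z Z in place of z, and the subsolution has compact support: the factor in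
  front of the mismatch then depends on \<delta> alone, and the scale can be chosen afterwards. The
  subsolution vanishes at the ends of its support, where additive errors cannot be absorbed into a
  factor; a strictly positive gap \<delta>' pays for them. The starting point has to lie in that
  support, which is why the lower barrier is pushed down near time 0.\<close>

fun airy_coeff :: "real \<Rightarrow> real \<Rightarrow> nat \<Rightarrow> real" where
  "airy_coeff p q 0 = p"
| "airy_coeff p q (Suc 0) = q"
| "airy_coeff p q (Suc (Suc 0)) = 0"
| "airy_coeff p q (Suc (Suc (Suc n))) = airy_coeff p q n / (real (n + 3) * real (n + 2))"

text \<open>Every three indices the recursion multiplies |a_k| R^k by R^3 / ((k + 3) (k + 2)), which
  is at most 1 once k \<ge> R^3. The terms before that are bounded by their sum. As R is arbitrary,
  the power series converges everywhere.\<close>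

lemma airy_coeff_bounded:
  assumes "R > 0"
  shows "\<exists>K. \<forall>n. \<bar>airy_coeff p q n\<bar> * R ^ n \<le> K"
proof -
  obtain m :: nat where m: "R ^ 3 \<le> real m" using real_arch_simple by blast
  define K where "K = (\<Sum>n\<le>m+3. \<bar>airy_coeff p q n\<bar> * R ^ n)"
  have "\<bar>airy_coeff p q n\<bar> * R ^ n \<le> K" for n
  proof (induction n rule: less_induct)
    case (less n)
    show ?case
    proof (cases "n \<le> m + 3")
      case True
      then show ?thesis unfolding K_def
        by (intro member_le_sum) (use assms in auto)
    next
      case False
      define k where "k = n - 3"
      have n: "n = Suc (Suc (Suc k))" "k < n" "k \<ge> m" using False by (auto simp: k_def)
      have "R ^ 3 \<le> real (k + 3) * real (k + 2)"
      proof -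
        have "R ^ 3 \<le> real (k + 3) * 1" using m n(3) by simp
        also have "\<dots> \<le> real (k + 3) * real (k + 2)" by (intro mult_left_mono) auto
        finally show ?thesis .
      qed
      then have "R ^ 3 / (real (k + 3) * real (k + 2)) \<le> 1" by (simp add: divide_simps)
      have "\<bar>airy_coeff p q n\<bar> * R ^ n = (\<bar>airy_coeff p q k\<bar> * R ^ k) * (R ^ 3 / (real (k + 3) * real (k + 2)))"
        unfolding n(1) by (simp add: abs_mult power3_eq_cube)
      also have "\<dots> \<le> (\<bar>airy_coeff p q k\<bar> * R ^ k) * 1"
        using \<open>R ^ 3 / _ \<le> 1\<close> assms by (intro mult_left_mono) auto
      also have "\<dots> \<le> K" using less[OF n(2)] by simp
      finally show ?thesis .
    qed
  qed
  then show ?thesis by blast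
qed

lemma airy_coeff_summable: "summable (\<lambda>n. airy_coeff p q n * (x::real) ^ n)"
proof -
  define R where "R = \<bar>x\<bar> + 1"
  obtain K where K: "\<And>n. \<bar>airy_coeff p q n\<bar> * R ^ n \<le> K"
    using airy_coeff_bounded[of R p q] unfolding R_def by (metis abs_ge_zero add_nonneg_pos zero_less_one)
  have "\<bar>x\<bar> / R < 1" "R > 0" by (auto simp: R_def)
  have "summable (\<lambda>n. K * (\<bar>x\<bar> / R) ^ n)"
    by (intro summable_mult summable_geometric) (use \<open>\<bar>x\<bar> / R < 1\<close> \<open>R > 0\<close> in auto)
  moreover have "norm (airy_coeff p q n * x ^ n) \<le> K * (\<bar>x\<bar> / R) ^ n" for n
  proof -
    have "norm (airy_coeff p q n * x ^ n) = (\<bar>airy_coeff p q n\<bar> * R ^ n) * (\<bar>x\<bar> / R) ^ n"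
      using \<open>R > 0\<close> by (simp add: abs_mult power_abs power_divide)
    also have "\<dots> \<le> K * (\<bar>x\<bar> / R) ^ n"
      using \<open>R > 0\<close> by (intro mult_right_mono K) auto
    finally show ?thesis .
  qed
  ultimately show ?thesis by (rule summable_comparison_test'[where N = 0])
qed

text \<open>The power series solution of u'' = x u with u 0 = p and u' 0 = q: comparing coefficients
  gives a_2 = 0 and (n + 3) (n + 2) a_(n+3) = a_n.\<close>

definition airy_sol :: "real \<Rightarrow> real \<Rightarrow> real \<Rightarrow> real" where
  "airy_sol p q x = (\<Sum>n. airy_coeff p q n * x ^ n)"

definition airy_sol' :: "real \<Rightarrow> real \<Rightarrow> real \<Rightarrow> real" where
  "airy_sol' p q x = (\<Sum>n. diffs (airy_coeff p q) n * x ^ n)"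

lemma airy_sol_deriv: "(airy_sol p q has_real_derivative airy_sol' p q x) (at x)"
  unfolding airy_sol_def[abs_def] airy_sol'_def
  by (rule termdiffs_strong_converges_everywhere) (rule airy_coeff_summable)

lemma airy_sol'_deriv: "(airy_sol' p q has_real_derivative x * airy_sol p q x) (at x)"
proof -
  have s: "summable (\<lambda>n. diffs (airy_coeff p q) n * y ^ n)" for y
    by (rule termdiff_converges_all) (rule airy_coeff_summable)
  have s2: "summable (\<lambda>n. diffs (diffs (airy_coeff p q)) n * x ^ n)"
    by (rule termdiff_converges_all) (rule s)
  have d: "(airy_sol' p q has_real_derivative (\<Sum>n. diffs (diffs (airy_coeff p q)) n * x ^ n)) (at x)"
    unfolding airy_sol'_def[abs_def] by (rule termdiffs_strong_converges_everywhere) (rule s)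
  \<comment> \<open>The constant term of the second derivative is 2 a_2 = 0; splitting it off leaves
    the original series with one more power of x.\<close>
  have "(\<Sum>n. diffs (diffs (airy_coeff p q)) n * x ^ n) =
     (\<Sum>n. diffs (diffs (airy_coeff p q)) (Suc n) * x ^ Suc n) + diffs (diffs (airy_coeff p q)) 0"
    using suminf_split_head[OF s2] by simp
  also have "\<dots> = (\<Sum>n. x * (airy_coeff p q n * x ^ n))"
  proof -
    have "real (n + 2) * (real (n + 3) * (c / (real (n + 3) * real (n + 2)))) = c" for c n
      by simp
    then have "diffs (diffs (airy_coeff p q)) (Suc n) = airy_coeff p q n" for n
      by (simp add: diffs_def numeral_eq_Suc)
    moreover have "diffs (diffs (airy_coeff p q)) 0 = 0" by (simp add: diffs_def)
    ultimately show ?thesis by (simp add: mult_ac)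
  qed
  also have "\<dots> = x * airy_sol p q x"
    unfolding airy_sol_def by (rule suminf_mult) (rule airy_coeff_summable)
  finally show ?thesis using d by simp
qed

lemma airy_sol_0: "airy_sol p q 0 = p" "airy_sol' p q 0 = q"
  unfolding airy_sol_def airy_sol'_def by (simp_all add: powser_zero diffs_def)

text \<open>Uniqueness follows from the constancy of Wronskians, the solution with data
  \<open>(1, 0)\<close> and \<open>(0, 1)\<close> at the origin having Wronskian 1.\<close>

lemma wronskian_const:
  fixes u v u1 v1 :: "real \<Rightarrow> real"
  assumes "\<And>x. (u has_real_derivative u1 x) (at x)" "\<And>x. (u1 has_real_derivative x * u x) (at x)"
    and "\<And>x. (v has_real_derivative v1 x) (at x)" "\<And>x. (v1 has_real_derivative x * v x) (at x)"
  shows "u x * v1 x - u1 x * v x = u y * v1 y - u1 y * v y"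
proof -
  have "((\<lambda>x. u x * v1 x - u1 x * v x) has_real_derivative 0) (at x)" for x
    by (rule derivative_eq_intros assms refl)+ (simp add: algebra_simps)
  then show ?thesis using DERIV_isconst_all by blast
qed

lemma airy_unique_zero:
  fixes u u1 :: "real \<Rightarrow> real"
  assumes u: "\<And>x. (u has_real_derivative u1 x) (at x)" "\<And>x. (u1 has_real_derivative x * u x) (at x)"
    and z: "u a = 0" "u1 a = 0"
  shows "u x = 0"
proof -
  have w: "u x * airy_sol' p q x - u1 x * airy_sol p q x = 0" for p q
    using wronskian_const[OF u airy_sol_deriv airy_sol'_deriv, of x p q a] z by simp
  have "airy_sol 1 0 x * airy_sol' 0 1 x - airy_sol' 1 0 x * airy_sol 0 1 x = 1"
    using wronskian_const[OF airy_sol_deriv airy_sol'_deriv airy_sol_deriv airy_sol'_deriv, of 1 0 x 0 1 0]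
    by (simp add: airy_sol_0)
  moreover have "u x * airy_sol' 0 1 x = u1 x * airy_sol 0 1 x" "u x * airy_sol' 1 0 x = u1 x * airy_sol 1 0 x"
    using w[of 0 1] w[of 1 0] by auto
  \<comment> \<open>Multiplying the unit Wronskian by \<open>u x\<close> and substituting the two
    proportionalities makes its two products cancel.\<close>
  ultimately show ?thesis by algebra
qed

lemma airy_solution_exists:
  fixes a :: real
  obtains v v1 where "\<And>x. (v has_real_derivative v1 x) (at x)" "\<And>x. (v1 has_real_derivative x * v x) (at x)"
    "v a = 0" "v1 a = 1"
proof -
  \<comment> \<open>With these coefficients v vanishes at a, and \<open>v1 a\<close> becomes the
    Wronskian of the two basic solutions, which is 1.\<close>
  define v where "v x = airy_sol 1 0 a * airy_sol 0 1 x - airy_sol 0 1 a * airy_sol 1 0 x" for x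
  define v1 where "v1 x = airy_sol 1 0 a * airy_sol' 0 1 x - airy_sol 0 1 a * airy_sol' 1 0 x" for x
  have "(v has_real_derivative v1 x) (at x)" for x
    unfolding v_def[abs_def] v1_def by (rule derivative_eq_intros airy_sol_deriv refl)+ simp
  moreover have "(v1 has_real_derivative x * v x) (at x)" for x
    unfolding v_def v1_def[abs_def] by (rule derivative_eq_intros airy_sol'_deriv refl)+ (simp add: algebra_simps)
  moreover have "v a = 0" by (simp add: v_def)
  moreover have "v1 a = 1"
    using wronskian_const[OF airy_sol_deriv airy_sol'_deriv airy_sol_deriv airy_sol'_deriv, of 1 0 a 0 1 0]
    by (simp add: airy_sol_0 v1_def mult.commute)
  ultimately show ?thesis using that by blast
qed

section \<open>The Airy integral on a rotated contour\<close>

lemma exp_cubic_bound: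
  fixes \<kappa> X :: real
  assumes "\<kappa> > 0" "X \<ge> 0"
  shows "\<exists>K. \<forall>r\<ge>0. exp (X * r - \<kappa> * r ^ 3) \<le> K * exp (- r)"
proof -
  \<comment> \<open>Beyond R \<ge> 1 one has \<kappa> r^2 \<ge> \<kappa> R \<ge> 1 + X, so the cubic
    term beats (1 + X) r; up to R the exponent is at most (1 + X) R.\<close>
  define R where "R = (1 + X) / \<kappa> + 1"
  have R: "R \<ge> 1" "(1 + X) \<le> \<kappa> * R" using assms by (auto simp: R_def field_simps)
  have "exp (X * r - \<kappa> * r ^ 3) \<le> exp ((1 + X) * R) * exp (- r)" if "r \<ge> 0" for r
  proof -
    have "(1 + X) * r - \<kappa> * r ^ 3 \<le> (1 + X) * R"
    proof (cases "r \<le> R")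
      case True
      have "(1 + X) * r \<le> (1 + X) * R" using True assms by (intro mult_left_mono) auto
      moreover have "\<kappa> * r ^ 3 \<ge> 0" using assms that by simp
      ultimately show ?thesis by linarith
    next
      case False
      then have "r \<ge> 1" using R by linarith
      have "r * 1 \<le> r * r" using \<open>r \<ge> 1\<close> by (intro mult_left_mono) auto
      then have "R \<le> r ^ 2" using False by (simp add: power2_eq_square)
      then have "\<kappa> * R \<le> \<kappa> * r ^ 2" using assms by simp
      then have "(1 + X) \<le> \<kappa> * r ^ 2" using R(2) by linarith
      then have "(1 + X) * r \<le> \<kappa> * r ^ 2 * r" using that by (intro mult_right_mono) auto
      also have "\<dots> = \<kappa> * r ^ 3" by (simp add: power3_eq_cube power2_eq_square)
      finally show ?thesis using R assms by (smt (verit) mult_nonneg_nonneg)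
    qed
    then have "X * r - \<kappa> * r ^ 3 \<le> (1 + X) * R + - r" by (simp add: algebra_simps)
    then show ?thesis unfolding exp_add[symmetric] exp_le_cancel_iff .
  qed
  then show ?thesis by blast
qed

lemma integrable_exp_minus: "integrable lborel (\<lambda>r::real. indicator {0..} r * exp (- r))"
proof (rule integrableI_nonneg)
  have "(\<integral>\<^sup>+ x. ennreal (indicator {0..} x * exp (- x)) \<partial>lborel) = (\<integral>\<^sup>+ x. ennreal (x ^ 0 * exp (- x)) * indicator {0..} x \<partial>lborel)"
    by (intro nn_integral_cong) (auto simp: indicator_def)
  also have "\<dots> = 1" by (subst nn_intergal_power_times_exp_Ici) simp
  finally show "(\<integral>\<^sup>+ x. ennreal (indicator {0..} x * exp (- x)) \<partial>lborel) < \<infinity>" by simp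
qed auto

lemma integrable_exp_cubic:
  fixes f :: "real \<Rightarrow> 'b::{banach, second_countable_topology}"
  assumes "\<kappa> > 0" "X \<ge> 0" "f \<in> borel_measurable borel"
    and "\<And>r. r \<ge> 0 \<Longrightarrow> norm (f r) \<le> C * exp (X * r - \<kappa> * r ^ 3)"
  shows "integrable lborel (\<lambda>r. indicator {0..} r *\<^sub>R f r)"
proof -
  obtain K where K: "\<And>r. r \<ge> 0 \<Longrightarrow> exp (X * r - \<kappa> * r ^ 3) \<le> K * exp (- r)"
    using exp_cubic_bound[OF assms(1,2)] by blast
  show ?thesis
  proof (rule Bochner_Integration.integrable_bound)
    show "integrable lborel (\<lambda>r. (\<bar>C\<bar> * K) * (indicator {0..} r * exp (- r)))"
      using integrable_exp_minus by (intro integrable_mult_right) auto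
    show "(\<lambda>r. indicator {0..} r *\<^sub>R f r) \<in> borel_measurable lborel"
      using assms(3) by measurable
    have "norm (f r) \<le> norm (\<bar>C\<bar> * K * exp (- r))" if "r \<ge> 0" for r
    proof -
      have "norm (f r) \<le> C * exp (X * r - \<kappa> * r ^ 3)" using assms(4) that by blast
      also have "\<dots> \<le> \<bar>C\<bar> * exp (X * r - \<kappa> * r ^ 3)" by (intro mult_right_mono) auto
      also have "\<dots> \<le> \<bar>C\<bar> * (K * exp (- r))" using K[OF that] by (intro mult_left_mono) auto
      finally show ?thesis by simp
    qed
    then show "AE r in lborel. norm (indicator {0..} r *\<^sub>R f r) \<le> norm (\<bar>C\<bar> * K * (indicator {0..} r * exp (- r)))"
      by (intro AE_I2) (auto simp: indicator_def)
  qed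
qed

text \<open>The contour is rotated to the ray in direction \<open>\<omega> = 1 + i / sqrt 3\<close>, along which \<open>i z\<^sup>3 / 3\<close>
  is real and negative.\<close>

definition airy_b :: real where "airy_b = 1 / sqrt 3"
definition airy_\<omega> :: complex where "airy_\<omega> = Complex 1 airy_b"
definition airy_\<kappa> :: real where "airy_\<kappa> = 8 / 3 * airy_b"

lemma airy_b: "airy_b > 0" "airy_b * airy_b = 1 / 3"
  by (auto simp: airy_b_def)

lemma airy_\<kappa>_pos: "airy_\<kappa> > 0" using airy_b by (simp add: airy_\<kappa>_def)

lemma airy_\<omega>_cubed: "airy_\<omega> ^ 3 = \<i> * of_real airy_\<kappa>"
proof -
  have "airy_\<omega> ^ 3 = (airy_\<omega> * airy_\<omega>) * airy_\<omega>" by (simp add: power3_eq_cube)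
  also have "\<dots> = Complex (1 - 3 * (airy_b * airy_b)) (3 * airy_b - (airy_b * airy_b) * airy_b)"
    unfolding airy_\<omega>_def by (simp add: complex_eq_iff algebra_simps)
  also have "\<dots> = \<i> * of_real airy_\<kappa>"
    unfolding airy_b(2) by (simp add: complex_eq_iff airy_\<kappa>_def)
  finally show ?thesis .
qed

text \<open>The integrand exp (i (z^3 / 3 + x z)) dz on the ray z = r \<omega>; the leading factor
  \<open>airy_\<omega>\<close> is dz / dr.\<close>

definition airy_kernel :: "real \<Rightarrow> real \<Rightarrow> complex" where
  "airy_kernel x r = airy_\<omega> * exp (- of_real (airy_\<kappa> / 3 * r ^ 3) + \<i> * of_real x * airy_\<omega> * of_real r)"

lemma norm_airy_kernel: "norm (airy_kernel x r) = norm airy_\<omega> * exp (- airy_b * x * r - airy_\<kappa> / 3 * r ^ 3)"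
proof -
  have "Re (- of_real (airy_\<kappa> / 3 * r ^ 3) + \<i> * of_real x * airy_\<omega> * of_real r) = - airy_b * x * r - airy_\<kappa> / 3 * r ^ 3"
    by (simp add: airy_\<omega>_def Re_power_real)
  then show ?thesis
    unfolding airy_kernel_def norm_mult norm_exp_eq_Re by metis
qed

lemma airy_kernel_measurable [measurable]: "airy_kernel x \<in> borel_measurable borel"
  unfolding airy_kernel_def[abs_def]
  by (intro borel_measurable_continuous_onI continuous_intros)

lemma airy_kernel_integrable: "integrable lborel (\<lambda>r. indicator {0..} r *\<^sub>R airy_kernel x r)"
proof (rule integrable_exp_cubic[where X = "airy_b * \<bar>x\<bar>" and \<kappa> = "airy_\<kappa> / 3" and C = "norm airy_\<omega>"])
  fix r :: real assume r: "0 \<le> r"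
  have "- airy_b * x * r \<le> airy_b * \<bar>x\<bar> * r"
    using airy_b(1) r by (intro mult_right_mono) (auto simp: abs_if)
  then show "norm (airy_kernel x r) \<le> norm airy_\<omega> * exp (airy_b * \<bar>x\<bar> * r - airy_\<kappa> / 3 * r ^ 3)"
    unfolding norm_airy_kernel by (intro mult_left_mono) auto
qed (use airy_b(1) airy_\<kappa>_pos in auto)

text \<open>Links the limit of gauge integrals over [0, t], as in the definition of Ai, with a
  Lebesgue integral over the half line.\<close>

lemma set_integral_tendsto_atLeast:
  fixes f :: "real \<Rightarrow> 'b::euclidean_space"
  assumes "integrable lborel (\<lambda>r. indicator {0..} r *\<^sub>R f r)"
  shows "((\<lambda>t. integral {0..t} f) \<longlongrightarrow> (\<integral>r. indicator {0..} r *\<^sub>R f r \<partial>lborel)) at_top"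
proof -
  have "((\<lambda>t. \<integral>r. indicator {..t} r *\<^sub>R (indicator {0..} r *\<^sub>R f r) \<partial>lborel) \<longlongrightarrow> (\<integral>r. indicator {0..} r *\<^sub>R f r \<partial>lborel)) at_top"
    by (rule tendsto_integral_at_top) (use assms in auto)
  moreover have "(\<integral>r. indicator {..t} r *\<^sub>R (indicator {0..} r *\<^sub>R f r) \<partial>lborel) = integral {0..t} f" for t
  proof -
    have eq: "indicator {..t} r *\<^sub>R (indicator {0..} r *\<^sub>R f r) = indicator {0..t} r *\<^sub>R f r" for r
      by (auto simp: indicator_def)
    have "integrable lborel (\<lambda>r. indicator {..t} r *\<^sub>R (indicator {0..} r *\<^sub>R f r))"
      using integrable_mult_indicator[OF _ assms, of "{..t}"] by simp
    then have "set_integrable lborel {0..t} f" unfolding eq set_integrable_def .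
    then show ?thesis unfolding eq using set_borel_integral_eq_integral(2)
      by (simp add: set_lebesgue_integral_def)
  qed
  ultimately show ?thesis by simp
qed

lemma complex_primitive_segment:
  fixes F :: "complex \<Rightarrow> complex"
  assumes F: "\<And>z. (F has_field_derivative f z) (at z)" and "0 \<le> t"
  shows "((\<lambda>s. d * f (z0 + of_real s * d)) has_integral (F (z0 + of_real t * d) - F z0)) {0..t}"
proof -
  have "((\<lambda>s. d * f (z0 + of_real s * d)) has_integral (F (z0 + of_real t * d) - F (z0 + of_real 0 * d))) {0..t}"
  proof (rule fundamental_theorem_of_calculus[OF assms(2)])
    fix s assume "s \<in> {0..t}"
    have "((\<lambda>s. z0 + of_real s * d) has_vector_derivative d) (at s within {0..t})"
      by (auto intro!: derivative_eq_intros)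
    from field_vector_diff_chain_within[OF this, of F "f (z0 + of_real s * d)"] F
    show "((\<lambda>s. F (z0 + of_real s * d)) has_vector_derivative d * f (z0 + of_real s * d)) (at s within {0..t})"
      by (auto simp: o_def intro: has_field_derivative_at_within)
  qed
  then show ?thesis by simp
qed

definition airy_entire :: "real \<Rightarrow> complex \<Rightarrow> complex" where
  "airy_entire x z = exp (\<i> * (z ^ 3 / 3 + of_real x * z))"

lemma airy_entire_ray: "airy_\<omega> * airy_entire x (of_real r * airy_\<omega>) = airy_kernel x r"
proof -
  have "\<i> * ((of_real r * airy_\<omega>) ^ 3 / 3) = - of_real (airy_\<kappa> / 3 * r ^ 3)"
    by (simp add: power_mult_distrib airy_\<omega>_cubed complex_eq_iff)
  then show ?thesis
    unfolding airy_entire_def airy_kernel_def by (simp add: algebra_simps)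
qed

text \<open>On the vertical side joining t to t \<omega> the real part of the exponent is - (t^2 -
  s^2 / 3 + x) s, and s \<le> t / sqrt 3 leaves at least 8/9 of t^2.\<close>

lemma norm_airy_entire_vertical:
  assumes "0 \<le> s" "s \<le> t * airy_b" "0 \<le> t"
  shows "norm (airy_entire x (of_real t + of_real s * \<i>)) \<le> exp (- (8 / 9 * t\<^sup>2 + x) * s)"
proof -
  have "s\<^sup>2 \<le> (t * airy_b)\<^sup>2" using assms by (intro power_mono) auto
  then have s2: "s\<^sup>2 \<le> t\<^sup>2 / 3" by (simp add: power_mult_distrib power2_eq_square[of airy_b] airy_b(2))
  have le: "(8 / 9 * t\<^sup>2) * s \<le> (t\<^sup>2 - s\<^sup>2 / 3) * s"
    using s2 assms(1) by (intro mult_right_mono) auto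
  have cube: "(of_real t + of_real s * \<i>) ^ 3 = Complex (t ^ 3 - 3 * (t * s\<^sup>2)) (3 * (t\<^sup>2 * s) - s ^ 3)"
    by (simp add: complex_eq_iff power3_eq_cube power2_eq_square algebra_simps)
  have "Re (\<i> * ((of_real t + of_real s * \<i>) ^ 3 / 3 + of_real x * (of_real t + of_real s * \<i>)))
     = - ((3 * (t\<^sup>2 * s) - s ^ 3) / 3) - x * s"
    unfolding cube by simp
  also have "(3 * (t\<^sup>2 * s) - s ^ 3) / 3 = (t\<^sup>2 - s\<^sup>2 / 3) * s"
    by (simp add: power3_eq_cube power2_eq_square field_simps)
  finally have "Re (\<i> * ((of_real t + of_real s * \<i>) ^ 3 / 3 + of_real x * (of_real t + of_real s * \<i>)))
     \<le> - (8 / 9 * t\<^sup>2 + x) * s" using le by (simp add: algebra_simps)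
  then show ?thesis unfolding airy_entire_def norm_exp_eq_Re by simp
qed

text \<open>A primitive F turns the integrals over the sides of the triangle 0, t, t \<omega> into
  differences of its values. The vertical side contributes at most 1 / (8/9 t^2 + x), which tends to
  0, so the oscillatory integral on the real axis and the absolutely convergent one on the ray have
  the same limit in their real parts.\<close>

lemma airy_Ai_eq: "airy_Ai x = 1 / pi * Re (\<integral>r. indicator {0..} r *\<^sub>R airy_kernel x r \<partial>lborel)"
proof -
  have "airy_entire x holomorphic_on UNIV"
    unfolding airy_entire_def by (intro holomorphic_intros) auto
  then obtain F where F: "\<And>z. (F has_field_derivative airy_entire x z) (at z)"
    using holomorphic_convex_primitive'[of UNIV "airy_entire x"] by auto
  have real: "integral {0..t} (\<lambda>s. cos (s ^ 3 / 3 + x * s)) = Re (F (of_real t) - F 0)" if "t \<ge> 0" for t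
  proof -
    have "((\<lambda>s. Re (airy_entire x (of_real s))) has_integral Re (F (of_real t) - F 0)) {0..t}"
      using has_integral_Re[OF complex_primitive_segment[OF F that, of 1 0]] by simp
    moreover have "Re (airy_entire x (of_real s)) = cos (s ^ 3 / 3 + x * s)" for s
    proof -
      have eq: "of_real s ^ 3 / 3 + of_real x * of_real s = complex_of_real (s ^ 3 / 3 + x * s)" by simp
      show ?thesis unfolding airy_entire_def eq cis_conv_exp[symmetric] by simp
    qed
    ultimately show ?thesis by (simp add: integral_unique)
  qed
  have ray: "integral {0..t} (airy_kernel x) = F (of_real t * airy_\<omega>) - F 0" if "t \<ge> 0" for t
    using complex_primitive_segment[OF F that, of airy_\<omega> 0] airy_entire_ray
    by (simp add: integral_unique)
  have vert: "norm (F (of_real t * airy_\<omega>) - F (of_real t)) \<le> 1 / (8 / 9 * t\<^sup>2 + x)"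
    if t: "t \<ge> 0" "8 / 9 * t\<^sup>2 + x > 0" for t
  proof -
    define m where "m = 8 / 9 * t\<^sup>2 + x"
    have m: "m > 0" using t(2) by (simp add: m_def)
    define T where "T = t * airy_b"
    have T: "T \<ge> 0" using t airy_b by (simp add: T_def)
    have om: "of_real t * airy_\<omega> = of_real t + of_real T * \<i>" by (simp add: airy_\<omega>_def T_def complex_eq_iff)
    have i1: "((\<lambda>s. \<i> * airy_entire x (of_real t + of_real s * \<i>)) has_integral (F (of_real t * airy_\<omega>) - F (of_real t))) {0..T}"
      using complex_primitive_segment[OF F T, of \<i> "of_real t"] unfolding om .
    have i2: "((\<lambda>s. exp (- m * s)) has_integral (- exp (- m * T) / m - (- exp (- m * 0) / m))) {0..T}"
      by (rule fundamental_theorem_of_calculus[OF T])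
         (use m in \<open>auto simp: has_real_derivative_iff_has_vector_derivative[symmetric] intro!: derivative_eq_intros\<close>)
    have "norm (F (of_real t * airy_\<omega>) - F (of_real t)) \<le> - exp (- m * T) / m - (- exp (- m * 0) / m)"
    proof -
      have "norm (integral {0..T} (\<lambda>s. \<i> * airy_entire x (of_real t + of_real s * \<i>))) \<le> integral {0..T} (\<lambda>s. exp (- m * s))"
      proof (rule integral_norm_bound_integral[OF has_integral_integrable[OF i1] has_integral_integrable[OF i2]])
        fix s assume s: "s \<in> {0..T}"
        then show "norm (\<i> * airy_entire x (of_real t + of_real s * \<i>)) \<le> exp (- m * s)"
          using norm_airy_entire_vertical[of s t x] t by (simp add: norm_mult m_def T_def)
      qed
      then show ?thesis unfolding integral_unique[OF i1] integral_unique[OF i2] .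
    qed
    also have "\<dots> \<le> 1 / m" using m by (simp add: divide_simps)
    finally show ?thesis unfolding m_def .
  qed
  have big: "\<forall>\<^sub>F t in at_top. t \<ge> 0 \<and> 8 / 9 * t\<^sup>2 + x > 0 \<and> t \<le> 8 / 9 * t\<^sup>2 + x"
    using eventually_ge_at_top[of "\<bar>x\<bar> + 3"]
  proof eventually_elim
    case (elim t)
    then have "3 * t \<le> t\<^sup>2" unfolding power2_eq_square by (intro mult_right_mono) auto
    then show ?case using elim by linarith
  qed
  have "((\<lambda>t. F (of_real t * airy_\<omega>) - F (of_real t)) \<longlongrightarrow> 0) at_top"
  proof (rule Lim_null_comparison)
    show "\<forall>\<^sub>F t in at_top. norm (F (of_real t * airy_\<omega>) - F (of_real t)) \<le> 1 / (8 / 9 * t\<^sup>2 + x)"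
      using big
    proof eventually_elim
      case (elim t)
      then show ?case by (intro vert) auto
    qed
    have "filterlim (\<lambda>t. 8 / 9 * t\<^sup>2 + x) at_top at_top"
      by (rule filterlim_at_top_mono[OF filterlim_ident]) (use big in \<open>eventually_elim, simp\<close>)
    then show "((\<lambda>t. 1 / (8 / 9 * t\<^sup>2 + x)) \<longlongrightarrow> 0) at_top"
      unfolding inverse_eq_divide[symmetric] by (rule tendsto_inverse_0_at_top)
  qed
  from tendsto_diff[OF set_integral_tendsto_atLeast[OF airy_kernel_integrable, of x] this]
  have "((\<lambda>t. Re (integral {0..t} (airy_kernel x) - (F (of_real t * airy_\<omega>) - F (of_real t)))) \<longlongrightarrow> Re (\<integral>r. indicator {0..} r *\<^sub>R airy_kernel x r \<partial>lborel)) at_top"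
    by (intro tendsto_Re) (simp only: diff_0_right)
  then have "((\<lambda>t. integral {0..t} (\<lambda>s. cos (s ^ 3 / 3 + x * s))) \<longlongrightarrow> Re (\<integral>r. indicator {0..} r *\<^sub>R airy_kernel x r \<partial>lborel)) at_top"
  proof (rule Lim_transform_eventually)
    show "\<forall>\<^sub>F t in at_top. Re (integral {0..t} (airy_kernel x) - (F (of_real t * airy_\<omega>) - F (of_real t))) = integral {0..t} (\<lambda>s. cos (s ^ 3 / 3 + x * s))"
      using eventually_ge_at_top[of 0] by eventually_elim (simp only: real ray minus_complex.sel diff_diff_eq2, simp)
  qed
  from tendsto_Lim[OF trivial_limit_at_top_linorder this] show ?thesis
    unfolding airy_Ai_def by (rule arg_cong)
qed

section \<open>Moments of the rotated kernel and the Taylor series of Ai\<close>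

definition airy_moment :: "nat \<Rightarrow> real" where
  "airy_moment k = (\<integral>r. indicator {0..} r *\<^sub>R (r ^ k * exp (- (airy_\<kappa> / 3) * r ^ 3)) \<partial>lborel)"

lemma power_le_fact_exp: "(r::real) \<ge> 0 \<Longrightarrow> r ^ k \<le> fact k * exp r"
proof -
  assume r: "r \<ge> 0"
  have "(\<Sum>n\<in>{k}. r ^ n /\<^sub>R fact n) \<le> (\<Sum>n. r ^ n /\<^sub>R fact n)"
    using r summable_exp_generic[of r] by (intro sum_le_suminf) auto
  then have "r ^ k / fact k \<le> exp r" by (simp add: exp_def divide_inverse mult.commute)
  then show ?thesis by (simp add: field_simps)
qed

lemma airy_moment_integrable:
  "integrable lborel (\<lambda>r. indicator {0..} r *\<^sub>R (r ^ k * exp (- (airy_\<kappa> / 3) * r ^ 3)))"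
proof (rule integrable_exp_cubic[where X = 1 and \<kappa> = "airy_\<kappa> / 3" and C = "fact k"])
  fix r :: real assume r: "0 \<le> r"
  have "norm (r ^ k * exp (- (airy_\<kappa> / 3) * r ^ 3)) = r ^ k * exp (- (airy_\<kappa> / 3) * r ^ 3)"
    using r by simp
  also have "\<dots> \<le> (fact k * exp r) * exp (- (airy_\<kappa> / 3) * r ^ 3)"
    using power_le_fact_exp[OF r] by (intro mult_right_mono) auto
  also have "\<dots> = fact k * exp (1 * r - airy_\<kappa> / 3 * r ^ 3)"
    by (simp add: mult.assoc flip: exp_add)
  finally show "norm (r ^ k * exp (- (airy_\<kappa> / 3) * r ^ 3)) \<le> fact k * exp (1 * r - airy_\<kappa> / 3 * r ^ 3)" .
qed (use airy_\<kappa>_pos in auto)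

text \<open>The derivative of r^k exp (- \<kappa> r^3 / 3), with \<kappa> =
  \<open>airy_\<kappa>\<close>, is integrated over the half line. The boundary term at 0 is 0^k,
  which is nonzero for k = 0 only.\<close>

lemma airy_moment_rec:
  "real k * airy_moment (k - 1) - airy_\<kappa> * airy_moment (k + 2) = (if k = 0 then - 1 else 0)"
proof -
  define E where "E r = exp (- (airy_\<kappa> / 3) * r ^ 3)" for r
  have i: "integrable lborel (\<lambda>r. indicator {0..} r *\<^sub>R (r ^ k * E r))" for k
    using airy_moment_integrable unfolding E_def .
  have split: "indicator {0..} r *\<^sub>R (real k * r ^ (k - 1) * E r - airy_\<kappa> * r ^ (k + 2) * E r)
     = real k * (indicator {0..} r *\<^sub>R (r ^ (k - 1) * E r)) - airy_\<kappa> * (indicator {0..} r *\<^sub>R (r ^ (k + 2) * E r))" for r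
    by (simp add: algebra_simps)
  have ii: "integrable lborel (\<lambda>r. indicator {0..} r *\<^sub>R (real k * r ^ (k - 1) * E r - airy_\<kappa> * r ^ (k + 2) * E r))"
    unfolding split by (intro Bochner_Integration.integrable_diff integrable_mult_right i)
  have lim: "((\<lambda>t. integral {0..t} (\<lambda>r. real k * r ^ (k - 1) * E r - airy_\<kappa> * r ^ (k + 2) * E r)) \<longlongrightarrow>
      real k * airy_moment (k - 1) - airy_\<kappa> * airy_moment (k + 2)) at_top"
  proof -
    have "(\<integral>r. indicator {0..} r *\<^sub>R (real k * r ^ (k - 1) * E r - airy_\<kappa> * r ^ (k + 2) * E r) \<partial>lborel) =
        real k * airy_moment (k - 1) - airy_\<kappa> * airy_moment (k + 2)"
      unfolding split airy_moment_def E_def[symmetric]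
      by (subst Bochner_Integration.integral_diff)
         (intro integrable_mult_right i, intro integrable_mult_right i,
          unfold Bochner_Integration.integral_mult_right[OF i], rule refl)
    then show ?thesis using set_integral_tendsto_atLeast[OF ii] by simp
  qed
  have val: "integral {0..t} (\<lambda>r. real k * r ^ (k - 1) * E r - airy_\<kappa> * r ^ (k + 2) * E r) = t ^ k * E t - 0 ^ k" if "t \<ge> 0" for t
  proof -
    have "((\<lambda>r. real k * r ^ (k - 1) * E r - airy_\<kappa> * r ^ (k + 2) * E r) has_integral (t ^ k * E t - 0 ^ k * E 0)) {0..t}"
    proof (rule fundamental_theorem_of_calculus[OF that])
      fix r
      have d: "((\<lambda>r. r ^ k * E r) has_real_derivative (real k * r ^ (k - 1) * E r + r ^ k * (E r * (- (airy_\<kappa> / 3) * (3 * r ^ 2))))) (at r within {0..t})"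
        unfolding E_def by (auto intro!: derivative_eq_intros)
      have eq: "r ^ k * (E r * (- (airy_\<kappa> / 3) * (3 * r ^ 2))) = - (airy_\<kappa> * r ^ (k + 2) * E r)"
        by (simp add: power_add power2_eq_square)
      from d[unfolded eq] show "((\<lambda>r. r ^ k * E r) has_vector_derivative real k * r ^ (k - 1) * E r - airy_\<kappa> * r ^ (k + 2) * E r) (at r within {0..t})"
        by (simp only: has_real_derivative_iff_has_vector_derivative diff_conv_add_uminus)
    qed
    then show ?thesis by (simp add: integral_unique E_def)
  qed
  have "((\<lambda>t. t ^ k * E t) \<longlongrightarrow> 0) at_top"
  proof -
    obtain K where K: "\<And>r. r \<ge> 0 \<Longrightarrow> exp (2 * r - airy_\<kappa> / 3 * r ^ 3) \<le> K * exp (- r)"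
      using exp_cubic_bound[of "airy_\<kappa> / 3" 2] airy_\<kappa>_pos by auto
    show ?thesis
    proof (rule Lim_null_comparison)
      show "((\<lambda>t. fact k * (K * exp (- t))) \<longlongrightarrow> 0) at_top" by real_asymp
      show "\<forall>\<^sub>F t in at_top. norm (t ^ k * E t) \<le> fact k * (K * exp (- t))"
        using eventually_ge_at_top[of 0]
      proof eventually_elim
        case (elim t)
        have "norm (t ^ k * E t) = t ^ k * E t" using elim by (simp add: E_def)
        also have "\<dots> \<le> (fact k * exp t) * E t"
          using power_le_fact_exp[OF elim] by (intro mult_right_mono) (auto simp: E_def)
        also have "\<dots> = fact k * exp (t - airy_\<kappa> / 3 * t ^ 3)"
          by (simp add: E_def mult.assoc flip: exp_add)
        also have "\<dots> \<le> fact k * exp (2 * t - airy_\<kappa> / 3 * t ^ 3)" using elim by simp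
        also have "\<dots> \<le> fact k * (K * exp (- t))" using K[OF elim] by simp
        finally show ?case .
      qed
    qed
  qed
  then have "((\<lambda>t. t ^ k * E t - 0 ^ k) \<longlongrightarrow> 0 - 0 ^ k) at_top" by (intro tendsto_diff tendsto_const)
  then have "((\<lambda>t. integral {0..t} (\<lambda>r. real k * r ^ (k - 1) * E r - airy_\<kappa> * r ^ (k + 2) * E r)) \<longlongrightarrow> 0 - 0 ^ k) at_top"
    by (rule Lim_transform_eventually) (use eventually_ge_at_top[of 0] in \<open>eventually_elim, simp only: val\<close>)
  from tendsto_unique[OF trivial_limit_at_top_linorder lim this] show ?thesis by simp
qed

lemma airy_moment_0_pos: "airy_moment 0 > 0"
proof -
  have "airy_moment 0 \<ge> 0" unfolding airy_moment_def by (intro integral_nonneg_AE) auto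
  moreover have "airy_moment 0 \<noteq> 0"
  proof
    assume "airy_moment 0 = 0"
    then have "AE r in lborel. indicator {0..} r *\<^sub>R (r ^ 0 * exp (- (airy_\<kappa> / 3) * r ^ 3)) = (0::real)"
      unfolding airy_moment_def
      by (subst (asm) integral_nonneg_eq_0_iff_AE[OF airy_moment_integrable]) auto
    then have "AE r in lborel. r \<notin> {0<..<1::real}" by eventually_elim (auto simp: indicator_def split: if_splits)
    then have "emeasure lborel {0<..<1::real} = 0"
      by (subst (asm) AE_iff_measurable[of "{0<..<1}"]) auto
    then show False by simp
  qed
  ultimately show ?thesis by simp
qed

text \<open>What remains of the kernel integral at order x^k after expanding exp (i x \<omega> r) in
  powers of x.\<close>

definition airy_taylor :: "nat \<Rightarrow> real" where
  "airy_taylor k = Re (airy_\<omega> * (\<i> * airy_\<omega>) ^ k) * airy_moment k / (fact k * pi)"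

text \<open>(i \<omega>)^3 is the real number \<open>airy_\<kappa>\<close>, so a shift by three
  passes through the real part in \<open>airy_taylor\<close>.\<close>

lemma airy_\<omega>_shift: "airy_\<omega> * (\<i> * airy_\<omega>) ^ (k + 3) = of_real airy_\<kappa> * (airy_\<omega> * (\<i> * airy_\<omega>) ^ k)"
proof -
  have "(\<i> * airy_\<omega>) ^ 3 = of_real airy_\<kappa>"
    by (simp add: power_mult_distrib airy_\<omega>_cubed power3_eq_cube[of \<i>])
  then show ?thesis by (simp add: power_add)
qed

text \<open>A shift by three multiplies the real part by \<open>airy_\<kappa>\<close>, and \<kappa>
  m_(k+3) = (k + 1) m_k for the moments; against the factorials this leaves the recursion of the
  Airy equation. The coefficient of index 2 vanishes since \<omega> (i \<omega>)^2 = - \<omega>^3 is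
  purely imaginary.\<close>

lemma airy_taylor_eq: "airy_taylor k = airy_coeff (airy_taylor 0) (airy_taylor 1) k"
proof (induction "airy_taylor 0" "airy_taylor 1" k rule: airy_coeff.induct)
  case 3
  have "airy_\<omega> * (\<i> * airy_\<omega>) ^ 2 = - \<i> * of_real airy_\<kappa>"
    using airy_\<omega>_cubed by (simp add: power2_eq_square power3_eq_cube mult_ac)
  then have "Re (airy_\<omega> * (\<i> * airy_\<omega>) ^ 2) = 0" by simp
  then show ?case by (simp add: airy_taylor_def numeral_2_eq_2)
next
  case (4 k)
  have "airy_\<kappa> * airy_moment (k + 3) = real (k + 1) * airy_moment k"
    using airy_moment_rec[of "k + 1"] by (simp add: eval_nat_numeral)
  moreover have "Re (airy_\<omega> * (\<i> * airy_\<omega>) ^ (k + 3)) = airy_\<kappa> * Re (airy_\<omega> * (\<i> * airy_\<omega>) ^ k)"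
    unfolding airy_\<omega>_shift by simp
  ultimately have "airy_taylor (k + 3) = Re (airy_\<omega> * (\<i> * airy_\<omega>) ^ k) * (real (k + 1) * airy_moment k) / (fact (k + 3) * pi)"
    unfolding airy_taylor_def by simp
  moreover have "fact (k + 3) = real (k + 3) * (real (k + 2) * (real (k + 1) * fact k))"
    by (simp add: eval_nat_numeral)
  ultimately have "airy_taylor (k + 3) = airy_taylor k / (real (k + 3) * real (k + 2))"
    unfolding airy_taylor_def by simp
  then show ?case using 4 by (simp add: eval_nat_numeral)
qed simp_all

text \<open>Termwise integration. The partial sums of the exponential series of z are dominated by
  exp |z|, which grows only like exp (C r) and is tamed by the cubic decay along the ray.\<close>

lemma airy_Ai_sums: "(\<lambda>k. airy_taylor k * x ^ k) sums airy_Ai x"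
proof -
  define E where "E r = exp (- (airy_\<kappa> / 3) * r ^ 3)" for r
  define S where "S n r = (\<Sum>k<n. airy_\<omega> * (\<i> * airy_\<omega>) ^ k * of_real (x ^ k / fact k) * of_real (r ^ k * E r))" for n r
  define w where "w r = norm airy_\<omega> * exp (norm airy_\<omega> * \<bar>x\<bar> * r - airy_\<kappa> / 3 * r ^ 3)" for r
  define z where "z r = \<i> * airy_\<omega> * of_real x * of_real r" for r :: real
  have S_eq: "S n r = airy_\<omega> * of_real (E r) * (\<Sum>k<n. z r ^ k /\<^sub>R fact k)" for n r
    unfolding S_def z_def sum_distrib_left
    by (intro sum.cong refl) (simp add: power_mult_distrib scaleR_conv_of_real divide_inverse)
  have norm_z: "norm (z r) = norm airy_\<omega> * \<bar>x\<bar> * r" if "r \<ge> 0" for r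
    using that by (simp add: z_def norm_mult)
  have conv: "(\<lambda>n. S n r) \<longlonglongrightarrow> airy_kernel x r" for r
  proof -
    have "(\<lambda>n. \<Sum>k<n. z r ^ k /\<^sub>R fact k) \<longlonglongrightarrow> exp (z r)"
      using exp_converges[of "z r"] by (simp add: sums_def)
    then have "(\<lambda>n. S n r) \<longlonglongrightarrow> airy_\<omega> * of_real (E r) * exp (z r)"
      unfolding S_eq by (intro tendsto_mult tendsto_const)
    also have "airy_\<omega> * of_real (E r) * exp (z r) = airy_kernel x r"
      unfolding airy_kernel_def E_def z_def exp_add exp_of_real[symmetric] by (simp add: mult_ac)
    finally show ?thesis .
  qed
  have dom: "norm (S n r) \<le> w r" if "r \<ge> 0" for n r
  proof -
    have "norm (S n r) = norm airy_\<omega> * E r * norm (\<Sum>k<n. z r ^ k /\<^sub>R fact k)"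
      unfolding S_eq norm_mult by (simp add: E_def)
    also have "norm (\<Sum>k<n. z r ^ k /\<^sub>R fact k) \<le> (\<Sum>k<n. norm (z r) ^ k /\<^sub>R fact k)"
      by (rule order.trans[OF norm_sum]) (simp add: norm_power)
    also have "\<dots> \<le> (\<Sum>k. norm (z r) ^ k /\<^sub>R fact k)"
      using summable_exp_generic[of "norm (z r)"] by (intro sum_le_suminf) auto
    also have "\<dots> = exp (norm (z r))" by (simp add: exp_def)
    finally have "norm (S n r) \<le> norm airy_\<omega> * E r * exp (norm (z r))"
      by (simp add: mult_left_mono E_def)
    also have "\<dots> = w r"
      unfolding w_def norm_z[OF that] E_def by (simp add: mult.assoc flip: exp_add)
    finally show ?thesis .
  qed
  have "(\<lambda>n. \<integral>r. indicator {0..} r *\<^sub>R S n r \<partial>lborel) \<longlonglongrightarrow> (\<integral>r. indicator {0..} r *\<^sub>R airy_kernel x r \<partial>lborel)"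
  proof (rule integral_dominated_convergence[where w = "\<lambda>r. indicator {0..} r *\<^sub>R w r"])
    show "integrable lborel (\<lambda>r. indicator {0..} r *\<^sub>R w r)"
      by (rule integrable_exp_cubic[where X = "norm airy_\<omega> * \<bar>x\<bar>" and \<kappa> = "airy_\<kappa> / 3" and C = "norm airy_\<omega>"])
         (use airy_\<kappa>_pos in \<open>auto simp: w_def\<close>)
    show "(\<lambda>r. indicator {0..} r *\<^sub>R S n r) \<in> borel_measurable lborel" for n
    proof -
      have "S n \<in> borel_measurable borel"
        unfolding S_def[abs_def] E_def by (intro borel_measurable_continuous_onI continuous_intros)
      then show ?thesis by measurable
    qed
    show "AE r in lborel. (\<lambda>n. indicator {0..} r *\<^sub>R S n r) \<longlonglongrightarrow> indicator {0..} r *\<^sub>R airy_kernel x r"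
      by (intro AE_I2 tendsto_scaleR tendsto_const conv)
    show "AE r in lborel. norm (indicator {0..} r *\<^sub>R S n r) \<le> indicator {0..} r *\<^sub>R w r" for n
      using dom by (intro AE_I2) (auto simp: indicator_def)
  qed simp
  moreover have "(\<integral>r. indicator {0..} r *\<^sub>R S n r \<partial>lborel) =
      (\<Sum>k<n. airy_\<omega> * (\<i> * airy_\<omega>) ^ k * of_real (x ^ k / fact k) * of_real (airy_moment k))" for n
  proof -
    have eq: "indicator {0..} r *\<^sub>R S n r = (\<Sum>k<n. (airy_\<omega> * (\<i> * airy_\<omega>) ^ k * of_real (x ^ k / fact k)) *
        complex_of_real (indicator {0..} r *\<^sub>R (r ^ k * E r)))" for r
      unfolding S_def scaleR_sum_right
      by (intro sum.cong refl) (simp add: scaleR_conv_of_real mult_ac)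
    have int: "integrable lborel (\<lambda>r. complex_of_real (indicator {0..} r *\<^sub>R (r ^ k * E r)))" for k
      unfolding E_def by (rule integrable_of_real[OF airy_moment_integrable])
    show ?thesis unfolding eq
      by (subst Bochner_Integration.integral_sum, rule integrable_mult_right, rule int)
         (simp only: Bochner_Integration.integral_mult_right[OF int] integral_complex_of_real, simp only: airy_moment_def E_def)
  qed
  ultimately have "(\<lambda>n. 1 / pi * Re (\<Sum>k<n. airy_\<omega> * (\<i> * airy_\<omega>) ^ k * of_real (x ^ k / fact k) * of_real (airy_moment k)))
      \<longlonglongrightarrow> airy_Ai x"
    unfolding airy_Ai_eq by (intro tendsto_intros) simp
  moreover have "1 / pi * Re (\<Sum>k<n. airy_\<omega> * (\<i> * airy_\<omega>) ^ k * of_real (x ^ k / fact k) * of_real (airy_moment k))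
     = (\<Sum>k<n. airy_taylor k * x ^ k)" for n
  proof -
    have Re_eq: "Re (c * of_real a * of_real b) = Re c * a * b" for c a b by simp
    show ?thesis unfolding Re_sum Re_eq sum_distrib_left airy_taylor_def
      by (intro sum.cong refl) (simp add: field_simps)
  qed
  ultimately show ?thesis unfolding sums_def by simp
qed

lemma airy_Ai_sol: "airy_Ai = airy_sol (airy_taylor 0) (airy_taylor 1)"
proof
  fix x
  show "airy_Ai x = airy_sol (airy_taylor 0) (airy_taylor 1) x"
    unfolding airy_sol_def airy_taylor_eq[symmetric] by (rule sums_unique[OF airy_Ai_sums])
qed

lemma airy_Ai_0_pos: "airy_Ai 0 > 0"
proof -
  have "airy_Ai 0 = airy_taylor 0" unfolding airy_Ai_sol by (simp add: airy_sol_0)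
  also have "\<dots> > 0" using airy_moment_0_pos by (simp add: airy_taylor_def airy_\<omega>_def)
  finally show ?thesis .
qed

text \<open>For x \<ge> 0 the factor exp (- b x r) of the kernel is at most 1. Boundedness on the
  half line tells Ai apart from the growing solutions; together with the Airy equation and Ai 0 > 0
  it is all that is used of the integral from here on.\<close>

lemma airy_Ai_bounded: "\<exists>K. \<forall>x\<ge>0. \<bar>airy_Ai x\<bar> \<le> K"
proof -
  have "\<bar>airy_Ai x\<bar> \<le> 1 / pi * (norm airy_\<omega> * airy_moment 0)" if "x \<ge> 0" for x
  proof -
    have "norm (\<integral>r. indicator {0..} r *\<^sub>R airy_kernel x r \<partial>lborel) \<le> (\<integral>r. norm (indicator {0..} r *\<^sub>R airy_kernel x r) \<partial>lborel)"
      by (rule integral_norm_bound)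
    also have "\<dots> \<le> (\<integral>r. norm airy_\<omega> * (indicator {0..} r *\<^sub>R (r ^ 0 * exp (- (airy_\<kappa> / 3) * r ^ 3))) \<partial>lborel)"
    proof (rule integral_mono)
      show "integrable lborel (\<lambda>r. norm (indicator {0..} r *\<^sub>R airy_kernel x r))"
        by (rule integrable_norm[OF airy_kernel_integrable])
      show "integrable lborel (\<lambda>r. norm airy_\<omega> * (indicator {0..} r *\<^sub>R (r ^ 0 * exp (- (airy_\<kappa> / 3) * r ^ 3))))"
        by (intro integrable_mult_right airy_moment_integrable)
      fix r
      have "- airy_b * x * r - airy_\<kappa> / 3 * r ^ 3 \<le> - (airy_\<kappa> / 3) * r ^ 3" if "r \<ge> 0"
        using \<open>x \<ge> 0\<close> that airy_b(1) by simp
      then show "norm (indicator {0..} r *\<^sub>R airy_kernel x r) \<le> norm airy_\<omega> * (indicator {0..} r *\<^sub>R (r ^ 0 * exp (- (airy_\<kappa> / 3) * r ^ 3)))"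
        by (auto simp: norm_airy_kernel indicator_def intro!: mult_left_mono)
    qed
    also have "\<dots> = norm airy_\<omega> * airy_moment 0"
      unfolding airy_moment_def
      by (rule Bochner_Integration.integral_mult_right) (rule airy_moment_integrable)
    finally have "norm (\<integral>r. indicator {0..} r *\<^sub>R airy_kernel x r \<partial>lborel) \<le> norm airy_\<omega> * airy_moment 0" .
    with abs_Re_le_cmod have "\<bar>Re (\<integral>r. indicator {0..} r *\<^sub>R airy_kernel x r \<partial>lborel)\<bar> \<le> norm airy_\<omega> * airy_moment 0"
      using order.trans by blast
    then show ?thesis unfolding airy_Ai_eq abs_mult by (simp add: divide_right_mono)
  qed
  then show ?thesis by blast
qed

section \<open>The largest zero of the Airy function\<close>

definition airy_Ai' :: "real \<Rightarrow> real" where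
  "airy_Ai' = airy_sol' (airy_taylor 0) (airy_taylor 1)"

lemma airy_Ai_deriv: "(airy_Ai has_real_derivative airy_Ai' x) (at x)"
  unfolding airy_Ai_sol airy_Ai'_def by (rule airy_sol_deriv)

lemma airy_Ai'_deriv: "(airy_Ai' has_real_derivative x * airy_Ai x) (at x)"
  unfolding airy_Ai_sol airy_Ai'_def by (rule airy_sol'_deriv)

lemma airy_Ai_not_double_zero: "airy_Ai x \<noteq> 0 \<or> airy_Ai' x \<noteq> 0"
  using airy_unique_zero[OF airy_Ai_deriv airy_Ai'_deriv, of x 0] airy_Ai_0_pos by auto

section \<open>Sign, zeros and decay of Ai by monotonicity arguments\<close>

lemma mono_bound_of_deriv:
  fixes f f' :: "real \<Rightarrow> real"
  assumes "\<And>x. (f has_real_derivative f' x) (at x)" "a \<le> b" "\<And>x. a \<le> x \<Longrightarrow> x \<le> b \<Longrightarrow> m \<le> f' x"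
  shows "f a + m * (b - a) \<le> f b"
proof (cases "a = b")
  case False
  then obtain z where z: "a < z" "z < b" "f b - f a = (b - a) * f' z"
    using MVT2[of a b f f'] assms by auto
  have "(b - a) * m \<le> (b - a) * f' z" using z assms by (intro mult_left_mono) auto
  then show ?thesis using z by (simp add: algebra_simps)
qed simp

lemmas mono_of_deriv = mono_bound_of_deriv[where m = 0, simplified]

lemma unbounded_of_deriv:
  fixes f f' :: "real \<Rightarrow> real"
  assumes "\<And>x. (f has_real_derivative f' x) (at x)" "m > 0" "\<And>x. a \<le> x \<Longrightarrow> m \<le> f' x"
  shows "\<exists>x\<ge>a. f x > K"
proof -
  define b where "b = a + (\<bar>K - f a\<bar> + 1) / m"
  have b: "b \<ge> a" "m * (b - a) = \<bar>K - f a\<bar> + 1" using assms(2) by (auto simp: b_def)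
  have "f a + m * (b - a) \<le> f b" by (rule mono_bound_of_deriv[OF assms(1) b(1)]) (use assms in auto)
  then have "f b > K" using b(2) by linarith
  then show ?thesis using b by blast
qed

text \<open>If Ai vanished at x0 \<ge> 0, then w = Ai Ai' would start from 0 with w' = Ai'^2 + x
  Ai^2 \<ge> 0 and soon be positive. As 2 w is the derivative of Ai^2, this square would grow at
  least linearly, against boundedness.\<close>

lemma airy_Ai_nonzero_nonneg:
  assumes "x0 \<ge> 0" shows "airy_Ai x0 \<noteq> 0"
proof
  assume z: "airy_Ai x0 = 0"
  define w where "w x = airy_Ai x * airy_Ai' x" for x
  define w' where "w' x = (airy_Ai' x)\<^sup>2 + x * (airy_Ai x)\<^sup>2" for x
  have w: "(w has_real_derivative w' x) (at x)" for x
    unfolding w_def[abs_def] w'_def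
    by (rule derivative_eq_intros airy_Ai_deriv airy_Ai'_deriv refl)+ (simp add: power2_eq_square)
  have w'_nn: "w' x \<ge> 0" if "x \<ge> x0" for x using that assms by (simp add: w'_def)
  obtain y where y: "x0 < y" "w (x0 + 1) - w x0 = (x0 + 1 - x0) * w' y"
    using MVT2[of x0 "x0 + 1" w w'] w by auto
  have "w' y > 0"
  proof (cases "airy_Ai y = 0")
    case True
    then show ?thesis using airy_Ai_not_double_zero[of y] by (simp add: w'_def)
  next
    case False
    then have "y * (airy_Ai y)\<^sup>2 > 0" using y(1) assms by simp
    then show ?thesis unfolding w'_def by (smt (verit) zero_le_power2)
  qed
  then have w1: "w (x0 + 1) > 0" using y z by (simp add: w_def)
  have mono: "w (x0 + 1) \<le> w x" if "x \<ge> x0 + 1" for x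
    using mono_bound_of_deriv[OF w that, of 0] w'_nn by auto
  have sq: "((\<lambda>x. (airy_Ai x)\<^sup>2) has_real_derivative 2 * w x) (at x)" for x
    unfolding w_def by (rule derivative_eq_intros airy_Ai_deriv refl)+ simp
  obtain K where K: "\<And>x. x \<ge> 0 \<Longrightarrow> \<bar>airy_Ai x\<bar> \<le> K" using airy_Ai_bounded by blast
  obtain x where x: "x \<ge> x0 + 1" "(airy_Ai x)\<^sup>2 > K\<^sup>2"
    using unbounded_of_deriv[OF sq, of "2 * w (x0 + 1)" "x0 + 1" "K\<^sup>2"] w1 mono by auto
  have "\<bar>airy_Ai x\<bar> \<le> K" using K x(1) assms by simp
  then have "\<bar>airy_Ai x\<bar>\<^sup>2 \<le> K\<^sup>2" by (intro power_mono) auto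
  then show False using x(2) by simp
qed

lemma isCont_airy_Ai: "isCont airy_Ai x" "isCont airy_Ai' x"
  using airy_Ai_deriv airy_Ai'_deriv DERIV_isCont by blast+

lemma continuous_pos_of_nonzero:
  fixes f :: "real \<Rightarrow> real"
  assumes "\<And>x. isCont f x" "\<And>x. x \<in> {a..b} \<Longrightarrow> f x \<noteq> 0" "c \<in> {a..b}" "f c > 0" "x \<in> {a..b}"
  shows "f x > 0"
proof (rule ccontr)
  assume "\<not> f x > 0"
  then have le: "f x \<le> 0" by simp
  show False
  proof (cases "x \<le> c")
    case True
    then obtain y where "x \<le> y" "y \<le> c" "f y = 0" using IVT[of f x 0 c] assms le by auto
    then show False using assms by force
  next
    case False
    then obtain y where "c \<le> y" "y \<le> x" "f y = 0" using IVT2[of f x 0 c] assms le by auto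
    then show False using assms by force
  qed
qed

lemma airy_Ai_pos_nonneg: "x \<ge> 0 \<Longrightarrow> airy_Ai x > 0"
  using continuous_pos_of_nonzero[of airy_Ai 0 x 0 x] isCont_airy_Ai airy_Ai_nonzero_nonneg airy_Ai_0_pos
  by auto

text \<open>Suppose Ai > 0 everywhere. If Ai' \<le> 0 on the negative axis, then Ai (-x) \<ge> Ai 0
  there, so the derivative x Ai (-x) of Ai' (-x) is bounded below by a positive number from x = 1
  on, and Ai' (-x) becomes positive. So Ai' x0 > 0 for some x0 < 0; by concavity the slope only
  increases further left, and Ai is driven below 0.\<close>

lemma airy_Ai_has_zero: "\<exists>x. airy_Ai x = 0"
proof (rule ccontr)
  assume nz: "\<nexists>x. airy_Ai x = 0"
  have pos: "airy_Ai x > 0" for x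
    using continuous_pos_of_nonzero[of airy_Ai "min x 0" "max x 0" 0 x] isCont_airy_Ai nz airy_Ai_0_pos by auto
  have "\<exists>x<0. airy_Ai' x > 0"
  proof (rule ccontr)
    assume "\<not> (\<exists>x<0. airy_Ai' x > 0)"
    then have np: "airy_Ai' x \<le> 0" if "x < 0" for x using that not_less by blast
    have dm: "((\<lambda>x. airy_Ai (- x)) has_real_derivative - airy_Ai' (- x)) (at x)" for x
      using DERIV_chain2[OF airy_Ai_deriv[of "- x"] DERIV_minus[OF DERIV_ident]] by simp
    have dm': "((\<lambda>x. airy_Ai' (- x)) has_real_derivative x * airy_Ai (- x)) (at x)" for x
      using DERIV_chain2[OF airy_Ai'_deriv[of "- x"] DERIV_minus[OF DERIV_ident]] by simp
    have 0: "airy_Ai' 0 \<le> 0"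
    proof (rule ccontr)
      assume "\<not> airy_Ai' 0 \<le> 0"
      then have "airy_Ai' 0 > 0" by simp
      then have "\<forall>\<^sub>F x in at 0. airy_Ai' x > 0"
        using isCont_airy_Ai(2)[of 0] by (auto simp: isCont_def dest: order_tendstoD)
      then obtain e where "e > 0" "\<And>x. x \<noteq> 0 \<Longrightarrow> dist x 0 < e \<Longrightarrow> airy_Ai' x > 0"
        by (auto simp: eventually_at)
      from this(2)[of "- e / 2"] \<open>e > 0\<close> show False using np[of "- e / 2"] by auto
    qed
    have ge: "airy_Ai (- x) \<ge> airy_Ai 0" if "x \<ge> 0" for x
    proof -
      have "0 \<le> - airy_Ai' (- y)" if "0 \<le> y" for y
        using np[of "- y"] 0 that by (cases "y = 0") auto
      from mono_bound_of_deriv[OF dm that, of 0] this show ?thesis by auto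
    qed
    have "1 * airy_Ai 0 \<le> x * airy_Ai (- x)" if "x \<ge> 1" for x
      using that ge[of x] airy_Ai_0_pos by (intro mult_mono) auto
    then obtain x where "x \<ge> 1" "airy_Ai' (- x) > 0"
      using unbounded_of_deriv[OF dm', of "airy_Ai 0" 1 0] airy_Ai_0_pos by auto
    then show False using np[of "- x"] by auto
  qed
  then obtain x0 where x0: "x0 < 0" "airy_Ai' x0 > 0" by blast
  have dm: "((\<lambda>x. - airy_Ai (- x)) has_real_derivative airy_Ai' (- x)) (at x)" for x
    by (rule derivative_eq_intros DERIV_chain2[OF airy_Ai_deriv] refl)+ simp
  have dm': "((\<lambda>x. airy_Ai' (- x)) has_real_derivative x * airy_Ai (- x)) (at x)" for x
    using DERIV_chain2[OF airy_Ai'_deriv[of "- x"] DERIV_minus[OF DERIV_ident]] by simp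
  have "airy_Ai' x0 \<le> airy_Ai' (- x)" if "x \<ge> - x0" for x
    using mono_of_deriv[OF dm' that] x0(1) pos by (simp add: less_imp_le)
  then obtain x where "- airy_Ai (- x) > 0"
    using unbounded_of_deriv[OF dm x0(2), of "- x0" 0] by auto
  then show False using pos[of "- x"] by simp
qed

text \<open>The zero set is closed, nonempty and bounded above by 0, so it contains its supremum and
  \<open>GREATEST\<close> is meaningful. To the right of it the sign is constant, hence that of Ai
  0.\<close>

lemma airy_\<alpha>\<^sub>1: "airy_Ai airy_\<alpha>\<^sub>1 = 0" "airy_\<alpha>\<^sub>1 < 0" "x > airy_\<alpha>\<^sub>1 \<Longrightarrow> airy_Ai x > 0"
proof -
  let ?Z = "{x. airy_Ai x = 0}"
  have le0: "x < 0" if "airy_Ai x = 0" for x using airy_Ai_pos_nonneg[of x] that by force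
  have "closed ?Z" using isCont_airy_Ai
    by (intro closed_Collect_eq continuous_at_imp_continuous_on ballI continuous_on_const) auto
  moreover have "?Z \<noteq> {}" using airy_Ai_has_zero by auto
  moreover have bdd: "bdd_above ?Z" using le0 by (intro bdd_aboveI[of _ 0]) (auto intro: less_imp_le)
  ultimately have S: "Sup ?Z \<in> ?Z" by (intro closed_contains_Sup) auto
  have "airy_\<alpha>\<^sub>1 = Sup ?Z"
    unfolding airy_\<alpha>\<^sub>1_def by (rule Greatest_equality) (use S bdd in \<open>auto intro: cSup_upper\<close>)
  then show z: "airy_Ai airy_\<alpha>\<^sub>1 = 0" and neg: "airy_\<alpha>\<^sub>1 < 0" using S le0 by auto
  have nz: "airy_Ai y \<noteq> 0" if "y > airy_\<alpha>\<^sub>1" for y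
    using that cSup_upper[of y ?Z] bdd \<open>airy_\<alpha>\<^sub>1 = Sup ?Z\<close> by auto
  show "airy_Ai x > 0" if "x > airy_\<alpha>\<^sub>1"
  proof (rule continuous_pos_of_nonzero[OF isCont_airy_Ai(1), of "min x 0" "max x 0" 0 x])
    fix y assume "y \<in> {min x 0..max x 0}"
    then show "airy_Ai y \<noteq> 0" using neg that by (intro nz) auto
  qed (use airy_Ai_0_pos in auto)
qed

text \<open>Ai is convex on the half line, so a single positive slope would force unbounded
  growth.\<close>

lemma airy_Ai'_nonpos: assumes "x0 \<ge> 0" shows "airy_Ai' x0 \<le> 0"
proof (rule ccontr)
  assume "\<not> airy_Ai' x0 \<le> 0"
  then have p: "airy_Ai' x0 > 0" by simp
  have "airy_Ai' x0 \<le> airy_Ai' x" if "x \<ge> x0" for x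
    using mono_of_deriv[OF airy_Ai'_deriv that] assms airy_Ai_pos_nonneg by (simp add: less_imp_le)
  moreover obtain K where K: "\<And>x. x \<ge> 0 \<Longrightarrow> \<bar>airy_Ai x\<bar> \<le> K" using airy_Ai_bounded by blast
  ultimately obtain x where "x \<ge> x0" "airy_Ai x > K"
    using unbounded_of_deriv[OF airy_Ai_deriv p, of x0 K] by auto
  then show False using K[of x] assms by auto
qed

lemma compact_bound:
  fixes f :: "real \<Rightarrow> real"
  assumes "continuous_on {a..b} f"
  shows "\<exists>C. \<forall>x\<in>{a..b}. \<bar>f x\<bar> \<le> C"
proof -
  have "bounded (f ` {a..b})" using assms by (intro compact_imp_bounded compact_continuous_image) auto
  then show ?thesis by (auto simp: bounded_iff)
qed

text \<open>Bounds for Ai and its first three derivatives, as Ai'' = x Ai and Ai''' = Ai + x Ai'.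
  For large x, monotonicity of Ai' on [x/2, x] gives x |Ai' x| \<le> 2 K, and the increment of Ai'
  over [x - 1, x] controls x Ai x. The remaining interval is compact.\<close>

lemma airy_Ai_bounds:
  "\<exists>C. \<forall>x\<ge>airy_\<alpha>\<^sub>1. \<bar>airy_Ai x\<bar> \<le> C \<and> \<bar>airy_Ai' x\<bar> \<le> C \<and> \<bar>x * airy_Ai x\<bar> \<le> C \<and> \<bar>x * airy_Ai' x\<bar> \<le> C"
proof -
  obtain K where K: "\<And>x. x \<ge> 0 \<Longrightarrow> \<bar>airy_Ai x\<bar> \<le> K" using airy_Ai_bounded by blast
  have K0: "K \<ge> 0" using K[of 0] by simp
  have d1: "x * \<bar>airy_Ai' x\<bar> \<le> 2 * K" if "x \<ge> 0" for x
  proof -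
    have "airy_Ai (x / 2) + (- airy_Ai x) \<ge> - airy_Ai' x * (x - x / 2)"
    proof -
      have "airy_Ai' y \<le> airy_Ai' x" if "x / 2 \<le> y" "y \<le> x" for y
        using mono_of_deriv[OF airy_Ai'_deriv that(2)] that(1) \<open>x \<ge> 0\<close> airy_Ai_pos_nonneg
        by (simp add: less_imp_le)
      moreover have "((\<lambda>x. - airy_Ai x) has_real_derivative - airy_Ai' x) (at x)" for x
        by (rule derivative_intros airy_Ai_deriv)+
      ultimately show ?thesis
        using mono_bound_of_deriv[of "\<lambda>x. - airy_Ai x" "\<lambda>x. - airy_Ai' x" "x/2" x "- airy_Ai' x"] that by auto
    qed
    then have "x * (- airy_Ai' x) \<le> 2 * airy_Ai (x / 2) - 2 * airy_Ai x" by (simp add: field_simps)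
    also have "\<dots> \<le> 2 * K" using K[of "x / 2"] airy_Ai_pos_nonneg[of x] that by auto
    finally show ?thesis using airy_Ai'_nonpos[OF that] by simp
  qed
  have d2: "\<bar>airy_Ai' x\<bar> \<le> 2 * K" if "x \<ge> 1" for x
    using d1[of x] that mult_right_mono[of 1 x "\<bar>airy_Ai' x\<bar>"] by simp
  have d3: "x * airy_Ai x \<le> 4 * K" if "x \<ge> 2" for x
  proof -
    obtain y where y: "x - 1 < y" "y < x" "airy_Ai' x - airy_Ai' (x - 1) = (x - (x - 1)) * (y * airy_Ai y)"
      using MVT2[of "x - 1" x airy_Ai' "\<lambda>y. y * airy_Ai y"] airy_Ai'_deriv by auto
    have "airy_Ai x \<le> airy_Ai y"
      using mono_bound_of_deriv[of "\<lambda>x. - airy_Ai x" "\<lambda>x. - airy_Ai' x" y x 0] y that airy_Ai'_nonpos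
      by (auto intro!: derivative_intros airy_Ai_deriv)
    then have "(x / 2) * airy_Ai x \<le> y * airy_Ai y"
      using y that airy_Ai_pos_nonneg[of x] by (intro mult_mono) auto
    also have "\<dots> = airy_Ai' x - airy_Ai' (x - 1)" using y by simp
    also have "\<dots> \<le> 2 * K" using airy_Ai'_nonpos[of x] d2[of "x - 1"] that by auto
    finally show ?thesis by simp
  qed
  have cont: "continuous_on A airy_Ai" "continuous_on A airy_Ai'" for A
    using isCont_airy_Ai by (auto intro: continuous_at_imp_continuous_on)
  obtain C1 where C1: "\<forall>x\<in>{airy_\<alpha>\<^sub>1..2}. \<bar>airy_Ai x\<bar> \<le> C1" using compact_bound[OF cont(1)] by blast
  obtain C2 where C2: "\<forall>x\<in>{airy_\<alpha>\<^sub>1..2}. \<bar>airy_Ai' x\<bar> \<le> C2" using compact_bound[OF cont(2)] by blast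
  obtain C3 where C3: "\<forall>x\<in>{airy_\<alpha>\<^sub>1..2}. \<bar>x * airy_Ai x\<bar> \<le> C3"
    using compact_bound[OF continuous_on_mult[OF continuous_on_id cont(1)]] by blast
  obtain C4 where C4: "\<forall>x\<in>{airy_\<alpha>\<^sub>1..2}. \<bar>x * airy_Ai' x\<bar> \<le> C4"
    using compact_bound[OF continuous_on_mult[OF continuous_on_id cont(2)]] by blast
  define C where "C = Max {C1, C2, C3, C4, 4 * K}"
  have C: "C1 \<le> C" "C2 \<le> C" "C3 \<le> C" "C4 \<le> C" "4 * K \<le> C" by (auto simp: C_def)
  have "\<bar>airy_Ai x\<bar> \<le> C \<and> \<bar>airy_Ai' x\<bar> \<le> C \<and> \<bar>x * airy_Ai x\<bar> \<le> C \<and> \<bar>x * airy_Ai' x\<bar> \<le> C"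
    if x: "x \<ge> airy_\<alpha>\<^sub>1" for x
  proof (cases "x \<le> 2")
    case True
    then show ?thesis using C1 C2 C3 C4 C x by (meson atLeastAtMost_iff order.trans)
  next
    case False
    then have "\<bar>airy_Ai x\<bar> \<le> K" "\<bar>airy_Ai' x\<bar> \<le> 2 * K" "x * airy_Ai x \<le> 4 * K" "x * \<bar>airy_Ai' x\<bar> \<le> 2 * K" "airy_Ai x > 0"
      using K d2 d3 d1 airy_Ai_pos_nonneg by auto
    then show ?thesis using C(5) K0 False by (auto simp: abs_mult)
  qed
  then show ?thesis by blast
qed

text \<open>The third derivative is controlled only between z and z + d, because the test functions
  have bounded derivatives on part of the line only.\<close>

lemma taylor_cubic:
  fixes f f1 f2 f3 :: "real \<Rightarrow> real"
  assumes "\<And>x. (f has_real_derivative f1 x) (at x)" "\<And>x. (f1 has_real_derivative f2 x) (at x)"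
    "\<And>x. (f2 has_real_derivative f3 x) (at x)"
    and "\<And>x. min z (z + d) \<le> x \<Longrightarrow> x \<le> max z (z + d) \<Longrightarrow> \<bar>f3 x\<bar> \<le> C"
  shows "\<bar>f (z + d) - (f z + f1 z * d + f2 z * d\<^sup>2 / 2)\<bar> \<le> C * \<bar>d\<bar> ^ 3"
proof (cases "d = 0")
  case False
  define diff where "diff m = (if m = 0 then f else if m = 1 then f1 else if m = 2 then f2 else f3)" for m :: nat
  have dd: "\<forall>m t. m < 3 \<and> min z (z + d) \<le> t \<and> t \<le> max z (z + d) \<longrightarrow> (diff m has_real_derivative diff (Suc m) t) (at t)"
  proof (intro allI impI)
    fix m :: nat and t :: real
    assume "m < 3 \<and> min z (z + d) \<le> t \<and> t \<le> max z (z + d)"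
    then have "m = 0 \<or> m = 1 \<or> m = 2" by auto
    then show "(diff m has_real_derivative diff (Suc m) t) (at t)"
      using assms(1-3) by (auto simp: diff_def)
  qed
  obtain t where t: "if z + d < z then z + d < t \<and> t < z else z < t \<and> t < z + d"
    "f (z + d) = (\<Sum>m<3. (diff m z / fact m) * (z + d - z) ^ m) + (diff 3 t / fact 3) * (z + d - z) ^ 3"
    using Taylor[of 3 diff f "min z (z + d)" "max z (z + d)" z "z + d"] dd False by (auto simp: diff_def)
  have "f (z + d) - (f z + f1 z * d + f2 z * d\<^sup>2 / 2) = f3 t / 6 * d ^ 3"
    using t(2) by (simp add: diff_def eval_nat_numeral)
  then have "\<bar>f (z + d) - (f z + f1 z * d + f2 z * d\<^sup>2 / 2)\<bar> = \<bar>f3 t\<bar> / 6 * \<bar>d\<bar> ^ 3"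
    by (simp only: abs_mult power_abs abs_divide abs_numeral)
  also have "\<dots> \<le> C * \<bar>d\<bar> ^ 3"
  proof (rule mult_right_mono)
    have "\<bar>f3 t\<bar> \<le> C" by (rule assms(4)) (use t(1) in \<open>auto split: if_splits\<close>)
    then show "\<bar>f3 t\<bar> / 6 \<le> C" by linarith
  qed simp
  finally show ?thesis .
qed simp

section \<open>Supersolutions and subsolutions\<close>

text \<open>The shift by \<open>\<delta>\<close> keeps the Airy function positive slightly to the left of the killing
  boundary; the constant \<open>\<kappa>\<close> bounds the supersolution from below at infinity.\<close>

lemma airy_supersolution:
  assumes "\<delta> > 0"
  obtains P P1 P2 :: "real \<Rightarrow> real" and \<kappa> C Z r where
    "\<kappa> > 0" "r > 0" "C \<ge> 0" "Z \<ge> 0" "\<And>x. isCont P x"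
    "\<And>z d. z \<ge> airy_\<alpha>\<^sub>1 - r \<Longrightarrow> z + d \<ge> airy_\<alpha>\<^sub>1 \<Longrightarrow> P (z + d) \<le> P z + P1 z * d + P2 z * d\<^sup>2 / 2 + C * \<bar>d\<bar> ^ 3"
    "\<And>z d. z \<ge> airy_\<alpha>\<^sub>1 - r \<Longrightarrow> z + d < airy_\<alpha>\<^sub>1 \<Longrightarrow> 0 \<le> P z + P1 z * d + P2 z * d\<^sup>2 / 2 + C * \<bar>d\<bar> ^ 3"
    "\<And>z. z \<ge> airy_\<alpha>\<^sub>1 - r \<Longrightarrow> \<kappa> \<le> P z"
    "\<And>z. z \<ge> airy_\<alpha>\<^sub>1 - r \<Longrightarrow> P2 z \<le> (min z Z + 2 * \<delta>) * P z"
    "\<And>z z' \<eta>. z \<ge> airy_\<alpha>\<^sub>1 \<Longrightarrow> z' \<ge> airy_\<alpha>\<^sub>1 - r \<Longrightarrow> \<eta> \<le> 1 / 2 \<Longrightarrow> \<bar>z' - z\<bar> \<le> \<eta> * (1 + \<bar>z\<bar>) \<Longrightarrow> P z' \<le> P z + C * \<eta>"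
proof -
  obtain C0 where C0: "\<And>x. x \<ge> airy_\<alpha>\<^sub>1 \<Longrightarrow> \<bar>airy_Ai x\<bar> \<le> C0 \<and> \<bar>airy_Ai' x\<bar> \<le> C0 \<and> \<bar>x * airy_Ai x\<bar> \<le> C0 \<and> \<bar>x * airy_Ai' x\<bar> \<le> C0"
    using airy_Ai_bounds by blast
  have C0_nn: "C0 \<ge> 0" using C0[of airy_\<alpha>\<^sub>1] abs_ge_zero order.trans by blast
  have nn: "airy_Ai x \<ge> 0" if "x \<ge> airy_\<alpha>\<^sub>1" for x
    using airy_\<alpha>\<^sub>1 that by (cases "x = airy_\<alpha>\<^sub>1") (auto simp: less_imp_le)
  define a where "a = airy_\<alpha>\<^sub>1"
  have a: "a < 0" using airy_\<alpha>\<^sub>1 by (simp add: a_def)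
  \<comment> \<open>A lower bound for the shifted Ai where its argument is negative; there the term
    x \<kappa> produced by the added constant has the wrong sign.\<close>
  obtain m where m: "m > 0" "\<And>x. x \<ge> a + \<delta> / 2 \<Longrightarrow> x \<le> 0 \<Longrightarrow> m \<le> airy_Ai x"
  proof (cases "a + \<delta> / 2 \<le> 0")
    case True
    have "continuous_on {a + \<delta> / 2..0} airy_Ai" using isCont_airy_Ai by (auto intro: continuous_at_imp_continuous_on)
    then obtain x0 where x0: "x0 \<in> {a + \<delta> / 2..0}" "\<And>y. y \<in> {a + \<delta> / 2..0} \<Longrightarrow> airy_Ai x0 \<le> airy_Ai y"
      using continuous_attains_inf[of "{a + \<delta> / 2..0}" airy_Ai] True by auto
    have "airy_Ai x0 > 0" using x0(1) assms by (intro airy_\<alpha>\<^sub>1) (auto simp: a_def)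
    then show ?thesis using that[of "airy_Ai x0"] x0(2) by auto
  next
    case False
    then show ?thesis using that[of 1] by auto
  qed
  \<comment> \<open>With x = z + \<delta>, the eigenvalue inequality x Ai x \<le> (x + \<delta>) (Ai
    x + \<kappa>) reduces to 0 \<le> \<delta> Ai x + (x + \<delta>) \<kappa>. For x < 0 the first
    term is at least \<delta> m and the second at least - (|a| + 1) \<kappa>.\<close>
  define \<kappa> where "\<kappa> = \<delta> * m / (\<bar>a\<bar> + 1)"
  have \<kappa>: "\<kappa> > 0" "\<kappa> * (\<bar>a\<bar> + 1) = \<delta> * m" using assms m by (auto simp: \<kappa>_def)
  \<comment> \<open>Room for the coordinate to slip below a when scale and barrier move in one step;
    half of the shift \<delta> is kept in reserve.\<close>
  define r where "r = \<delta> / 2"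
  have r: "r > 0" using assms by (simp add: r_def)
  \<comment> \<open>2 C0 bounds the third derivative of P, the quotients by powers of \<delta> pay
    for jumps of length at least \<delta> / 2, and the terms added in C serve the Lipschitz
    estimate.\<close>
  define C1 where "C1 = C0 + C0 + C0 * 4 / \<delta>\<^sup>2 + C0 * 2 / \<delta> + C0 + C0"
  define C where "C = C1 + 2 * (2 + \<delta>) * C0 + 2 * C0"
  \<comment> \<open>P2 is bounded by C0 = Z \<kappa> \<le> Z P, so beyond Z the coordinate may be
    capped in the eigenvalue inequality.\<close>
  define Z where "Z = C0 / \<kappa>"
  define P where "P z = airy_Ai (z + \<delta>) + \<kappa>" for z
  define P1 where "P1 z = airy_Ai' (z + \<delta>)" for z
  define P2 where "P2 z = (z + \<delta>) * airy_Ai (z + \<delta>)" for z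
  define P3 where "P3 z = airy_Ai (z + \<delta>) + (z + \<delta>) * airy_Ai' (z + \<delta>)" for z
  have sh: "((\<lambda>z. z + \<delta>) has_real_derivative 1) (at x)" for x by (auto intro!: derivative_eq_intros)
  have P: "(P has_real_derivative P1 x) (at x)" for x
    unfolding P_def[abs_def] P1_def using DERIV_add[OF DERIV_chain2[OF airy_Ai_deriv sh] DERIV_const] by simp
  have P1: "(P1 has_real_derivative P2 x) (at x)" for x
    unfolding P1_def[abs_def] P2_def using DERIV_chain2[OF airy_Ai'_deriv sh] by simp
  have P2: "(P2 has_real_derivative P3 x) (at x)" for x
    unfolding P2_def[abs_def] P3_def
    by (rule DERIV_cong[OF DERIV_mult'[OF sh DERIV_chain2[OF airy_Ai_deriv sh]]]) simp
  have P_low: "\<kappa> \<le> P z" if "z \<ge> a - \<delta>" for z using nn[of "z + \<delta>"] that by (simp add: P_def a_def)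
  have b1: "\<bar>P1 z\<bar> \<le> C0" "\<bar>P2 z\<bar> \<le> C0" "\<bar>P3 z\<bar> \<le> 2 * C0" if "z \<ge> a - \<delta>" for z
    using C0[of "z + \<delta>"] that by (auto simp: P1_def P2_def P3_def a_def)
  have C1: "2 * C0 \<le> C1" "C0 * 4 / \<delta>\<^sup>2 + C0 * 2 / \<delta> \<le> C1" using C0_nn assms by (auto simp: C1_def)
  have C: "C1 \<le> C" "2 * (2 + \<delta>) * C0 + 2 * C0 \<le> C" "0 \<le> C" using C0_nn assms C1 by (auto simp: C_def)
  have taylor: "\<bar>P (z + d) - (P z + P1 z * d + P2 z * d\<^sup>2 / 2)\<bar> \<le> C * \<bar>d\<bar> ^ 3" if "z \<ge> a - \<delta>" "z + d \<ge> a - \<delta>" for z d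
  proof -
    have "\<bar>P (z + d) - (P z + P1 z * d + P2 z * d\<^sup>2 / 2)\<bar> \<le> (2 * C0) * \<bar>d\<bar> ^ 3"
      by (rule taylor_cubic[OF P P1 P2]) (use that b1(3) in \<open>auto simp: min_def split: if_splits\<close>)
    also have "\<dots> \<le> C * \<bar>d\<bar> ^ 3" using C1 C by (intro mult_right_mono) auto
    finally show ?thesis .
  qed
  \<comment> \<open>The walk is killed below a, so the Taylor majorant only has to be nonnegative.
    Either the landing point is still in the region where P is positive and the Taylor estimate
    holds, or |d| \<ge> \<delta> / 2 and the cubic term absorbs the linear and quadratic
    ones.\<close>
  have out: "0 \<le> P z + P1 z * d + P2 z * d\<^sup>2 / 2 + C * \<bar>d\<bar> ^ 3" if "z \<ge> a - r" "z + d < a" for z d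
  proof (cases "z + d \<ge> a - \<delta>")
    case True
    then show ?thesis using taylor[of z d] P_low[of "z + d"] \<kappa> that r by (auto simp: r_def)
  next
    case False
    then have d: "\<bar>d\<bar> \<ge> \<delta> / 2" using that by (auto simp: r_def)
    have zz: "z \<ge> a - \<delta>" using that r by (simp add: r_def)
    have e1: "\<bar>d\<bar> * 1 \<le> \<bar>d\<bar> * (\<bar>d\<bar>\<^sup>2 * (4 / \<delta>\<^sup>2))"
    proof (rule mult_left_mono)
      have "(\<delta> / 2)\<^sup>2 \<le> \<bar>d\<bar>\<^sup>2" using d assms by (intro power_mono) auto
      then show "1 \<le> \<bar>d\<bar>\<^sup>2 * (4 / \<delta>\<^sup>2)" using assms by (simp add: field_simps power_divide)
    qed simp
    have e2: "\<bar>d\<bar>\<^sup>2 * 1 \<le> \<bar>d\<bar>\<^sup>2 * (\<bar>d\<bar> * (2 / \<delta>))"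
      by (rule mult_left_mono) (use d assms in \<open>auto simp: field_simps\<close>)
    have "\<bar>P1 z * d\<bar> \<le> C0 * (\<bar>d\<bar> * (\<bar>d\<bar>\<^sup>2 * (4 / \<delta>\<^sup>2)))"
      unfolding abs_mult using b1[OF zz] e1 by (intro mult_mono) (auto simp: C0_nn)
    moreover have "\<bar>P2 z * d\<^sup>2 / 2\<bar> \<le> C0 * (\<bar>d\<bar>\<^sup>2 * (\<bar>d\<bar> * (2 / \<delta>)))"
    proof -
      have "\<bar>P2 z * d\<^sup>2 / 2\<bar> \<le> \<bar>P2 z\<bar> * \<bar>d\<bar>\<^sup>2" by (simp add: abs_mult)
      also have "\<dots> \<le> C0 * (\<bar>d\<bar>\<^sup>2 * (\<bar>d\<bar> * (2 / \<delta>)))"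
        using b1[OF zz] e2 by (intro mult_mono) (auto simp: C0_nn)
      finally show ?thesis .
    qed
    moreover have "C0 * (\<bar>d\<bar> * (\<bar>d\<bar>\<^sup>2 * (4 / \<delta>\<^sup>2))) + C0 * (\<bar>d\<bar>\<^sup>2 * (\<bar>d\<bar> * (2 / \<delta>))) = (C0 * 4 / \<delta>\<^sup>2 + C0 * 2 / \<delta>) * \<bar>d\<bar> ^ 3"
      by (simp add: power2_eq_square power3_eq_cube algebra_simps)
    moreover have "(C0 * 4 / \<delta>\<^sup>2 + C0 * 2 / \<delta>) * \<bar>d\<bar> ^ 3 \<le> C * \<bar>d\<bar> ^ 3"
      using C1 C by (intro mult_right_mono) auto
    ultimately show ?thesis using P_low[OF zz] \<kappa>(1) by linarith
  qed
  have super: "P2 z \<le> (min z Z + 2 * \<delta>) * P z" if "z \<ge> a - r" for z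
  proof (cases "z \<le> Z")
    case True
    define x where "x = z + \<delta>"
    have x: "x \<ge> a + \<delta> / 2" using that by (simp add: x_def r_def)
    have "0 \<le> \<delta> * airy_Ai x + (x + \<delta>) * \<kappa>"
    proof (cases "x \<ge> 0")
      case True
      then show ?thesis using x nn[of x] \<kappa> assms by (intro add_nonneg_nonneg mult_nonneg_nonneg) (auto simp: a_def)
    next
      case False
      then have "\<delta> * m \<le> \<delta> * airy_Ai x" using m x assms by simp
      moreover have "(x + \<delta>) * \<kappa> \<ge> - (\<bar>a\<bar> + 1) * \<kappa>" using x assms \<kappa> by (intro mult_right_mono) auto
      ultimately show ?thesis using \<kappa>(2) by (simp add: algebra_simps)
    qed
    moreover have eq: "min z Z = x - \<delta>" "P z = airy_Ai x + \<kappa>" "P2 z = x * airy_Ai x"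
      using True by (simp_all add: x_def P_def P2_def)
    ultimately show ?thesis unfolding eq by (simp add: algebra_simps)
  next
    case False
    have zz: "z \<ge> a - \<delta>" using that r by (simp add: r_def)
    have "P2 z \<le> C0" using b1(2)[OF zz] by simp
    also have "\<dots> = Z * \<kappa>" using \<kappa> by (simp add: Z_def)
    also have "\<dots> \<le> (min z Z + 2 * \<delta>) * P z"
      using False P_low[OF zz] \<kappa> C0_nn assms by (intro mult_mono) (auto simp: Z_def)
    finally show ?thesis .
  qed
  \<comment> \<open>A change of scale moves z by an amount proportional to |z|, so an ordinary
    Lipschitz bound is not enough. The decay of Ai' makes |P1 y| (1 + |z|) bounded, where \<eta>
    \<le> 1/2 keeps the intermediate point y comparable to z.\<close>
  have lip: "P z' \<le> P z + C * \<eta>" if z: "z \<ge> a" "z' \<ge> a - r" "\<eta> \<le> 1 / 2" "\<bar>z' - z\<bar> \<le> \<eta> * (1 + \<bar>z\<bar>)" for z z' \<eta>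
  proof -
    have \<eta>: "\<eta> \<ge> 0"
    proof (rule ccontr)
      assume "\<not> \<eta> \<ge> 0"
      then have "\<eta> * (1 + \<bar>z\<bar>) < 0" by (intro mult_neg_pos) auto
      then show False using z(4) by linarith
    qed
    obtain y where y: "min z z' \<le> y" "y \<le> max z z'" "P z' - P z = P1 y * (z' - z)"
    proof (cases z z' rule: linorder_cases)
      case less
      then obtain y where "z < y" "y < z'" "P z' - P z = (z' - z) * P1 y" using MVT2[of z z' P P1] P by auto
      then show ?thesis using that[of y] by (simp add: mult.commute)
    next
      case greater
      then obtain y where "z' < y" "y < z" "P z - P z' = (z - z') * P1 y" using MVT2[of z' z P P1] P by auto
      then show ?thesis using that[of y] by (simp add: algebra_simps)
    qed (use that[of z] in simp)
    have yy: "y \<ge> a - \<delta>" using y(1) z r by (auto simp: r_def min_def split: if_splits)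
    have "\<bar>y - z\<bar> \<le> \<bar>z' - z\<bar>" using y by (auto simp: min_def max_def split: if_splits)
    also have "\<dots> \<le> 1 / 2 * (1 + \<bar>z\<bar>)" using z(3,4) mult_right_mono[of \<eta> "1/2" "1 + \<bar>z\<bar>"] by linarith
    finally have "\<bar>y - z\<bar> \<le> 1 / 2 * (1 + \<bar>z\<bar>)" .
    moreover have "\<bar>z\<bar> \<le> \<bar>y - z\<bar> + \<bar>y\<bar>" "\<bar>y\<bar> \<le> \<bar>y + \<delta>\<bar> + \<delta>" using assms by auto
    ultimately have "1 + \<bar>z\<bar> \<le> 2 * (2 + \<delta>) + 2 * \<bar>y + \<delta>\<bar>" using assms by argo
    then have "\<bar>P1 y\<bar> * (1 + \<bar>z\<bar>) \<le> \<bar>P1 y\<bar> * (2 * (2 + \<delta>) + 2 * \<bar>y + \<delta>\<bar>)" by (intro mult_left_mono) auto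
    also have "\<dots> = 2 * (2 + \<delta>) * \<bar>P1 y\<bar> + 2 * \<bar>(y + \<delta>) * airy_Ai' (y + \<delta>)\<bar>"
      unfolding P1_def abs_mult by (simp add: algebra_simps)
    also have "\<dots> \<le> 2 * (2 + \<delta>) * C0 + 2 * C0"
      using b1(1)[OF yy] C0[of "y + \<delta>"] yy assms by (intro add_mono mult_left_mono) (auto simp: a_def)
    also have "\<dots> \<le> C" by (rule C)
    finally have *: "\<bar>P1 y\<bar> * (1 + \<bar>z\<bar>) \<le> C" .
    have "P z' - P z \<le> \<bar>P1 y\<bar> * \<bar>z' - z\<bar>" unfolding y(3) abs_mult[symmetric] by simp
    also have "\<dots> \<le> \<bar>P1 y\<bar> * (\<eta> * (1 + \<bar>z\<bar>))" using z(4) by (intro mult_left_mono) auto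
    also have "\<dots> = (\<bar>P1 y\<bar> * (1 + \<bar>z\<bar>)) * \<eta>" by simp
    also have "\<dots> \<le> C * \<eta>" using * \<eta> by (intro mult_right_mono)
    finally show ?thesis by simp
  qed
  show ?thesis
  proof (rule that[of \<kappa> r C Z P P1 P2])
    show "isCont P x" for x using P DERIV_isCont by blast
    show "P (z + d) \<le> P z + P1 z * d + P2 z * d\<^sup>2 / 2 + C * \<bar>d\<bar> ^ 3"
      if "z \<ge> airy_\<alpha>\<^sub>1 - r" "z + d \<ge> airy_\<alpha>\<^sub>1" for z d
      using taylor[of z d] that r assms by (auto simp: a_def r_def)
    show "0 \<le> Z" using C0_nn \<kappa> by (simp add: Z_def)
    show "\<kappa> \<le> P z" if "z \<ge> airy_\<alpha>\<^sub>1 - r" for z using P_low[of z] that r by (simp add: a_def r_def)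
  qed (use \<kappa> r C out super lip in \<open>auto simp: a_def\<close>)
qed

text \<open>Sturm comparison with u x = Ai (x + \<delta>), which solves u'' = (x + \<delta>) u,
  vanishes at a and is positive afterwards. If v had no further zero it would be positive too, so w
  = v u' - v' u would increase from 0, having derivative \<delta> u v; and (v / u)' = - w /
  u^2.\<close>

lemma airy_comparison_zero:
  assumes "\<delta> > 0"
    and v: "\<And>x. (v has_real_derivative v1 x) (at x)" "\<And>x. (v1 has_real_derivative x * v x) (at x)"
    and a: "a = airy_\<alpha>\<^sub>1 - \<delta>" "v a = 0" "v1 a = 1"
  shows "\<exists>x>a. v x = 0"
proof (rule ccontr)
  assume "\<not> (\<exists>x>a. v x = 0)"
  then have nz: "v x \<noteq> 0" if "x > a" for x using that by blast
  have cont: "isCont v x" for x using v DERIV_isCont by blast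
  obtain e where e: "e > 0" "\<And>h. 0 < h \<Longrightarrow> h < e \<Longrightarrow> v a < v (a + h)"
    using DERIV_pos_inc_right[OF v(1)[of a]] a(3) by auto
  have pos: "v x > 0" if "x > a" for x
  proof -
    define c where "c = a + min (e / 2) (x - a)"
    have c: "c > a" "c \<le> x" "c < a + e" using e(1) that by (auto simp: c_def)
    then have "v c > 0" using e(2)[of "c - a"] a(2) by auto
    with c show ?thesis using nz
      by (intro continuous_pos_of_nonzero[OF cont, of c x c x]) auto
  qed
  define u where "u x = airy_Ai (x + \<delta>)" for x
  define u1 where "u1 x = airy_Ai' (x + \<delta>)" for x
  have sh: "((\<lambda>z. z + \<delta>) has_real_derivative 1) (at x)" for x by (auto intro!: derivative_eq_intros)
  have u: "(u has_real_derivative u1 x) (at x)" for x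
    unfolding u_def[abs_def] u1_def using DERIV_chain2[OF airy_Ai_deriv sh] by simp
  have u1: "(u1 has_real_derivative (x + \<delta>) * u x) (at x)" for x
    unfolding u_def u1_def[abs_def] using DERIV_chain2[OF airy_Ai'_deriv sh] by simp
  have u_pos: "u x > 0" if "x > a" for x unfolding u_def using that a(1) by (intro airy_\<alpha>\<^sub>1) simp
  have u_a: "u a = 0" using airy_\<alpha>\<^sub>1 by (simp add: u_def a(1))
  obtain K where K: "\<And>x. x \<ge> airy_\<alpha>\<^sub>1 \<Longrightarrow> \<bar>airy_Ai x\<bar> \<le> K" using airy_Ai_bounds by blast
  have u_le: "u x \<le> K" if "x > a" for x using K[of "x + \<delta>"] that a(1) by (simp add: u_def)
  have K: "K > 0" using u_le[of "a + 1"] u_pos[of "a + 1"] by simp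
  define w where "w x = v x * u1 x - v1 x * u x" for x
  have w: "(w has_real_derivative \<delta> * u x * v x) (at x)" for x
    unfolding w_def[abs_def] by (rule derivative_eq_intros v u u1 refl)+ (simp add: algebra_simps)
  have w_mono: "w x \<le> w y" if "a \<le> x" "x \<le> y" for x y
  proof (rule mono_of_deriv[OF w that(2)])
    fix z assume "x \<le> z"
    then show "0 \<le> \<delta> * u z * v z" using that assms(1) u_pos[of z] pos[of z] u_a
      by (cases "z = a") (auto intro!: mult_nonneg_nonneg less_imp_le)
  qed
  have w1: "w (a + 1) > 0"
  proof -
    obtain z where z: "a < z" "w (a + 1) - w a = (a + 1 - a) * (\<delta> * u z * v z)"
      using MVT2[of a "a + 1" w "\<lambda>x. \<delta> * u x * v x"] w by auto
    then show ?thesis using u_pos[of z] pos[of z] assms(1) u_a a(2) by (simp add: w_def)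
  qed
  text \<open>The quotient \<open>v / u\<close> decreases at a uniform rate since \<open>u\<close> is bounded.\<close>
  define q where "q x = v x / u x" for x
  have q: "(q has_real_derivative - w x / (u x)\<^sup>2) (at x)" if "x > a" for x
    unfolding q_def[abs_def] w_def
    by (rule derivative_eq_intros v u refl)+ (use u_pos[OF that] in \<open>simp_all add: power2_eq_square algebra_simps\<close>)
  have rate: "- w x / (u x)\<^sup>2 \<le> - w (a + 1) / K\<^sup>2" if "x \<ge> a + 1" for x
  proof -
    have "w (a + 1) / K\<^sup>2 \<le> w x / (u x)\<^sup>2"
      using w_mono[of "a + 1" x] that w1 u_pos[of x] u_le[of x]
      by (intro frac_le power_mono) auto
    then show ?thesis by simp
  qed
  \<comment> \<open>At this point the decrease at rate w (a + 1) / K^2 amounts to q (a + 1) + 1,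
    which makes q negative.\<close>
  define b where "b = a + 1 + (q (a + 1) + 1) * K\<^sup>2 / w (a + 1)"
  have qp: "q (a + 1) > 0" using pos u_pos by (simp add: q_def)
  have b: "b > a + 1" using qp K w1 by (simp add: b_def)
  obtain z where z: "a + 1 < z" "q b - q (a + 1) = (b - (a + 1)) * (- w z / (u z)\<^sup>2)"
    using MVT2[OF b, of q "\<lambda>x. - w x / (u x)\<^sup>2"] q by auto
  have "q b - q (a + 1) \<le> (b - (a + 1)) * (- w (a + 1) / K\<^sup>2)"
    unfolding z(2) using b z(1) rate by (intro mult_left_mono) auto
  also have "\<dots> = - (q (a + 1) + 1)" using K w1 by (simp add: b_def)
  finally have "q b < 0" by simp
  moreover have "q b > 0" using pos[of b] u_pos[of b] b by (simp add: q_def)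
  ultimately show False by simp
qed

text \<open>Adding the square of \<open>v\<close> makes the second derivative positive at the zeros of \<open>v\<close>,
  where the slack \<open>\<delta> v\<close> in the eigenvalue vanishes.\<close>

lemma airy_subsolution:
  assumes "\<delta> > 0" and a_def: "a = airy_\<alpha>\<^sub>1 - \<delta>"
  obtains P P1 P2 :: "real \<Rightarrow> real" and B C r \<delta>' where
    "a < B" "r > 0" "C \<ge> 0" "\<delta>' > 0" "\<And>x. isCont P x"
    "\<And>z d. z \<in> {a - r..B + r} \<Longrightarrow> z + d \<in> {a..B} \<Longrightarrow> P z + P1 z * d + P2 z * d\<^sup>2 / 2 - C * \<bar>d\<bar> ^ 3 \<le> P (z + d)"
    "\<And>z d. z \<in> {a - r..B + r} \<Longrightarrow> z + d \<notin> {a..B} \<Longrightarrow> P z + P1 z * d + P2 z * d\<^sup>2 / 2 - C * \<bar>d\<bar> ^ 3 \<le> 0"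
    "\<And>z. z \<in> {a - r..B + r} \<Longrightarrow> \<bar>P z\<bar> \<le> C"
    "\<And>z. z \<in> {a<..<B} \<Longrightarrow> 0 < P z" "P a = 0" "P B = 0"
    "\<And>z. z \<in> {a - r..B + r} \<Longrightarrow> (z - \<delta>) * P z + \<delta>' \<le> P2 z"
    "\<And>z z'. z \<in> {a..B} \<Longrightarrow> z' \<in> {a - r..B + r} \<Longrightarrow> \<bar>P z' - P z\<bar> \<le> C * \<bar>z' - z\<bar>"
proof -
  obtain v v1 where v: "\<And>x. (v has_real_derivative v1 x) (at x)" "\<And>x. (v1 has_real_derivative x * v x) (at x)"
    and va: "v a = 0" "v1 a = 1" using airy_solution_exists[of a] by blast
  have vc: "isCont v x" "isCont v1 x" for x using v DERIV_isCont by blast+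
  have nd: "v x \<noteq> 0 \<or> v1 x \<noteq> 0" for x
  proof (rule ccontr)
    assume "\<not> (v x \<noteq> 0 \<or> v1 x \<noteq> 0)"
    then have "v = (\<lambda>_. 0)" using airy_unique_zero[OF v, of x] by auto
    then show False using DERIV_unique[OF v(1)[of a], of 0] va by simp
  qed
  obtain z0 where z0: "z0 > a" "v z0 = 0" using airy_comparison_zero[OF assms(1) v a_def va] by blast
  obtain e where e: "e > 0" "\<And>h. 0 < h \<Longrightarrow> h < e \<Longrightarrow> v a < v (a + h)"
    using DERIV_pos_inc_right[OF v(1)[of a]] va(2) by auto
  obtain e' where e': "e' > 0" "\<And>h. 0 < h \<Longrightarrow> h < e' \<Longrightarrow> v (a - h) < v a"
    using DERIV_pos_inc_left[OF v(1)[of a]] va(2) by auto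
  \<comment> \<open>The zero a itself is cut off: v is positive on (a, a + e), so starting at a + e
    / 2 loses no zero and gives a closed set whose infimum is the next zero B.\<close>
  define S where "S = {x \<in> {a + e / 2..z0}. v x = 0}"
  have z0e: "z0 \<ge> a + e"
  proof (rule ccontr)
    assume "\<not> z0 \<ge> a + e"
    then have "v a < v (a + (z0 - a))" using z0 by (intro e(2)) auto
    then show False using z0 va by simp
  qed
  have "closed S" unfolding S_def Collect_conj_eq Collect_mem_eq using vc
    by (intro closed_Int closed_Collect_eq continuous_at_imp_continuous_on ballI continuous_on_const) auto
  moreover have "z0 \<in> S" using z0e z0 e by (simp add: S_def)
  moreover have bdd: "bdd_below S" by (rule bdd_belowI[of _ "a + e / 2"]) (simp add: S_def)
  ultimately have S: "Inf S \<in> S" by (intro closed_contains_Inf) auto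
  define B where "B = Inf S"
  have B: "B > a" "v B = 0" using S e(1) by (auto simp: B_def S_def)
  have Bz0: "B \<le> z0" using S by (auto simp: B_def S_def)
  have v_nz: "v x \<noteq> 0" if "a < x" "x < B" for x
  proof
    assume vx: "v x = 0"
    show False
    proof (cases "x < a + e")
      case True
      then show False using e(2)[of "x - a"] vx va that by auto
    next
      case False
      then have "x \<in> S" using vx that Bz0 e(1) by (auto simp: S_def)
      then show False using cInf_lower[OF _ bdd, of x] that by (simp add: B_def)
    qed
  qed
  have v_pos: "v x > 0" if "a < x" "x < B" for x
  proof -
    define c where "c = a + min (e / 2) (x - a)"
    have c: "c > a" "c \<le> x" "c < a + e" using e(1) that by (auto simp: c_def)
    then have "v c > 0" using e(2)[of "c - a"] va(1) by auto
    with c show ?thesis using v_nz that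
      by (intro continuous_pos_of_nonzero[OF vc(1), of c x c x]) auto
  qed
  have v_nn: "v x \<ge> 0" if "x \<in> {a..B}" for x
    using v_pos[of x] that va B by (cases "x = a \<or> x = B") auto
  have v1B: "v1 B < 0"
  proof (rule ccontr)
    assume "\<not> v1 B < 0"
    then have "v1 B > 0" using nd[of B] B by simp
    then obtain d where d: "d > 0" "\<And>h. 0 < h \<Longrightarrow> h < d \<Longrightarrow> v (B - h) < v B"
      using DERIV_pos_inc_left[OF v(1)[of B]] by auto
    define h where "h = min (d / 2) ((B - a) / 2)"
    have "0 < h" "h < d" "a < B - h" using d B by (auto simp: h_def min_def field_simps)
    then show False using d(2)[of h] v_pos[of "B - h"] B by simp
  qed
  obtain s' where s': "s' > 0" "\<And>h. 0 < h \<Longrightarrow> h < s' \<Longrightarrow> v (B + h) < v B"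
    using DERIV_neg_dec_right[OF v(1)[of B] v1B] by auto
  have vcont: "continuous_on A v" "continuous_on A v1" for A
    using vc by (auto intro: continuous_at_imp_continuous_on)
  obtain V where V: "\<And>x. x \<in> {a - 1..B + 1} \<Longrightarrow> \<bar>v x\<bar> \<le> V" using compact_bound[OF vcont(1)] by blast
  have V0: "V \<ge> 0" using V[of a] B by simp
  \<comment> \<open>The first bound gives \<eta> |v| \<le> 1/2, so P = v (1 + \<eta> v) has the sign
    of v. The second keeps \<eta> x v^2, negative for x < 0, above - \<delta> v / 2, so half of the
    slack \<delta> v survives.\<close>
  define \<eta> where "\<eta> = min (1 / (2 * (V + 1))) (\<delta> / (2 * (\<bar>a\<bar> + 1) * (V + 1)))"
  have \<eta>: "\<eta> > 0" using V0 assms(1) by (auto simp: \<eta>_def intro!: divide_pos_pos mult_pos_pos)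
  have \<eta>1: "\<eta> * V \<le> 1 / 2"
  proof -
    have "\<eta> * V \<le> 1 / (2 * (V + 1)) * (V + 1)" using V0 \<eta> by (intro mult_mono) (auto simp: \<eta>_def)
    also have "\<dots> = 1 / 2" using V0 by simp
    finally show ?thesis .
  qed
  have \<eta>2: "\<eta> * \<bar>a\<bar> * V \<le> \<delta> / 2"
  proof -
    have "\<eta> * (\<bar>a\<bar> * V) \<le> \<delta> / (2 * (\<bar>a\<bar> + 1) * (V + 1)) * ((\<bar>a\<bar> + 1) * (V + 1))"
      using V0 \<eta> assms(1) by (intro mult_mono) (auto simp: \<eta>_def)
    also have "\<dots> = \<delta> / 2"
    proof -
      have "\<delta> / (2 * A * W) * (A * W) = \<delta> / 2" if "A > 0" "W > 0" for A W using that by simp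
      then show ?thesis using V0 by (meson abs_ge_zero add_nonneg_pos zero_less_one)
    qed
    finally show ?thesis by (simp add: mult.assoc)
  qed
  define P where "P x = v x + \<eta> * (v x)\<^sup>2" for x
  define P1 where "P1 x = v1 x + 2 * \<eta> * (v x * v1 x)" for x
  define P2 where "P2 x = x * v x + 2 * \<eta> * ((v1 x)\<^sup>2 + x * (v x)\<^sup>2)" for x
  define P3 where "P3 x = v x + x * v1 x + 2 * \<eta> * (2 * v1 x * (x * v x) + ((v x)\<^sup>2 + x * (2 * v x * v1 x)))" for x
  have P: "(P has_real_derivative P1 x) (at x)" for x
    unfolding P_def[abs_def] P1_def by (rule derivative_eq_intros v refl)+ simp
  have P1: "(P1 has_real_derivative P2 x) (at x)" for x
    unfolding P1_def[abs_def] P2_def by (rule derivative_eq_intros v refl)+ (simp add: power2_eq_square algebra_simps)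
  have P2: "(P2 has_real_derivative P3 x) (at x)" for x
    unfolding P2_def[abs_def] P3_def by (rule derivative_eq_intros v refl)+ (simp add: power2_eq_square algebra_simps)
  have Pc: "isCont P x" "isCont P1 x" "isCont P2 x" for x using P P1 P2 DERIV_isCont by blast+
  have P_fact: "P x = v x * (1 + \<eta> * v x)" for x by (simp add: P_def power2_eq_square algebra_simps)
  have P_sgn: "P x \<le> 0" if "v x \<le> 0" "x \<in> {a - 1..B + 1}" for x
  proof -
    have "\<eta> * \<bar>v x\<bar> \<le> \<eta> * V" using V[OF that(2)] \<eta> by simp
    then have "\<eta> * v x \<ge> - 1 / 2" using \<eta>1 that(1) by simp
    then show ?thesis unfolding P_fact using that(1) by (intro mult_nonpos_nonneg) auto
  qed
  define D where "D x = P2 x - (x - \<delta>) * P x" for x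
  have D_eq: "D x = 2 * \<eta> * (v1 x)\<^sup>2 + \<eta> * x * (v x)\<^sup>2 + \<delta> * v x + \<delta> * \<eta> * (v x)\<^sup>2" for x
    by (simp add: D_def P_def P2_def algebra_simps)
  have D_pos: "D x > 0" if "x \<in> {a..B}" for x
  proof -
    have vx: "0 \<le> v x" "v x \<le> V" using v_nn[OF that] V[of x] that by auto
    have "- (\<delta> / 2) * v x \<le> \<eta> * x * v x * v x"
    proof (rule mult_right_mono[OF _ vx(1)])
      have "(- x) * v x \<le> \<bar>a\<bar> * V" using that vx by (intro mult_mono) auto
      then have "\<eta> * ((- x) * v x) \<le> \<eta> * (\<bar>a\<bar> * V)" using \<eta> by (intro mult_left_mono) auto
      then show "- (\<delta> / 2) \<le> \<eta> * x * v x" using \<eta>2 by (simp add: mult.assoc)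
    qed
    then have "D x \<ge> 2 * \<eta> * (v1 x)\<^sup>2 + \<delta> / 2 * v x + \<delta> * \<eta> * (v x)\<^sup>2"
      unfolding D_eq by (simp add: power2_eq_square algebra_simps)
    moreover have "2 * \<eta> * (v1 x)\<^sup>2 + \<delta> / 2 * v x + \<delta> * \<eta> * (v x)\<^sup>2 > 0"
    proof (cases "v x = 0")
      case True
      then show ?thesis using nd[of x] \<eta> by simp
    next
      case False
      then show ?thesis using \<eta> assms(1) vx by (intro add_nonneg_pos add_nonneg_nonneg mult_pos_pos) auto
    qed
    ultimately show ?thesis by linarith
  qed
  have Dc: "isCont D x" for x unfolding D_def[abs_def] using Pc by (intro continuous_intros) auto
  obtain xm where xm: "xm \<in> {a..B}" "\<And>y. y \<in> {a..B} \<Longrightarrow> D xm \<le> D y"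
  proof -
    have "continuous_on {a..B} D" using Dc by (intro continuous_at_imp_continuous_on) auto
    then show ?thesis using continuous_attains_inf[of "{a..B}" D] B(1) that by fastforce
  qed
  \<comment> \<open>Half of the minimum over [a, B], so that the bound persists by continuity a
    little outside the interval.\<close>
  define \<delta>' where "\<delta>' = D xm / 2"
  have \<delta>': "\<delta>' > 0" using D_pos[OF xm(1)] by (simp add: \<delta>'_def)
  have near: "\<exists>s>0. \<forall>y. \<bar>y - x\<bar> < s \<longrightarrow> D y \<ge> \<delta>'" if "x \<in> {a..B}" for x
  proof -
    have "D x > \<delta>'" using xm(2)[OF that] \<delta>' by (simp add: \<delta>'_def)
    then have "\<forall>\<^sub>F y in at x. D y > \<delta>'" using Dc[of x] by (auto simp: isCont_def dest: order_tendstoD)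
    then obtain s where s: "s > 0" "\<And>y. y \<noteq> x \<Longrightarrow> dist y x < s \<Longrightarrow> D y > \<delta>'" by (auto simp: eventually_at)
    have "D y \<ge> \<delta>'" if "\<bar>y - x\<bar> < s" for y
      using s(2)[of y] \<open>D x > \<delta>'\<close> that by (cases "y = x") (auto simp: dist_real_def)
    then show ?thesis using s(1) by blast
  qed
  obtain sa where sa: "sa > 0" "\<And>y. \<bar>y - a\<bar> < sa \<Longrightarrow> D y \<ge> \<delta>'" using near[of a] B by auto
  obtain sb where sb: "sb > 0" "\<And>y. \<bar>y - B\<bar> < sb \<Longrightarrow> D y \<ge> \<delta>'" using near[of B] B by auto
  \<comment> \<open>Within 4 r of the end points the gap D stays above \<delta>' and v is negative
    on the outer side; 4 r \<le> 1 keeps everything where the compactness bounds hold.\<close>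
  define r where "r = Min {1, sa, sb, e', s'} / 4"
  have r: "r > 0" "4 * r \<le> 1" "4 * r \<le> sa" "4 * r \<le> sb" "4 * r \<le> e'" "4 * r \<le> s'"
    using sa sb e' s' by (auto simp: r_def)
  have D_ge: "D x \<ge> \<delta>'" if "x \<in> {a - r..B + r}" for x
  proof -
    consider "x \<in> {a..B}" | "x < a" | "x > B" by fastforce
    then show ?thesis
    proof cases
      case 1
      then show ?thesis using xm(2)[of x] D_pos[OF xm(1)] by (simp add: \<delta>'_def)
    qed (use that sa(2)[of x] sb(2)[of x] r in auto)
  qed
  have v_out: "v x \<le> 0" if "x \<in> {a - 2 * r..B + 2 * r}" "x \<notin> {a..B}" for x
    using that e'(2)[of "a - x"] s'(2)[of "x - B"] r va B by (cases "x < a") auto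
  have cont: "continuous_on A P" "continuous_on A P1" "continuous_on A P2" "continuous_on A P3" for A
    using Pc unfolding P3_def
    by (auto intro!: continuous_intros vcont intro: continuous_at_imp_continuous_on)
  obtain K0 where K0: "\<And>x. x \<in> {a - 1..B + 1} \<Longrightarrow> \<bar>P x\<bar> \<le> K0" using compact_bound[OF cont(1)] by blast
  obtain K1 where K1: "\<And>x. x \<in> {a - 1..B + 1} \<Longrightarrow> \<bar>P1 x\<bar> \<le> K1" using compact_bound[OF cont(2)] by blast
  obtain K2 where K2: "\<And>x. x \<in> {a - 1..B + 1} \<Longrightarrow> \<bar>P2 x\<bar> \<le> K2" using compact_bound[OF cont(3)] by blast
  obtain K3 where K3: "\<And>x. x \<in> {a - 1..B + 1} \<Longrightarrow> \<bar>P3 x\<bar> \<le> K3" using compact_bound[OF cont(4)] by blast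
  have Knn: "0 \<le> K0" "0 \<le> K1" "0 \<le> K2" "0 \<le> K3"
    using K0[of a] K1[of a] K2[of a] K3[of a] B by auto
  \<comment> \<open>The summands without quotient bound P, its slope and its third derivative; those
    divided by powers of r turn P, P1 d and P2 d^2 into multiples of |d|^3 when |d| \<ge> r.\<close>
  define C where "C = K0 + K1 + K3 + K0 / r ^ 3 + K1 / r\<^sup>2 + K2 / r"
  have C: "K0 \<le> C" "K1 \<le> C" "K3 \<le> C" "K0 / r ^ 3 + K1 / r\<^sup>2 + K2 / r \<le> C" "0 \<le> C"
    using Knn r(1) by (auto simp: C_def)
  have taylor: "\<bar>P (z + d) - (P z + P1 z * d + P2 z * d\<^sup>2 / 2)\<bar> \<le> C * \<bar>d\<bar> ^ 3"
    if "z \<in> {a - 1..B + 1}" "z + d \<in> {a - 1..B + 1}" for z d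
    by (rule taylor_cubic[OF P P1 P2], rule order.trans[OF K3 C(3)])
       (use that in \<open>auto simp: min_def max_def split: if_splits\<close>)
  \<comment> \<open>Landing outside [a, B] the test function is 0. Up to 2 r outside, P is
    nonpositive and the Taylor estimate applies; further out |d| \<ge> r and the cubic term
    dominates.\<close>
  have out: "P z + P1 z * d + P2 z * d\<^sup>2 / 2 - C * \<bar>d\<bar> ^ 3 \<le> 0"
    if "z \<in> {a - r..B + r}" "z + d \<notin> {a..B}" for z d
  proof (cases "z + d \<in> {a - 2 * r..B + 2 * r}")
    case True
    then have "P (z + d) \<le> 0" using that v_out[of "z + d"] r by (intro P_sgn) auto
    moreover have "\<bar>P (z + d) - (P z + P1 z * d + P2 z * d\<^sup>2 / 2)\<bar> \<le> C * \<bar>d\<bar> ^ 3"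
      by (rule taylor) (use True that r in auto)
    ultimately show ?thesis by linarith
  next
    case False
    then have d: "\<bar>d\<bar> \<ge> r" using that by auto
    have z: "z \<in> {a - 1..B + 1}" using that r by auto
    have p3: "1 \<le> \<bar>d\<bar> ^ 3 / r ^ 3" using d r(1) power_mono[of r "\<bar>d\<bar>" 3] by simp
    have p2: "\<bar>d\<bar> \<le> \<bar>d\<bar> ^ 3 / r\<^sup>2"
    proof -
      have "r\<^sup>2 * \<bar>d\<bar> \<le> \<bar>d\<bar>\<^sup>2 * \<bar>d\<bar>" using d r(1) by (intro mult_right_mono power_mono) auto
      then show ?thesis using r(1) by (simp add: field_simps power3_eq_cube power2_eq_square)
    qed
    have p1: "\<bar>d\<bar>\<^sup>2 \<le> \<bar>d\<bar> ^ 3 / r"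
    proof -
      have "r * \<bar>d\<bar>\<^sup>2 \<le> \<bar>d\<bar> * \<bar>d\<bar>\<^sup>2" using d by (intro mult_right_mono) auto
      then show ?thesis using r(1) by (simp add: field_simps power3_eq_cube power2_eq_square)
    qed
    have "\<bar>P z\<bar> \<le> K0 * (\<bar>d\<bar> ^ 3 / r ^ 3)" using K0[OF z] mult_left_mono[OF p3 Knn(1)] by simp
    moreover have "\<bar>P1 z * d\<bar> \<le> K1 * (\<bar>d\<bar> ^ 3 / r\<^sup>2)"
      unfolding abs_mult using K1[OF z] p2 Knn by (intro mult_mono) auto
    moreover have "\<bar>P2 z * d\<^sup>2 / 2\<bar> \<le> K2 * (\<bar>d\<bar> ^ 3 / r)"
    proof -
      have "\<bar>P2 z * d\<^sup>2 / 2\<bar> \<le> \<bar>P2 z\<bar> * \<bar>d\<bar>\<^sup>2" by (simp add: abs_mult)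
      also have "\<dots> \<le> K2 * (\<bar>d\<bar> ^ 3 / r)" using K2[OF z] p1 Knn by (intro mult_mono) auto
      finally show ?thesis .
    qed
    moreover have "K0 * (\<bar>d\<bar> ^ 3 / r ^ 3) + K1 * (\<bar>d\<bar> ^ 3 / r\<^sup>2) + K2 * (\<bar>d\<bar> ^ 3 / r) \<le> C * \<bar>d\<bar> ^ 3"
      using mult_right_mono[OF C(4), of "\<bar>d\<bar> ^ 3"] by (simp add: algebra_simps)
    ultimately show ?thesis by linarith
  qed
  have lip: "\<bar>P z' - P z\<bar> \<le> C * \<bar>z' - z\<bar>" if "z \<in> {a - 1..B + 1}" "z' \<in> {a - 1..B + 1}" for z z'
  proof -
    have "\<bar>P y - P x\<bar> \<le> C * \<bar>y - x\<bar>" if xy: "x < y" "x \<in> {a - 1..B + 1}" "y \<in> {a - 1..B + 1}" for x y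
    proof -
      obtain t where t: "x < t" "t < y" "P y - P x = (y - x) * P1 t" using MVT2[of x y P P1] P xy(1) by auto
      have "\<bar>P1 t\<bar> \<le> C" using K1[of t] C t xy by auto
      then have "\<bar>y - x\<bar> * \<bar>P1 t\<bar> \<le> \<bar>y - x\<bar> * C" by (intro mult_left_mono) auto
      then show ?thesis unfolding t(3) abs_mult by (simp add: mult.commute)
    qed
    from this[of z z'] this[of z' z] that show ?thesis
      by (cases z z' rule: linorder_cases) (auto simp: abs_minus_commute)
  qed
  show ?thesis
  proof (rule that[of B r C \<delta>' P P1 P2])
    show "P z + P1 z * d + P2 z * d\<^sup>2 / 2 - C * \<bar>d\<bar> ^ 3 \<le> P (z + d)"
      if "z \<in> {a - r..B + r}" "z + d \<in> {a..B}" for z d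
      using taylor[of z d] that r by auto
    show "\<bar>P z\<bar> \<le> C" if "z \<in> {a - r..B + r}" for z using K0[of z] C that r by auto
    show "0 < P z" if "z \<in> {a<..<B}" for z
      unfolding P_fact using v_pos[of z] that \<eta> by (intro mult_pos_pos add_pos_nonneg) auto
    show "(z - \<delta>) * P z + \<delta>' \<le> P2 z" if "z \<in> {a - r..B + r}" for z
      using D_ge[OF that] by (simp add: D_def)
    show "\<bar>P z' - P z\<bar> \<le> C * \<bar>z' - z\<bar>" if "z \<in> {a..B}" "z' \<in> {a - r..B + r}" for z z'
      by (rule lip) (use that r in auto)
  qed (use B r C \<delta>' Pc out va in \<open>auto simp: P_def\<close>)
qed

section \<open>Absolutely continuous functions\<close>

lemma interval_content_eq:
  assumes "(x, k) \<in> p" "p tagged_division_of s"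
  shows "measure lborel k = Sup k - Inf (k::real set)" "measure lebesgue k = Sup k - Inf k"
proof -
  obtain u v where "k = cbox u v" using tagged_division_ofD(4)[OF assms(2,1)] by blast
  moreover have "x \<in> k" by (rule tagged_division_ofD(2)[OF assms(2,1)])
  ultimately show "measure lborel k = Sup k - Inf k" "measure lebesgue k = Sup k - Inf k"
    by (auto simp: content_real)
qed

lemma ae_derivative_negligible:
  assumes "ae_derivative a b h h'"
  obtains N where "negligible N" "N \<subseteq> {a..b}" "\<And>t. t \<in> {a..b} - N \<Longrightarrow> (h has_real_derivative h' t) (at t within {a..b})"
proof -
  obtain N where N: "{t. \<not> (t \<in> {a..b} \<longrightarrow> (h has_real_derivative h' t) (at t within {a..b}))} \<subseteq> N" "N \<in> null_sets lborel"
    using assms unfolding ae_derivative_def by (auto elim!: AE_E simp: null_sets_def)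
  then have "negligible (N \<inter> {a..b})"
    by (intro negligible_Int) (simp add: negligible_iff_null_sets null_sets_completionI)
  then show ?thesis using N(1) that[of "N \<inter> {a..b}"] by blast
qed

text \<open>The fundamental theorem of calculus, read off a gauge. At tags where the derivative
  exists, the straddle estimate from the tag to both end points costs e1 times the length. The
  exceptional tags carry the value 0 and small balls inside an open set of small measure, so
  absolute continuity bounds the increments of h over their intervals.\<close>

theorem has_integral_absolutely_continuous:
  fixes h h' :: "real \<Rightarrow> real"
  assumes ab: "a \<le> b" and ac: "absolutely_continuous_fun a b h" and der: "ae_derivative a b h h'"
  shows "(h' has_integral (h b - h a)) {a..b}"
proof -
  obtain N where neg: "negligible N"
    and N: "\<And>t. t \<in> {a..b} - N \<Longrightarrow> (h has_real_derivative h' t) (at t within {a..b})"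
    using ae_derivative_negligible[OF der] by metis
  define f where "f t = (if t \<in> N then 0 else h' t)" for t
  have "(f has_integral (h b - h a)) (cbox a b)"
    unfolding has_integral
  proof (intro allI impI)
    fix e :: real assume e: "e > 0"
    define e1 where "e1 = e / (2 * (b - a + 1))"
    have e1: "e1 > 0" "e1 * (b - a) < e / 2" using e ab by (auto simp: e1_def field_simps)
    obtain d0 where d0: "d0 > 0" "\<And>d s. d division_of s \<Longrightarrow> s \<subseteq> {a..b} \<Longrightarrow> (\<Sum>k\<in>d. Sup k - Inf k) < d0 \<Longrightarrow>
        (\<Sum>k\<in>d. \<bar>h (Sup k) - h (Inf k)\<bar>) < e / 2"
      using ac e unfolding absolutely_continuous_fun_def by (metis half_gt_zero)
    have Nnull: "N \<in> null_sets lebesgue" using neg by (simp add: negligible_iff_null_sets)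
    then have "N \<in> sets lebesgue" by auto
    \<comment> \<open>Intervals tagged in N will lie in U, so their total length is below the
      threshold d0 of absolute continuity.\<close>
    then obtain U where U: "open U" "N \<subseteq> U" "U - N \<in> lmeasurable" "emeasure lebesgue (U - N) < ennreal d0"
      using sets_lebesgue_outer_open d0(1) by metis
    have "U \<in> sets lebesgue" using U(1) by simp
    have mU: "emeasure lebesgue U < ennreal d0"
    proof -
      have "emeasure lebesgue U = emeasure lebesgue (U - N)"
        by (rule emeasure_Diff_null_set[symmetric, OF Nnull \<open>U \<in> sets lebesgue\<close>])
      then show ?thesis using U(4) by simp
    qed
    have "\<exists>\<rho>>0. (x \<in> N \<longrightarrow> ball x \<rho> \<subseteq> U) \<and> (x \<in> {a..b} - N \<longrightarrow>
        (\<forall>y\<in>{a..b}. \<bar>y - x\<bar> < \<rho> \<longrightarrow> \<bar>h y - h x - h' x * (y - x)\<bar> \<le> e1 * \<bar>y - x\<bar>))" for x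
    proof (cases "x \<in> N")
      case True
      then show ?thesis using U(1,2) by (meson DiffE openE subsetD)
    next
      case False
      show ?thesis
      proof (cases "x \<in> {a..b}")
        case True
        then have "(h has_derivative (*) (h' x)) (at x within {a..b})"
          using False N by (simp add: has_field_derivative_def)
        then have "\<exists>\<rho>>0. \<forall>y\<in>{a..b}. norm (y - x) < \<rho> \<longrightarrow> norm (h y - h x - h' x * (y - x)) \<le> e1 * norm (y - x)"
          unfolding has_derivative_within_alt using e1(1) by blast
        then show ?thesis using False by auto
      qed (use False in \<open>auto intro: exI[of _ 1]\<close>)
    qed
    then obtain \<rho> where \<rho>: "\<And>x. \<rho> x > 0" "\<And>x. x \<in> N \<Longrightarrow> ball x (\<rho> x) \<subseteq> U"
      "\<And>x y. x \<in> {a..b} - N \<Longrightarrow> y \<in> {a..b} \<Longrightarrow> \<bar>y - x\<bar> < \<rho> x \<Longrightarrow> \<bar>h y - h x - h' x * (y - x)\<bar> \<le> e1 * \<bar>y - x\<bar>"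
      by metis
    show "\<exists>\<gamma>. gauge \<gamma> \<and> (\<forall>\<D>. \<D> tagged_division_of cbox a b \<and> \<gamma> fine \<D> \<longrightarrow>
        norm ((\<Sum>(x, k)\<in>\<D>. measure lborel k *\<^sub>R f x) - (h b - h a)) < e)"
    proof (intro exI conjI allI impI)
      show "gauge (\<lambda>x. ball x (\<rho> x))" using \<rho>(1) by (simp add: gauge_def)
      fix D assume D: "D tagged_division_of cbox a b \<and> (\<lambda>x. ball x (\<rho> x)) fine D"
      then have tag: "D tagged_division_of {a..b}" and fine: "(\<lambda>x. ball x (\<rho> x)) fine D" by auto
      note Dp = tagged_division_ofD[OF tag]
      \<comment> \<open>The value 0 at the empty set is required for summing over intervals instead
        of tagged intervals: intervals with empty interior must contribute nothing.\<close>
      define \<Delta> where "\<Delta> k = (if k = {} then 0 else h (Sup k) - h (Inf k))" for k :: "real set"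
      define Bad where "Bad = {(x, k) \<in> D. x \<in> N}"
      have Bad: "Bad \<subseteq> D" by (auto simp: Bad_def)
      have fin: "finite D" "finite Bad" using Dp(1) Bad finite_subset by auto
      have tele: "h b - h a = (\<Sum>(x, k)\<in>D. \<Delta> k)"
        unfolding additive_tagged_division_1[OF ab tag, of h, symmetric]
        by (intro sum.cong refl) (auto simp: \<Delta>_def dest: Dp(2))
      have "(\<Sum>(x, k)\<in>D. measure lborel k *\<^sub>R f x) - (h b - h a) = (\<Sum>(x, k)\<in>D. measure lborel k * f x - \<Delta> k)"
        unfolding tele by (simp add: sum_subtractf case_prod_unfold)
      also have "\<dots> = (\<Sum>(x, k)\<in>D - Bad. measure lborel k * f x - \<Delta> k) + (\<Sum>(x, k)\<in>Bad. measure lborel k * f x - \<Delta> k)"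
        using sum.subset_diff[OF Bad fin(1)] by simp
      also have "(\<Sum>(x, k)\<in>Bad. measure lborel k * f x - \<Delta> k) = - (\<Sum>(x, k)\<in>Bad. \<Delta> k)"
        unfolding sum_negf[symmetric] by (intro sum.cong refl) (auto simp: Bad_def f_def)
      finally have split: "(\<Sum>(x, k)\<in>D. measure lborel k *\<^sub>R f x) - (h b - h a) =
          (\<Sum>(x, k)\<in>D - Bad. measure lborel k * f x - \<Delta> k) - (\<Sum>(x, k)\<in>Bad. \<Delta> k)" by simp
      have "\<bar>\<Sum>(x, k)\<in>D - Bad. measure lborel k * f x - \<Delta> k\<bar> \<le> (\<Sum>(x, k)\<in>D - Bad. e1 * measure lborel k)"
      proof (rule order.trans[OF sum_abs], rule sum_mono, clarify)
        fix x k assume xk: "(x, k) \<in> D" "(x, k) \<notin> Bad"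
        then have xN: "x \<notin> N" by (auto simp: Bad_def)
        obtain u v where k: "k = cbox u v" using Dp(4)[OF xk(1)] by blast
        have xk': "x \<in> k" "k \<subseteq> {a..b}" "k \<subseteq> ball x (\<rho> x)"
          using Dp(2,3)[OF xk(1)] fine xk(1) by (auto simp: fine_def)
        then have uv: "u \<le> x" "x \<le> v" by (auto simp: k)
        then have uv': "Sup k = v" "Inf k = u" "measure lborel k = v - u" "k \<noteq> {}" by (auto simp: k)
        have mem: "u \<in> k" "v \<in> k" using uv by (auto simp: k)
        then have "u \<in> {a..b}" "v \<in> {a..b}" "\<bar>u - x\<bar> < \<rho> x" "\<bar>v - x\<bar> < \<rho> x"
          using xk'(2,3) by (auto simp: dist_real_def abs_minus_commute)
        moreover have "x \<in> {a..b} - N" using xk' xN by auto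
        ultimately have "\<bar>h u - h x - h' x * (u - x)\<bar> \<le> e1 * (x - u)" "\<bar>h v - h x - h' x * (v - x)\<bar> \<le> e1 * (v - x)"
          using \<rho>(3)[of x u] \<rho>(3)[of x v] uv by auto
        moreover have "measure lborel k * f x - \<Delta> k = (h u - h x - h' x * (u - x)) - (h v - h x - h' x * (v - x))"
          using xN by (simp only: uv' \<Delta>_def f_def if_False) (simp add: algebra_simps)
        ultimately show "\<bar>measure lborel k * f x - \<Delta> k\<bar> \<le> e1 * measure lborel k"
          unfolding uv' by (simp add: algebra_simps abs_le_iff)
      qed
      also have "\<dots> \<le> (\<Sum>(x, k)\<in>D. e1 * measure lborel k)"
        using e1(1) fin by (intro sum_mono2) auto
      also have "\<dots> = e1 * (b - a)"
        using additive_content_tagged_division[of D a b] D ab by (simp add: sum_distrib_left[symmetric] case_prod_unfold)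
      finally have good: "\<bar>\<Sum>(x, k)\<in>D - Bad. measure lborel k * f x - \<Delta> k\<bar> < e / 2" using e1(2) by simp
      \<comment> \<open>The badly tagged intervals form a division of their union, which is the form
        in which absolute continuity can be applied.\<close>
      have "Bad tagged_partial_division_of {a..b}"
        using tagged_partial_division_subset[OF _ Bad] tag unfolding tagged_division_of_def by blast
      then have tagB: "Bad tagged_division_of \<Union>(snd ` Bad)" by (rule tagged_partial_division_of_Union_self)
      note divB = division_of_tagged_division[OF tagB]
      have subB: "\<Union>(snd ` Bad) \<subseteq> {a..b}" using Dp(3) by (force simp: Bad_def)
      have subU: "\<Union>(snd ` Bad) \<subseteq> U"
      proof clarify
        fix y x k assume "y \<in> snd (x, k)" "(x, k) \<in> Bad"
        then have "y \<in> ball x (\<rho> x)" "x \<in> N" using fineD[OF fine, of x k] by (auto simp: Bad_def)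
        then show "y \<in> U" using \<rho>(2) by blast
      qed
      have "(\<Sum>k\<in>snd ` Bad. Sup k - Inf k) = (\<Sum>k\<in>snd ` Bad. measure lebesgue k)"
      proof (intro sum.cong refl, clarify)
        fix x k assume "(x, k) \<in> Bad"
        from interval_content_eq(2)[OF this tagB] show "Sup (snd (x, k)) - Inf (snd (x, k)) = measure lebesgue (snd (x, k))"
          by simp
      qed
      also have "\<dots> = measure lebesgue (\<Union>(snd ` Bad))" by (rule content_division[OF divB])
      also have "\<dots> < d0"
      proof -
        have "emeasure lebesgue (\<Union>(snd ` Bad)) \<le> emeasure lebesgue U"
          using subU \<open>U \<in> sets lebesgue\<close> by (intro emeasure_mono) auto
        then have "emeasure lebesgue (\<Union>(snd ` Bad)) < ennreal d0" using mU by simp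
        then have "enn2real (emeasure lebesgue (\<Union>(snd ` Bad))) < d0"
          using d0(1) order.strict_trans[OF _ ennreal_less_top] by (subst enn2real_less_iff) auto
        then show ?thesis unfolding measure_def .
      qed
      finally have "(\<Sum>k\<in>snd ` Bad. \<bar>h (Sup k) - h (Inf k)\<bar>) < e / 2" by (rule d0(2)[OF divB subB])
      also have "(\<Sum>k\<in>snd ` Bad. \<bar>h (Sup k) - h (Inf k)\<bar>) = (\<Sum>(x, k)\<in>Bad. \<bar>\<Delta> k\<bar>)"
      proof -
        have "(\<Sum>(x, k)\<in>Bad. \<bar>\<Delta> k\<bar>) = (\<Sum>k\<in>snd ` Bad. \<bar>\<Delta> k\<bar>)"
        proof (rule sum.over_tagged_division_lemma[OF tagB])
          fix u v :: real assume "box u v = {}"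
          then show "\<bar>\<Delta> (cbox u v)\<bar> = 0" by (cases "u = v") (auto simp: \<Delta>_def)
        qed
        also have "\<dots> = (\<Sum>k\<in>snd ` Bad. \<bar>h (Sup k) - h (Inf k)\<bar>)"
          by (intro sum.cong refl) (auto simp: \<Delta>_def Bad_def dest: Dp(2))
        finally show ?thesis by simp
      qed
      finally have "\<bar>\<Sum>(x, k)\<in>Bad. \<Delta> k\<bar> < e / 2"
        unfolding case_prod_unfold by (rule order.strict_trans1[OF sum_abs])
      then show "norm ((\<Sum>(x, k)\<in>D. measure lborel k *\<^sub>R f x) - (h b - h a)) < e"
        unfolding split using good by simp
    qed
  qed
  then have "(f has_integral (h b - h a)) {a..b}" by simp
  from has_integral_spike[OF neg _ this, of h'] show ?thesis by (auto simp: f_def)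
qed

lemma absolutely_continuous_fun_subinterval:
  "absolutely_continuous_fun a b h \<Longrightarrow> a \<le> c \<Longrightarrow> d \<le> b \<Longrightarrow> absolutely_continuous_fun c d h"
  unfolding absolutely_continuous_fun_def by (meson atLeastatMost_subset_iff order.trans)

lemma ae_derivative_subinterval:
  assumes "ae_derivative a b h h'" "a \<le> c" "d \<le> b"
  shows "ae_derivative c d h h'"
  using assms(1) unfolding ae_derivative_def
  by eventually_elim (use assms(2,3) in \<open>auto intro: DERIV_subset\<close>)

text \<open>Moving a single tag within its interval keeps the division fine, and both Riemann sums
  are within 1 of the integral; so f x times the length of the interval is bounded in terms of the
  old tag. Intervals of length 0 say nothing, which accounts for the finite exceptional set.\<close>

lemma riemann_integrable_bounded:
  fixes f :: "real \<Rightarrow> real"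
  assumes "riemann_integrable a b f"
  shows "\<exists>H F. finite F \<and> (\<forall>x\<in>{a..b} - F. \<bar>f x\<bar> \<le> H)"
proof -
  obtain I \<delta> where \<delta>: "\<delta> > 0" "\<And>p. p tagged_division_of {a..b} \<Longrightarrow> (\<lambda>x. ball x \<delta>) fine p \<Longrightarrow>
        \<bar>(\<Sum>(x, k)\<in>p. (Sup k - Inf k) * f x) - I\<bar> < 1"
    using assms unfolding riemann_integrable_def by (metis zero_less_one)
  \<comment> \<open>Half the radius: any point of an interval may then replace its tag without
    violating fineness for \<delta>.\<close>
  have "gauge (\<lambda>x::real. ball x (\<delta> / 2))" using \<delta>(1) by (simp add: gauge_def)
  then obtain p where p: "p tagged_division_of {a..b}" "(\<lambda>x. ball x (\<delta> / 2)) fine p"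
    by (rule fine_division_exists_real)
  note pD = tagged_division_ofD[OF p(1)]
  define F where "F = Inf ` {k \<in> snd ` p. Sup k = Inf k}"
  define B where "B t k = (2 + \<bar>(Sup k - Inf k) * f t\<bar>) / (Sup k - Inf k)" for t and k :: "real set"
  have "finite F" using pD(1) by (simp add: F_def)
  moreover have "\<bar>f x\<bar> \<le> (\<Sum>(t, k)\<in>p. \<bar>B t k\<bar>)" if x: "x \<in> {a..b} - F" for x
  proof -
    have "x \<in> \<Union>{K. \<exists>x. (x, K) \<in> p}" using x pD(6) by simp
    then obtain t k where tk: "(t, k) \<in> p" "x \<in> k" by blast
    obtain u v where k: "k = cbox u v" using pD(4)[OF tk(1)] by blast
    have uv: "u \<le> x" "x \<le> v" using tk(2) by (auto simp: k)
    then have SI: "Sup k = v" "Inf k = u" by (auto simp: k)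
    have "u < v"
    proof (rule ccontr)
      assume "\<not> u < v"
      then have "u = v" "x = u" using uv by auto
      moreover have "k \<in> snd ` p" using tk(1) by force
      ultimately have "x \<in> F" unfolding F_def using SI by (auto intro!: image_eqI[of _ _ k])
      then show False using x by simp
    qed
    define q where "q = insert (x, k) (p - {(t, k)})"
    have fine_p: "(\<lambda>x. ball x \<delta>) fine p"
    proof (rule fineI)
      fix y l assume "(y, l) \<in> p"
      from fineD[OF p(2) this] show "l \<subseteq> ball y \<delta>" using \<delta>(1) by force
    qed
    have kb: "k \<subseteq> ball x \<delta>"
    proof
      fix y assume "y \<in> k"
      then have "\<bar>t - y\<bar> < \<delta> / 2" "\<bar>t - x\<bar> < \<delta> / 2"
        using fineD[OF p(2) tk(1)] tk(2) by (auto simp: dist_real_def)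
      then show "y \<in> ball x \<delta>" unfolding mem_ball dist_real_def by linarith
    qed
    have fine_q: "(\<lambda>x. ball x \<delta>) fine q" using fine_p kb by (auto simp: fine_def q_def)
    have tag_q: "q tagged_division_of {a..b}"
    proof (rule tagged_division_ofI)
      show "finite q" using pD(1) by (simp add: q_def)
      fix y l assume yl: "(y, l) \<in> q"
      then show "y \<in> l" "l \<subseteq> {a..b}" "\<exists>a b. l = cbox a b"
        using pD(2-4)[OF tk(1)] pD(2-4)[of y l] tk(2) by (auto simp: q_def)
      fix y' l' assume "(y', l') \<in> q" "(y, l) \<noteq> (y', l')"
      then show "interior l \<inter> interior l' = {}"
        using yl pD(5)[OF tk(1), of y' l'] pD(5)[OF tk(1), of y l] pD(5)[of y l y' l']
        by (auto simp: q_def)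
    next
      have "{l. \<exists>y. (y, l) \<in> q} = {l. \<exists>y. (y, l) \<in> p}" using tk(1) by (auto simp: q_def)
      then show "\<Union>{l. \<exists>y. (y, l) \<in> q} = {a..b}" using pD(6) by simp
    qed
    show ?thesis
    proof (cases "(x, k) \<in> p - {(t, k)}")
      case True
      text \<open>Two tags on the same interval: its interior would be empty.\<close>
      then have "interior k \<inter> interior k = {}" using pD(5)[OF tk(1), of x k] by auto
      then show ?thesis using \<open>u < v\<close> by (simp add: k)
    next
      case False
      define R where "R = (\<Sum>(x, k)\<in>p - {(t, k)}. (Sup k - Inf k) * f x)"
      have "(\<Sum>(x, k)\<in>q. (Sup k - Inf k) * f x) = (v - u) * f x + R"
        unfolding q_def R_def using False pD(1) SI by (subst sum.insert) auto
      moreover have "(\<Sum>(x, k)\<in>p. (Sup k - Inf k) * f x) = (v - u) * f t + R"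
        unfolding R_def using sum.remove[OF pD(1) tk(1), of "\<lambda>(x, k). (Sup k - Inf k) * f x"] SI by simp
      ultimately have "\<bar>(v - u) * f x + R - I\<bar> < 1" "\<bar>(v - u) * f t + R - I\<bar> < 1"
        using \<delta>(2)[OF tag_q fine_q] \<delta>(2)[OF p(1) fine_p] by simp_all
      \<comment> \<open>The remaining terms R of the two Riemann sums coincide, so the two
        contributions of k differ by less than 2.\<close>
      then have "\<bar>(v - u) * f x\<bar> \<le> 2 + \<bar>(v - u) * f t\<bar>" by linarith
      then have "\<bar>f x\<bar> \<le> B t k" unfolding B_def SI using \<open>u < v\<close> by (simp add: abs_mult field_simps)
      also have "\<dots> \<le> (\<Sum>(t, k)\<in>p. \<bar>B t k\<bar>)"
        using member_le_sum[OF tk(1), of "\<lambda>(t, k). \<bar>B t k\<bar>"] pD(1) by auto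
      finally show ?thesis .
    qed
  qed
  ultimately show ?thesis by blast
qed

section \<open>Approximation of the derivative\<close>

lemma dominated_convergence_ae:
  fixes g :: "nat \<Rightarrow> real \<Rightarrow> real"
  assumes "\<And>m. g m integrable_on {0..1}" "negligible N"
    and "\<And>m t. t \<in> {0..1} - N \<Longrightarrow> \<bar>g m t\<bar> \<le> K" "\<And>t. t \<in> {0..1} - N \<Longrightarrow> (\<lambda>m. g m t) \<longlonglongrightarrow> G t"
  shows "G integrable_on {0..1}" "(\<lambda>m. integral {0..1} (g m)) \<longlonglongrightarrow> integral {0..1} G"
proof -
  define g' where "g' m t = (if t \<in> N then 0 else g m t)" for m t
  define G' where "G' t = (if t \<in> N then 0 else G t)" for t
  have "g' m integrable_on {0..1}" for m
    by (rule integrable_spike[OF assms(1)[of m] assms(2)]) (simp add: g'_def)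
  moreover have "norm (g' m t) \<le> \<bar>K\<bar>" if "t \<in> {0..1}" for m t
    using assms(3)[of t m] that by (auto simp: g'_def)
  moreover have "(\<lambda>m. g' m t) \<longlonglongrightarrow> G' t" if "t \<in> {0..1}" for t
    using assms(4)[of t] that by (auto simp: g'_def G'_def)
  moreover have "(\<lambda>t. \<bar>K\<bar>) integrable_on {0..1::real}" by (rule integrable_const_ivl)
  ultimately have "G' integrable_on {0..1}" and lim: "(\<lambda>m. integral {0..1} (g' m)) \<longlonglongrightarrow> integral {0..1} G'"
    using dominated_convergence[of g' "{0..1}" "\<lambda>t. \<bar>K\<bar>" G'] by auto
  moreover have "integral {0..1} (g' m) = integral {0..1} (g m)" for m
    by (rule integral_spike[OF assms(2)]) (simp add: g'_def)
  moreover have "integral {0..1} G' = integral {0..1} G"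
    by (rule integral_spike[OF assms(2)]) (simp add: G'_def)
  ultimately show "G integrable_on {0..1}" "(\<lambda>m. integral {0..1} (g m)) \<longlonglongrightarrow> integral {0..1} G"
    using integrable_spike[OF _ assms(2), of G' "{0..1}" G] by (auto simp: G'_def)
qed

text \<open>Boundedness off a finite set together with the fundamental theorem makes h Lipschitz.
  Its forward difference quotients are then continuous, lie between 0 and H by monotonicity, and
  converge to the derivative almost everywhere; the version f is set to 0 on the exceptional
  set.\<close>

lemma bounded_derivative_version:
  fixes h h' :: "real \<Rightarrow> real"
  assumes ac: "absolutely_continuous_fun 0 1 h" and mono: "mono_on {0..1} h"
    and der: "ae_derivative 0 1 h h'" and ri: "riemann_integrable 0 1 h'"
  obtains f H N a where "H \<ge> 0" "negligible N" "\<And>t. 0 \<le> f t" "\<And>t. f t \<le> H"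
    "\<And>t. t \<in> {0..1} - N \<Longrightarrow> f t = h' t"
    "\<And>s t. 0 \<le> s \<Longrightarrow> s \<le> t \<Longrightarrow> t \<le> 1 \<Longrightarrow> (f has_integral (h t - h s)) {s..t}"
    "\<And>m::nat. continuous_on {0..1} (a m)" "\<And>m t. t \<in> {0..1} \<Longrightarrow> 0 \<le> a m t"
    "\<And>m t. t \<in> {0..1} \<Longrightarrow> a m t \<le> H" "\<And>t. t \<in> {0..1} - N \<Longrightarrow> (\<lambda>m. a m t) \<longlonglongrightarrow> f t"
proof -
  obtain N1 where N1: "negligible N1"
    "\<And>t. t \<in> {0..1} - N1 \<Longrightarrow> (h has_real_derivative h' t) (at t within {0..1})"
    using ae_derivative_negligible[OF der] by metis
  obtain H0 F where HF: "finite F" "\<And>t. t \<in> {0..1} - F \<Longrightarrow> \<bar>h' t\<bar> \<le> H0"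
    using riemann_integrable_bounded[OF ri] by blast
  define H where "H = \<bar>H0\<bar>"
  \<comment> \<open>Collected are the points without derivative, the points where the bound may
    fail, and the right end point, where the forward quotients below are 0.\<close>
  define N where "N = N1 \<union> F \<union> {1}"
  have N: "negligible N" using N1 HF by (auto simp: N_def intro: negligible_finite)
  define f where "f t = (if t \<in> {0..1} - N then h' t else 0)" for t
  define a where "a m t = real (Suc m) * (h (min (t + 1 / real (Suc m)) 1) - h t)" for m t
  have le: "\<bar>f t\<bar> \<le> H" for t using HF(2)[of t] by (auto simp: f_def H_def N_def)
  have int: "(f has_integral (h t - h s)) {s..t}" if st: "0 \<le> s" "s \<le> t" "t \<le> 1" for s t
  proof -
    have "(h' has_integral (h t - h s)) {s..t}"
      by (rule has_integral_absolutely_continuous[OF st(2)])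
         (use absolutely_continuous_fun_subinterval[OF ac] ae_derivative_subinterval[OF der] st in auto)
    from has_integral_spike[OF N _ this, of f] show ?thesis using st by (auto simp: f_def)
  qed
  have lip: "h t - h s \<le> H * (t - s)" if st: "0 \<le> s" "s \<le> t" "t \<le> 1" for s t
  proof -
    have "h t - h s \<le> (t - s) * H"
      using has_integral_le[OF int[OF st] has_integral_const_real[of H s t]] le st by (simp add: abs_le_iff)
    then show ?thesis by (simp add: mult.commute)
  qed
  have mn: "h s \<le> h t" if "0 \<le> s" "s \<le> t" "t \<le> 1" for s t
    using monotone_onD[OF mono, of s t] that by auto
  have hc: "continuous_on {0..1} h"
  proof (rule lipschitz_on_continuous_on[of H])
    show "H-lipschitz_on {0..1} h"
    proof (rule lipschitz_onI)
      fix x y :: real assume xy: "x \<in> {0..1}" "y \<in> {0..1}"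
      then show "dist (h x) (h y) \<le> H * dist x y"
        using lip[of x y] lip[of y x] mn[of x y] mn[of y x] by (cases "x \<le> y") (auto simp: dist_real_def)
    qed (simp add: H_def)
  qed
  have ac: "continuous_on {0..1} (a m)" for m
    unfolding a_def
    by (intro continuous_intros hc continuous_on_compose2[OF hc]) (auto simp: min_def)
  have a0: "0 \<le> a m t" if "t \<in> {0..1}" for m t
    unfolding a_def using that mn[of t "min (t + 1 / real (Suc m)) 1"] by (intro mult_nonneg_nonneg) auto
  have aH: "a m t \<le> H" if "t \<in> {0..1}" for m t
  proof -
    have "h (min (t + 1 / real (Suc m)) 1) - h t \<le> H * (min (t + 1 / real (Suc m)) 1 - t)"
      using that by (intro lip) auto
    also have "\<dots> \<le> H * (1 / real (Suc m))" by (intro mult_left_mono) (auto simp: H_def)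
    finally show ?thesis unfolding a_def by (simp add: field_simps)
  qed
  have lim: "(\<lambda>m. a m t) \<longlonglongrightarrow> f t" if t: "t \<in> {0..1} - N" for t
  proof -
    have t': "0 \<le> t" "t < 1" using t by (auto simp: N_def)
    have "(h has_real_derivative h' t) (at t within {0..1})" using N1(2)[of t] t by (auto simp: N_def)
    then have l: "((\<lambda>y. (h y - h t) / (y - t)) \<longlongrightarrow> h' t) (at t within {0..1})"
      by (simp add: has_field_derivative_iff)
    have ev: "\<forall>\<^sub>F m in sequentially. 1 / real (Suc m) < 1 - t"
    proof -
      have "(\<lambda>m. 1 / real (Suc m)) \<longlonglongrightarrow> 0" by (rule LIMSEQ_inverse_real_of_nat[unfolded inverse_eq_divide])
      from order_tendstoD(2)[OF this, of "1 - t"] show ?thesis using t'(2) by simp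
    qed
    have fl: "filterlim (\<lambda>m. t + 1 / real (Suc m)) (at t within {0..1}) sequentially"
      unfolding filterlim_at
    proof (intro conjI)
      show "\<forall>\<^sub>F m in sequentially. t + 1 / real (Suc m) \<in> {0..1} \<and> t + 1 / real (Suc m) \<noteq> t"
        using ev by eventually_elim (use t' in auto)
      have "(\<lambda>m. t + 1 / real (Suc m)) \<longlonglongrightarrow> t + 0"
        by (intro tendsto_add tendsto_const LIMSEQ_inverse_real_of_nat[unfolded inverse_eq_divide])
      then show "(\<lambda>m. t + 1 / real (Suc m)) \<longlonglongrightarrow> t" by simp
    qed
    from filterlim_compose[OF l fl]
    have "(\<lambda>m. (h (t + 1 / real (Suc m)) - h t) / (t + 1 / real (Suc m) - t)) \<longlonglongrightarrow> h' t" .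
    then have "(\<lambda>m. a m t) \<longlonglongrightarrow> h' t"
    proof (rule Lim_transform_eventually)
      show "\<forall>\<^sub>F m in sequentially. (h (t + 1 / real (Suc m)) - h t) / (t + 1 / real (Suc m) - t) = a m t"
        using ev by eventually_elim (simp add: a_def min_def field_simps)
    qed
    then show ?thesis using t by (simp add: f_def)
  qed
  have nn: "0 \<le> f t" for t
  proof (cases "t \<in> {0..1} - N")
    case True
    then show ?thesis using LIMSEQ_le_const[OF lim[OF True], of 0] a0 by blast
  qed (auto simp: f_def)
  show ?thesis
    by (rule that[of H N f a]) (use N le nn int ac a0 aH lim in \<open>auto simp: f_def H_def abs_le_iff\<close>)
qed

text \<open>Weierstrass approximation: a polynomial has a bounded derivative on [0, 1].\<close>

lemma continuous_lipschitz_approx: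
  fixes u :: "real \<Rightarrow> real"
  assumes "continuous_on {0..1} u" "e > 0"
  obtains p L where "L-lipschitz_on {0..1} p" "\<And>t. t \<in> {0..1} \<Longrightarrow> \<bar>u t - p t\<bar> < e"
proof -
  obtain p where p: "polynomial_function p" "\<And>t. t \<in> {0..1} \<Longrightarrow> norm (u t - p t) < e"
    using Stone_Weierstrass_polynomial_function[of "{0..1}" u e] assms by auto
  obtain p' where p': "polynomial_function p'" "\<And>x. (p has_vector_derivative p' x) (at x)"
    using has_vector_derivative_polynomial_function[OF p(1)] by metis
  have "compact (p' ` {0..1})"
    using p'(1) by (intro compact_continuous_image continuous_on_polymonial_function) auto
  then obtain L where L: "\<And>x. x \<in> {0..1} \<Longrightarrow> norm (p' x) \<le> L"
    by (metis compact_imp_bounded bounded_iff imageI)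
  have "\<bar>L\<bar>-lipschitz_on {0..1} p"
  proof (rule bounded_derivative_imp_lipschitz)
    show "(p has_derivative (*) (p' x)) (at x within {0..1})" for x
      using p'(2)[of x] by (auto simp: has_field_derivative_def[symmetric] has_real_derivative_iff_has_vector_derivative intro: has_vector_derivative_at_within)
    fix x :: real assume "x \<in> {0..1}"
    then show "onorm ((*) (p' x)) \<le> \<bar>L\<bar>"
      using L[of x] by (intro onorm_le) (auto simp: abs_mult intro!: mult_right_mono)
  qed auto
  then show ?thesis using that p(2) by auto
qed

text \<open>Here \<open>f\<close> plays the role of \<open>h'\<close>. As \<open>f\<close> is an almost everywhere limit of the continuous functions
  \<open>a m\<close>, dominated convergence yields both the integrability of functions of \<open>f\<close> and the
  approximation of their integrals.\<close>

locale derivative_approx =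
  fixes f :: "real \<Rightarrow> real" and H :: real and N :: "real set" and a :: "nat \<Rightarrow> real \<Rightarrow> real"
  assumes neg: "negligible N" and f0: "\<And>t. 0 \<le> f t" and fH: "\<And>t. f t \<le> H"
    and ac: "\<And>m. continuous_on {0..1} (a m)" and a0: "\<And>m t. t \<in> {0..1} \<Longrightarrow> 0 \<le> a m t"
    and aH: "\<And>m t. t \<in> {0..1} \<Longrightarrow> a m t \<le> H" and lim: "\<And>t. t \<in> {0..1} - N \<Longrightarrow> (\<lambda>m. a m t) \<longlonglongrightarrow> f t"
begin

lemma H_nn: "0 \<le> H" using f0 fH order.trans by blast

lemma compose:
  fixes \<Psi> :: "real \<Rightarrow> real \<Rightarrow> real"
  assumes "\<And>m. continuous_on {0..1} (\<lambda>t. \<Psi> (a m t) t)"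
    and "\<And>x t. 0 \<le> x \<Longrightarrow> x \<le> H \<Longrightarrow> t \<in> {0..1} \<Longrightarrow> \<bar>\<Psi> x t\<bar> \<le> K"
    and "\<And>x t. x \<ge> 0 \<Longrightarrow> t \<in> {0..1} \<Longrightarrow> continuous (at x within {0..}) (\<lambda>y. \<Psi> y t)"
  shows "(\<lambda>t. \<Psi> (f t) t) integrable_on {0..1}"
    "(\<lambda>m. integral {0..1} (\<lambda>t. \<Psi> (a m t) t)) \<longlonglongrightarrow> integral {0..1} (\<lambda>t. \<Psi> (f t) t)"
proof -
  have 1: "(\<lambda>t. \<Psi> (a m t) t) integrable_on {0..1}" for m
    by (rule integrable_continuous_real[OF assms(1)])
  have 2: "\<bar>\<Psi> (a m t) t\<bar> \<le> K" if "t \<in> {0..1} - N" for m t using that by (intro assms(2) a0 aH) auto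
  have 3: "(\<lambda>m. \<Psi> (a m t) t) \<longlonglongrightarrow> \<Psi> (f t) t" if t: "t \<in> {0..1} - N" for t
  proof (rule continuous_within_tendsto_compose[OF assms(3)[of "f t" t]])
    show "\<forall>\<^sub>F m in sequentially. a m t \<in> {0..}" using a0 t by auto
  qed (use f0 t lim in auto)
  show "(\<lambda>t. \<Psi> (f t) t) integrable_on {0..1}"
    "(\<lambda>m. integral {0..1} (\<lambda>t. \<Psi> (a m t) t)) \<longlonglongrightarrow> integral {0..1} (\<lambda>t. \<Psi> (f t) t)"
    using dominated_convergence_ae[OF 1 neg 2 3] by auto
qed

lemma integrable_mult_cont:
  assumes "continuous_on {0..1} u" shows "(\<lambda>t. f t * u t) integrable_on {0..1}"
proof -
  obtain U where U: "\<forall>t\<in>{0..1}. \<bar>u t\<bar> \<le> U" using compact_imp_bounded[OF compact_continuous_image[OF assms]]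
    by (auto simp: bounded_iff)
  show ?thesis
    by (rule compose(1)[of "\<lambda>x t. x * u t" "H * U"])
       (use U in \<open>auto intro!: continuous_intros ac assms mult_mono simp: abs_mult\<close>)
qed

lemma integrable_absdiff:
  assumes "continuous_on {0..1} k" "continuous_on {0..1} u"
  shows "(\<lambda>t. \<bar>k t - f t * u t\<bar>) integrable_on {0..1}"
proof -
  obtain U where U: "\<forall>t\<in>{0..1}. \<bar>u t\<bar> \<le> U" using compact_imp_bounded[OF compact_continuous_image[OF assms(2)]]
    by (auto simp: bounded_iff)
  obtain K where K: "\<forall>t\<in>{0..1}. \<bar>k t\<bar> \<le> K" using compact_imp_bounded[OF compact_continuous_image[OF assms(1)]]
    by (auto simp: bounded_iff)
  show ?thesis
  proof (rule compose(1)[of "\<lambda>x t. \<bar>k t - x * u t\<bar>" "K + H * U"])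
    fix x t :: real assume x: "0 \<le> x" "x \<le> H" "t \<in> {0..1}"
    then have "\<bar>x * u t\<bar> \<le> H * U" using U unfolding abs_mult by (intro mult_mono) auto
    then show "\<bar>\<bar>k t - x * u t\<bar>\<bar> \<le> K + H * U" using K x by fastforce
  qed (auto intro!: continuous_intros ac assms)
qed

text \<open>Everything follows from c^3 = 2 (x + \<rho>) / s^2, equivalently (x + \<rho>) s = c^3
  s^3 / 2.\<close>

lemma scale_identity:
  fixes s x \<rho> c :: real
  assumes "s > 0" "x \<ge> 0" "\<rho> > 0" and c: "c = (2 * (x + \<rho>) / s\<^sup>2) powr (1 / 3)"
  shows "c > 0" "c\<^sup>2 * s\<^sup>2 / 2 = (x + \<rho>) / c" "c\<^sup>2 * s\<^sup>2 / 2 = ((x + \<rho>) * s) powr (2 / 3) / 2 powr (1 / 3)"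
proof -
  define b where "b = 2 * (x + \<rho>) / s\<^sup>2"
  have b: "b > 0" using assms by (simp add: b_def)
  show c0: "c > 0" unfolding c b_def[symmetric] using b by simp
  have "c ^ 3 = b powr (1 / 3 * real 3)" unfolding c b_def[symmetric] using b
    by (subst powr_powr[symmetric], subst powr_realpow) auto
  then have c3: "c ^ 3 = b" using b by simp
  have "c\<^sup>2 * s\<^sup>2 / 2 * c = c ^ 3 * s\<^sup>2 / 2" by (simp add: power2_eq_square power3_eq_cube)
  also have "\<dots> = x + \<rho>" using assms(1) by (simp add: c3 b_def)
  finally show "c\<^sup>2 * s\<^sup>2 / 2 = (x + \<rho>) / c" using c0 by (simp add: field_simps)
  have "c\<^sup>2 = b powr (1 / 3 * real 2)" unfolding c b_def[symmetric] using b
    by (subst powr_powr[symmetric], subst powr_realpow) auto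
  then have c2: "c\<^sup>2 = b powr (2 / 3)" by simp
  have eq: "((x + \<rho>) * s) = b * (s ^ 3 / 2)" using assms by (simp add: b_def power2_eq_square power3_eq_cube field_simps)
  have "((x + \<rho>) * s) powr (2 / 3) = b powr (2 / 3) * (s ^ 3 / 2) powr (2 / 3)"
    unfolding eq by (rule powr_mult)
  also have "(s ^ 3 / 2) powr (2 / 3) = s\<^sup>2 / 2 powr (2 / 3)"
  proof -
    have "(s ^ 3) powr (2 / 3) = s powr (real 3 * (2 / 3))"
      using assms(1) by (subst powr_powr[symmetric], subst powr_realpow) auto
    also have "\<dots> = s\<^sup>2" using assms(1) by (simp add: powr_realpow[of s 2, simplified])
    finally show ?thesis using assms(1) by (simp add: powr_divide)
  qed
  finally have "((x + \<rho>) * s) powr (2 / 3) / 2 powr (1 / 3) = c\<^sup>2 * s\<^sup>2 / (2 powr (2 / 3) * 2 powr (1 / 3))"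
    by (simp add: c2)
  also have "2 powr (2 / 3) * 2 powr (1 / 3) = (2::real)" by (simp flip: powr_add)
  finally show "c\<^sup>2 * s\<^sup>2 / 2 = ((x + \<rho>) * s) powr (2 / 3) / 2 powr (1 / 3)" by simp
qed

text \<open>The scale \<open>c = (2 f / \<sigma>\<^sup>2) powr (1/3)\<close> turns the generator \<open>\<sigma>\<^sup>2 / 2 \<partial>\<^sup>2 - f y\<close> into a multiple of
  the Airy operator, and \<open>c\<^sup>2 \<sigma>\<^sup>2 / 2 - f / c\<close> vanishes. Adding a small constant to \<open>f\<close> keeps the
  scale bounded away from 0.\<close>

lemma exists_scale:
  assumes \<sigma>c: "continuous_on {0..1} \<sigma>" and \<sigma>0: "\<And>t. t \<in> {0..1} \<Longrightarrow> \<sigma> t > 0" and "\<epsilon> > 0"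
  obtains c L where "L-lipschitz_on {0..1} c" "\<And>t. t \<in> {0..1} \<Longrightarrow> c t > 0"
    "integral {0..1} (\<lambda>t. \<bar>(c t)\<^sup>2 * (\<sigma> t)\<^sup>2 / 2 - f t / c t\<bar>) < \<epsilon>"
    "\<bar>integral {0..1} (\<lambda>t. (c t)\<^sup>2 * (\<sigma> t)\<^sup>2 / 2) - integral {0..1} (\<lambda>t. (f t * \<sigma> t) powr (2 / 3) / 2 powr (1 / 3))\<bar> < \<epsilon>"
    "(\<lambda>t. (f t * \<sigma> t) powr (2 / 3) / 2 powr (1 / 3)) integrable_on {0..1}"
proof -
  obtain s1 where s1: "\<And>t. t \<in> {0..1} \<Longrightarrow> \<sigma> t \<le> s1" "s1 > 0"
  proof -
    obtain t1 where "t1 \<in> {0..1}" "\<And>t. t \<in> {0..1} \<Longrightarrow> \<sigma> t \<le> \<sigma> t1"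
      using continuous_attains_sup[of "{0..1::real}" \<sigma>] \<sigma>c by auto
    then show ?thesis using that \<sigma>0 by blast
  qed
  obtain s0 where s0: "\<And>t. t \<in> {0..1} \<Longrightarrow> s0 \<le> \<sigma> t" "s0 > 0"
  proof -
    obtain t1 where "t1 \<in> {0..1}" "\<And>t. t \<in> {0..1} \<Longrightarrow> \<sigma> t1 \<le> \<sigma> t"
      using continuous_attains_inf[of "{0..1::real}" \<sigma>] \<sigma>c by auto
    then show ?thesis using that \<sigma>0 by blast
  qed
  define Q where "Q x t = (x * \<sigma> t) powr (2 / 3) / 2 powr (1 / 3)" for x t
  have Q_bound: "\<bar>Q x t\<bar> \<le> (K * s1) powr (2 / 3) / 2 powr (1 / 3)" if "0 \<le> x" "x \<le> K" "t \<in> {0..1}" for x K t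
  proof -
    have "(x * \<sigma> t) powr (2 / 3) \<le> (K * s1) powr (2 / 3)"
      using that s1(1)[of t] \<sigma>0[of t] by (intro powr_mono2 mult_mono) auto
    then show ?thesis by (simp add: Q_def divide_right_mono)
  qed
  have Q_cont: "continuous_on {0..1} (\<lambda>t. Q (u t) t)" if "continuous_on {0..1} u" "\<And>t. t \<in> {0..1} \<Longrightarrow> 0 \<le> u t" for u
    unfolding Q_def using that \<sigma>0
    by (intro continuous_intros continuous_on_powr' \<sigma>c ballI) (auto simp: less_imp_le)
  have Q_cont': "continuous (at x within {0..}) (\<lambda>y. Q (y + \<rho>) t)" if "x \<ge> 0" "\<rho> \<ge> 0" "t \<in> {0..1}" for x \<rho> t
  proof -
    have "continuous_on {0..} (\<lambda>y. Q (y + \<rho>) t)" unfolding Q_def using that \<sigma>0[of t]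
      by (intro continuous_intros continuous_on_powr' ballI) auto
    then show ?thesis using that by (simp add: continuous_on_eq_continuous_within)
  qed
  have Qint: "(\<lambda>t. Q (f t + \<rho>) t) integrable_on {0..1}"
    "(\<lambda>m. integral {0..1} (\<lambda>t. Q (a m t + \<rho>) t)) \<longlonglongrightarrow> integral {0..1} (\<lambda>t. Q (f t + \<rho>) t)" if "\<rho> \<ge> 0" for \<rho>
  proof -
    have 1: "continuous_on {0..1} (\<lambda>t. Q (a m t + \<rho>) t)" for m
      by (intro Q_cont continuous_intros ac) (use that a0 in \<open>auto intro: add_nonneg_nonneg\<close>)
    have 2: "\<bar>Q (x + \<rho>) t\<bar> \<le> ((H + \<rho>) * s1) powr (2 / 3) / 2 powr (1 / 3)" if "0 \<le> x" "x \<le> H" "t \<in> {0..1}" for x t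
      using that \<open>\<rho> \<ge> 0\<close> by (intro Q_bound) auto
    show "(\<lambda>t. Q (f t + \<rho>) t) integrable_on {0..1}"
      "(\<lambda>m. integral {0..1} (\<lambda>t. Q (a m t + \<rho>) t)) \<longlonglongrightarrow> integral {0..1} (\<lambda>t. Q (f t + \<rho>) t)"
      using compose[of "\<lambda>x t. Q (x + \<rho>) t", OF 1 2 Q_cont'] that by auto
  qed
  \<comment> \<open>Three approximations are fixed in turn: a constant \<rho> added to f, then a
    continuous function \<open>a m\<close> in place of f, then a Lipschitz function
    \<open>p j\<close> in place of the resulting scale.\<close>
  define \<rho>s where "\<rho>s i = 1 / real (Suc i)" for i :: nat
  have \<rho>s: "\<rho>s i > 0" "\<rho>s i \<le> 1" for i by (auto simp: \<rho>s_def)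
  have \<rho>s_lim: "\<rho>s \<longlonglongrightarrow> 0" unfolding \<rho>s_def by (rule LIMSEQ_inverse_real_of_nat[unfolded inverse_eq_divide])
  have L1: "(\<lambda>i. integral {0..1} (\<lambda>t. Q (f t + \<rho>s i) t)) \<longlonglongrightarrow> integral {0..1} (\<lambda>t. Q (f t) t)"
  proof (rule dominated_convergence_ae(2)[OF Qint(1) neg])
    show "\<bar>Q (f t + \<rho>s m) t\<bar> \<le> ((H + 1) * s1) powr (2 / 3) / 2 powr (1 / 3)" if "t \<in> {0..1} - N" for m t
      using that \<rho>s[of m] f0[of t] fH[of t] by (intro Q_bound) auto
    show "(\<lambda>m. Q (f t + \<rho>s m) t) \<longlonglongrightarrow> Q (f t) t" if "t \<in> {0..1} - N" for t
    proof -
      have "(\<lambda>m. Q (f t + \<rho>s m + 0) t) \<longlonglongrightarrow> Q (f t + 0) t"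
      proof (rule continuous_within_tendsto_compose[OF Q_cont'[of "f t" 0 t]])
        show "\<forall>\<^sub>F m in sequentially. f t + \<rho>s m \<in> {0..}" 
          by (intro always_eventually allI) (simp add: add_nonneg_nonneg f0 less_imp_le[OF \<rho>s(1)])
        show "(\<lambda>m. f t + \<rho>s m) \<longlonglongrightarrow> f t" using tendsto_add[OF tendsto_const \<rho>s_lim, of "f t"] by simp
      qed (use f0 that in auto)
      then show ?thesis by simp
    qed
  qed (use \<rho>s in \<open>auto simp: less_imp_le\<close>)
  \<comment> \<open>The smallest possible scale, attained for f = 0 and the maximum s1 of \<sigma>.
    Although it tends to 0 with \<rho>, the quotient \<rho> / c\<rho> is of order \<rho>^(2/3), so
    adding \<rho> costs little in the mismatch.\<close>
  define c\<rho> where "c\<rho> \<rho> = (2 * \<rho> / s1\<^sup>2) powr (1 / 3)" for \<rho>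
  have L2: "(\<lambda>i. \<rho>s i / c\<rho> (\<rho>s i)) \<longlonglongrightarrow> 0"
  proof -
    have "\<rho> / c\<rho> \<rho> = 1 / (2 / s1\<^sup>2) powr (1 / 3) * \<rho> powr (2 / 3)" if "\<rho> > 0" for \<rho>
    proof -
      have "\<rho> = \<rho> powr (1/3) * \<rho> powr (2/3)" using that by (simp flip: powr_add)
      moreover have "c\<rho> \<rho> = (2 / s1\<^sup>2) powr (1 / 3) * \<rho> powr (1 / 3)"
        unfolding c\<rho>_def using that s1(2) by (subst powr_mult[symmetric]) auto
      ultimately show ?thesis using that s1(2) by (simp add: field_simps)
    qed
    then have eq: "\<rho>s i / c\<rho> (\<rho>s i) = 1 / (2 / s1\<^sup>2) powr (1 / 3) * \<rho>s i powr (2 / 3)" for i using \<rho>s by blast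
    have "(\<lambda>i. \<rho>s i powr (2 / 3)) \<longlonglongrightarrow> 0" unfolding \<rho>s_def by real_asymp
    then show ?thesis unfolding eq by (rule tendsto_mult_right_zero)
  qed
  have "\<forall>\<^sub>F i in sequentially. \<rho>s i / c\<rho> (\<rho>s i) < \<epsilon> / 4 \<and>
      dist (integral {0..1} (\<lambda>t. Q (f t + \<rho>s i) t)) (integral {0..1} (\<lambda>t. Q (f t) t)) < \<epsilon> / 4"
    using order_tendstoD(2)[OF L2, of "\<epsilon> / 4"] tendstoD[OF L1, of "\<epsilon> / 4"] \<open>\<epsilon> > 0\<close>
    by (intro eventually_conj) auto
  from eventually_happens'[OF sequentially_bot this] obtain i where i: "\<rho>s i / c\<rho> (\<rho>s i) < \<epsilon> / 4"
    "\<bar>integral {0..1} (\<lambda>t. Q (f t + \<rho>s i) t) - integral {0..1} (\<lambda>t. Q (f t) t)\<bar> < \<epsilon> / 4"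
    unfolding dist_real_def by blast
  define \<rho> where "\<rho> = \<rho>s i"
  have \<rho>: "\<rho> > 0" "\<rho> \<le> 1" using \<rho>s by (auto simp: \<rho>_def)
  define c0 where "c0 x t = (2 * (x + \<rho>) / (\<sigma> t)\<^sup>2) powr (1 / 3)" for x t
  have c\<rho>_pos: "c\<rho> \<rho> > 0" using \<rho> s1 by (simp add: c\<rho>_def)
  have c0_low: "c\<rho> \<rho> \<le> c0 x t" if "x \<ge> 0" "t \<in> {0..1}" for x t
    unfolding c\<rho>_def c0_def
    using that \<rho> \<sigma>0[of t] s1(1)[of t] by (intro powr_mono2 frac_le power_mono) auto
  have c0_up: "c0 x t \<le> (2 * (H + 1) / s0\<^sup>2) powr (1 / 3)" if "0 \<le> x" "x \<le> H" "t \<in> {0..1}" for x t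
    unfolding c0_def using that \<rho> s0(1)[of t] s0(2) by (intro powr_mono2 frac_le power_mono) auto
  have c0_cont: "continuous_on {0..1} (\<lambda>t. c0 (a m t) t)" for m
    unfolding c0_def using \<rho> a0 \<sigma>0
    by (intro continuous_intros continuous_on_powr' \<sigma>c ac ballI) (auto intro!: divide_nonneg_nonneg add_nonneg_nonneg simp: less_imp_le dual_order.strict_implies_not_eq)
  have id: "c0 x t > 0" "(c0 x t)\<^sup>2 * (\<sigma> t)\<^sup>2 / 2 = (x + \<rho>) / c0 x t" "(c0 x t)\<^sup>2 * (\<sigma> t)\<^sup>2 / 2 = Q (x + \<rho>) t"
    if "x \<ge> 0" "t \<in> {0..1}" for x t
    unfolding c0_def Q_def by (rule scale_identity[OF \<sigma>0[OF that(2)] that(1) \<rho>(1) refl])+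
  \<comment> \<open>By the identities for the scale this mismatch equals |a m + \<rho> - f| / c0:
    one part is small in mean for large m, the other is \<rho> / c\<rho>.\<close>
  define d where "d m t = \<bar>(c0 (a m t) t)\<^sup>2 * (\<sigma> t)\<^sup>2 / 2 - f t / c0 (a m t) t\<bar>" for m t
  have d_int: "d m integrable_on {0..1}" for m
  proof -
    have "(\<lambda>t. \<bar>(c0 (a m t) t)\<^sup>2 * (\<sigma> t)\<^sup>2 / 2 - f t * (1 / c0 (a m t) t)\<bar>) integrable_on {0..1}"
    proof (intro integrable_absdiff continuous_intros c0_cont \<sigma>c ballI)
      show "c0 (a m t) t \<noteq> 0" if "t \<in> {0..1}" for t using id(1)[OF a0[OF that] that, of m] by linarith
    qed simp_all
    then show ?thesis unfolding d_def by simp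
  qed
  have d_eq: "d m t = \<bar>a m t + \<rho> - f t\<bar> / c0 (a m t) t" if "t \<in> {0..1}" for m t
    unfolding d_def id(2)[OF a0[OF that] that] diff_divide_distrib[symmetric] abs_divide
      abs_of_pos[OF id(1)[OF a0[OF that] that]] by (rule refl)
  have d_le: "d m t \<le> (\<bar>a m t - f t\<bar> + \<rho>) / c\<rho> \<rho>" if "t \<in> {0..1}" for m t
    unfolding d_eq[OF that]
    by (rule frac_le[OF _ _ c\<rho>_pos c0_low[OF a0[OF that] that]]) (use \<rho> in linarith)+
  have af_int: "(\<lambda>t. \<bar>a m t - f t\<bar>) integrable_on {0..1}" for m
    using integrable_absdiff[OF ac continuous_on_const[of _ 1]] by simp
  have af: "(\<lambda>m. integral {0..1} (\<lambda>t. \<bar>a m t - f t\<bar>)) \<longlonglongrightarrow> integral {0..1} (\<lambda>t::real. 0::real)"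
  proof (rule dominated_convergence_ae(2)[OF af_int neg])
    show "\<bar>\<bar>a m t - f t\<bar>\<bar> \<le> H" if "t \<in> {0..1} - N" for m t
      using a0[of t m] aH[of t m] f0[of t] fH[of t] that unfolding abs_idempotent abs_le_iff
      by (simp add: algebra_simps)
    show "(\<lambda>m. \<bar>a m t - f t\<bar>) \<longlonglongrightarrow> 0" if "t \<in> {0..1} - N" for t
      using tendsto_rabs[OF tendsto_diff[OF lim[OF that] tendsto_const[of "f t"]]] by simp
  qed
  have "\<forall>\<^sub>F m in sequentially. integral {0..1} (\<lambda>t. \<bar>a m t - f t\<bar>) < \<epsilon> / 4 * c\<rho> \<rho> \<and>
      dist (integral {0..1} (\<lambda>t. Q (a m t + \<rho>) t)) (integral {0..1} (\<lambda>t. Q (f t + \<rho>) t)) < \<epsilon> / 4"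
    using order_tendstoD(2)[OF af, of "\<epsilon> / 4 * c\<rho> \<rho>"] tendstoD[OF Qint(2), of \<rho> "\<epsilon> / 4"] \<open>\<epsilon> > 0\<close> c\<rho>_pos \<rho>
    by (intro eventually_conj) auto
  from eventually_happens'[OF sequentially_bot this] obtain m where m: "integral {0..1} (\<lambda>t. \<bar>a m t - f t\<bar>) < \<epsilon> / 4 * c\<rho> \<rho>"
      "\<bar>integral {0..1} (\<lambda>t. Q (a m t + \<rho>) t) - integral {0..1} (\<lambda>t. Q (f t + \<rho>) t)\<bar> < \<epsilon> / 4"
    unfolding dist_real_def by blast
  have I1: "integral {0..1} (d m) < \<epsilon> / 2"
  proof -
    have "integral {0..1} (d m) \<le> integral {0..1} (\<lambda>t. (\<bar>a m t - f t\<bar> + \<rho>) / c\<rho> \<rho>)"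
      using d_le by (intro integral_le d_int integrable_on_divide integrable_add af_int integrable_const_ivl) auto
    also have "\<dots> = (integral {0..1} (\<lambda>t. \<bar>a m t - f t\<bar>) + \<rho>) / c\<rho> \<rho>"
      using af_int[of m] by (simp add: integral_add integrable_const_ivl)
    also have "\<dots> < \<epsilon> / 4 + \<epsilon> / 4"
      unfolding add_divide_distrib
      by (intro add_strict_mono i(1)[folded \<rho>_def]) (use m(1) c\<rho>_pos in \<open>simp add: pos_divide_less_eq\<close>)
    finally show ?thesis by simp
  qed
  define u where "u t = c0 (a m t) t" for t
  have uc: "continuous_on {0..1} u" unfolding u_def by (rule c0_cont)
  have u_low: "c\<rho> \<rho> \<le> u t" if "t \<in> {0..1}" for t unfolding u_def by (rule c0_low[OF a0[OF that] that])
  define cU where "cU = (2 * (H + 1) / s0\<^sup>2) powr (1 / 3)"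
  have u_up: "u t \<le> cU" if "t \<in> {0..1}" for t unfolding u_def cU_def by (rule c0_up[OF a0[OF that] aH[OF that] that])
  have I2: "integral {0..1} (\<lambda>t. (u t)\<^sup>2 * (\<sigma> t)\<^sup>2 / 2) = integral {0..1} (\<lambda>t. Q (a m t + \<rho>) t)"
    by (rule integral_cong) (simp add: u_def id(3) a0)
  \<comment> \<open>An error of at most half the lower bound of u keeps the Lipschitz approximations
    bounded away from 0.\<close>
  define e where "e j = min (c\<rho> \<rho> / 2) (1 / real (Suc j))" for j :: nat
  have e: "e j > 0" "e j \<le> c\<rho> \<rho> / 2" "e j \<le> 1 / real (Suc j)" for j using c\<rho>_pos by (auto simp: e_def)
  have "\<exists>p L. L-lipschitz_on {0..1} p \<and> (\<forall>t\<in>{0..1}. \<bar>u t - p t\<bar> < e j)" for j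
    by (rule continuous_lipschitz_approx[OF uc e(1)[of j]]) blast
  then obtain p L where p: "\<And>j. (L j)-lipschitz_on {0..1} (p j)" "\<And>j t. t \<in> {0..1} \<Longrightarrow> \<bar>u t - p j t\<bar> < e j"
    by metis
  have pc: "continuous_on {0..1} (p j)" for j by (rule lipschitz_on_continuous_on[OF p(1)])
  have p_low: "c\<rho> \<rho> / 2 \<le> p j t" if "t \<in> {0..1}" for j t
    using p(2)[OF that, of j] e(2)[of j] u_low[OF that] by linarith
  have p_up: "p j t \<le> cU + c\<rho> \<rho>" if "t \<in> {0..1}" for j t
    using p(2)[OF that, of j] e(2)[of j] u_up[OF that] c\<rho>_pos by linarith
  have p_pos: "p j t > 0" if "t \<in> {0..1}" for j t using p_low[OF that, of j] c\<rho>_pos by linarith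
  have p_lim: "(\<lambda>j. p j t) \<longlonglongrightarrow> u t" if "t \<in> {0..1}" for t
  proof (rule LIM_zero_cancel, rule Lim_null_comparison)
    show "\<forall>\<^sub>F j in sequentially. norm (p j t - u t) \<le> 1 / real (Suc j)"
    proof (intro always_eventually allI)
      fix j
      show "norm (p j t - u t) \<le> 1 / real (Suc j)"
        using order.strict_trans2[OF p(2)[OF that] e(3), of j] by (simp only: real_norm_def abs_minus_commute less_imp_le)
    qed
  qed (rule LIMSEQ_inverse_real_of_nat[unfolded inverse_eq_divide])
  define K1 where "K1 = (cU + c\<rho> \<rho>)\<^sup>2 * s1\<^sup>2"
  have k_bd: "0 \<le> (p j t)\<^sup>2 * (\<sigma> t)\<^sup>2 / 2" "(p j t)\<^sup>2 * (\<sigma> t)\<^sup>2 / 2 \<le> K1" if "t \<in> {0..1}" for j t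
  proof -
    have "(p j t)\<^sup>2 * (\<sigma> t)\<^sup>2 \<le> K1"
      unfolding K1_def using p_pos[OF that, of j] p_up[OF that, of j] \<sigma>0[OF that] s1(1)[OF that]
      by (intro mult_mono power_mono) auto
    moreover have "0 \<le> (p j t)\<^sup>2 * (\<sigma> t)\<^sup>2" by (intro mult_nonneg_nonneg) auto
    ultimately show "(p j t)\<^sup>2 * (\<sigma> t)\<^sup>2 / 2 \<le> K1" "0 \<le> (p j t)\<^sup>2 * (\<sigma> t)\<^sup>2 / 2"
      by linarith+
  qed
  have fp_bd: "0 \<le> f t / p j t" "f t / p j t \<le> H / (c\<rho> \<rho> / 2)" if "t \<in> {0..1}" for j t
  proof -
    show "0 \<le> f t / p j t" using f0[of t] p_pos[OF that, of j] by simp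
    show "f t / p j t \<le> H / (c\<rho> \<rho> / 2)"
      by (rule frac_le[OF H_nn fH _ p_low[OF that]]) (use c\<rho>_pos in simp)
  qed
  have D1: "(\<lambda>j. integral {0..1} (\<lambda>t. \<bar>(p j t)\<^sup>2 * (\<sigma> t)\<^sup>2 / 2 - f t / p j t\<bar>)) \<longlonglongrightarrow> integral {0..1} (d m)"
  proof (rule dominated_convergence_ae(2)[OF _ neg])
    fix j
    have "(\<lambda>t. \<bar>(p j t)\<^sup>2 * (\<sigma> t)\<^sup>2 / 2 - f t * (1 / p j t)\<bar>) integrable_on {0..1}"
    proof (intro integrable_absdiff continuous_intros pc \<sigma>c ballI)
      show "p j t \<noteq> 0" if "t \<in> {0..1}" for t using p_pos[OF that, of j] by linarith
    qed simp_all
    then show "(\<lambda>t. \<bar>(p j t)\<^sup>2 * (\<sigma> t)\<^sup>2 / 2 - f t / p j t\<bar>) integrable_on {0..1}" by simp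
  next
    fix j t assume "t \<in> {0..1} - N"
    then have t: "t \<in> {0..1}" by simp
    show "\<bar>\<bar>(p j t)\<^sup>2 * (\<sigma> t)\<^sup>2 / 2 - f t / p j t\<bar>\<bar> \<le> K1 + H / (c\<rho> \<rho> / 2)"
      using k_bd[OF t, of j] fp_bd[OF t, of j] unfolding abs_idempotent abs_le_iff by linarith
  next
    fix t assume t: "t \<in> {0..1} - N"
    then have "u t \<noteq> 0" using u_low[of t] c\<rho>_pos by auto
    then show "(\<lambda>j. \<bar>(p j t)\<^sup>2 * (\<sigma> t)\<^sup>2 / 2 - f t / p j t\<bar>) \<longlonglongrightarrow> d m t"
      unfolding d_def u_def[symmetric] using t by (intro tendsto_intros p_lim) auto
  qed
  have D2: "(\<lambda>j. integral {0..1} (\<lambda>t. (p j t)\<^sup>2 * (\<sigma> t)\<^sup>2 / 2)) \<longlonglongrightarrow> integral {0..1} (\<lambda>t. (u t)\<^sup>2 * (\<sigma> t)\<^sup>2 / 2)"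
  proof (rule dominated_convergence_ae(2)[OF _ neg])
    show "(\<lambda>t. (p j t)\<^sup>2 * (\<sigma> t)\<^sup>2 / 2) integrable_on {0..1}" for j
      by (intro integrable_continuous_real continuous_intros pc \<sigma>c) auto
    show "\<bar>(p j t)\<^sup>2 * (\<sigma> t)\<^sup>2 / 2\<bar> \<le> K1" if "t \<in> {0..1} - N" for j t using k_bd[of t j] that by auto
    show "(\<lambda>j. (p j t)\<^sup>2 * (\<sigma> t)\<^sup>2 / 2) \<longlonglongrightarrow> (u t)\<^sup>2 * (\<sigma> t)\<^sup>2 / 2" if "t \<in> {0..1} - N" for t
      using that by (intro tendsto_intros p_lim) auto
  qed
  have "\<forall>\<^sub>F j in sequentially. integral {0..1} (\<lambda>t. \<bar>(p j t)\<^sup>2 * (\<sigma> t)\<^sup>2 / 2 - f t / p j t\<bar>) < \<epsilon> \<and>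
     dist (integral {0..1} (\<lambda>t. (p j t)\<^sup>2 * (\<sigma> t)\<^sup>2 / 2)) (integral {0..1} (\<lambda>t. (u t)\<^sup>2 * (\<sigma> t)\<^sup>2 / 2)) < \<epsilon> / 2"
    using order_tendstoD(2)[OF D1, of \<epsilon>] I1 tendstoD[OF D2, of "\<epsilon> / 2"] \<open>\<epsilon> > 0\<close> by (intro eventually_conj) auto
  from eventually_happens'[OF sequentially_bot this] obtain j where j: "integral {0..1} (\<lambda>t. \<bar>(p j t)\<^sup>2 * (\<sigma> t)\<^sup>2 / 2 - f t / p j t\<bar>) < \<epsilon>"
     "\<bar>integral {0..1} (\<lambda>t. (p j t)\<^sup>2 * (\<sigma> t)\<^sup>2 / 2) - integral {0..1} (\<lambda>t. (u t)\<^sup>2 * (\<sigma> t)\<^sup>2 / 2)\<bar> < \<epsilon> / 2"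
    unfolding dist_real_def by blast
  show ?thesis
  proof (rule that[OF p(1)[of j] p_pos j(1)])
    show "\<bar>integral {0..1} (\<lambda>t. (p j t)\<^sup>2 * (\<sigma> t)\<^sup>2 / 2) - integral {0..1} (\<lambda>t. (f t * \<sigma> t) powr (2 / 3) / 2 powr (1 / 3))\<bar> < \<epsilon>"
      using j(2) m(2) i(2) unfolding I2 \<rho>_def[symmetric] Q_def[symmetric] by linarith
    show "(\<lambda>t. (f t * \<sigma> t) powr (2 / 3) / 2 powr (1 / 3)) integrable_on {0..1}"
      using Qint(1)[of 0] by (simp add: Q_def)
  qed auto
qed

end

section \<open>Riemann sums and barriers\<close>

lemma sum_integral_partition:
  fixes F :: "real \<Rightarrow> real"
  assumes "F integrable_on {0..1}" "n \<ge> 1" "m \<le> n"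
  shows "(\<Sum>j=1..m. integral {real (j - 1) / real n..real j / real n} F) = integral {0..real m / real n} F"
  using assms(3)
proof (induction m)
  case (Suc m)
  have "F integrable_on {0..real (Suc m) / real n}"
    by (rule integrable_on_subinterval[OF assms(1)]) (use Suc(2) assms(2) in auto)
  then have "integral {0..real m / real n} F + integral {real m / real n..real (Suc m) / real n} F = integral {0..real (Suc m) / real n} F"
    by (intro Henstock_Kurzweil_Integration.integral_combine) (auto simp: divide_right_mono)
  then show ?case using Suc by simp
qed simp

lemma unif_cont_01:
  fixes k :: "real \<Rightarrow> real"
  assumes "continuous_on {0..1} k" "e > 0"
  obtains \<delta> where "\<delta> > 0" "\<And>s t. s \<in> {0..1} \<Longrightarrow> t \<in> {0..1} \<Longrightarrow> \<bar>s - t\<bar> < \<delta> \<Longrightarrow> \<bar>k s - k t\<bar> < e"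
proof -
  have "uniformly_continuous_on {0..1} k" using assms(1) by (intro compact_uniformly_continuous) auto
  then show ?thesis using that assms(2) unfolding uniformly_continuous_on_def dist_real_def by metis
qed

lemma eventually_inverse_less: "\<delta> > 0 \<Longrightarrow> \<forall>\<^sub>F n in sequentially. n \<ge> 1 \<and> K / real n < (\<delta>::real)"
proof -
  assume "\<delta> > 0"
  have "(\<lambda>n. K / real n) \<longlonglongrightarrow> 0" by (rule tendsto_divide_0[OF tendsto_const]) (rule filterlim_at_top_imp_at_infinity, rule filterlim_real_sequentially)
  then have "\<forall>\<^sub>F n in sequentially. K / real n < \<delta>" using \<open>\<delta> > 0\<close> by (rule order_tendstoD)
  then show ?thesis using eventually_ge_at_top[of 1] by eventually_elim simp
qed

locale derivative_approx_fun = derivative_approx +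
  fixes h :: "real \<Rightarrow> real"
  assumes h: "\<And>s t. 0 \<le> s \<Longrightarrow> s \<le> t \<Longrightarrow> t \<le> 1 \<Longrightarrow> (f has_integral (h t - h s)) {s..t}"
begin

text \<open>For j = 0 truncated subtraction gives the increment 0, so a term of index 0 can be added
  to sums and products at will.\<close>

definition incr :: "nat \<Rightarrow> nat \<Rightarrow> real" where
  "incr n j = h (real j / real n) - h (real (j - 1) / real n)"

lemma cell:
  assumes "j \<in> {1..n}"
  shows "0 \<le> real (j - 1) / real n" "real (j - 1) / real n \<le> real j / real n" "real j / real n \<le> 1"
    "real j / real n - real (j - 1) / real n = 1 / real n"
  using assms by (auto simp: field_simps of_nat_diff)

lemma incr_integral: "j \<in> {1..n} \<Longrightarrow> (f has_integral incr n j) {real (j - 1) / real n..real j / real n}"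
  unfolding incr_def using cell by (intro h) auto

lemma incr_0: "incr n 0 = 0" by (simp add: incr_def)

lemma incr_bounds: assumes "j \<le> n" "n \<ge> 1" shows "0 \<le> incr n j" "incr n j \<le> H / real n"
proof -
  show "0 \<le> incr n j"
  proof (cases "j = 0")
    case False
    then show ?thesis using has_integral_nonneg[OF incr_integral[of j n]] f0 assms by auto
  qed (simp add: incr_0)
  show "incr n j \<le> H / real n"
  proof (cases "j = 0")
    case False
    then have j: "j \<in> {1..n}" using assms by auto
    have "incr n j \<le> (real j / real n - real (j - 1) / real n) * H"
      using has_integral_le[OF incr_integral[OF j] has_integral_const_real[of H]] fH cell(2)[OF j] by simp
    then show ?thesis unfolding cell(4)[OF j] by simp
  qed (use H_nn in \<open>simp add: incr_0\<close>)
qed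

text \<open>On each cell \<gamma> oscillates by less than e1 and f is at most H, so a cell
  contributes an error of at most e1 H / n.\<close>

lemma stieltjes_sum:
  assumes \<gamma>: "continuous_on {0..1} \<gamma>"
  shows "(\<lambda>n. \<Sum>j=1..n. incr n j * \<gamma> (real j / real n)) \<longlonglongrightarrow> integral {0..1} (\<lambda>t. f t * \<gamma> t)"
proof (rule LIMSEQ_I)
  fix e :: real assume "e > 0"
  define e1 where "e1 = e / 2 / (H + 1)"
  have e1: "e1 > 0" using \<open>e > 0\<close> H_nn by (simp add: e1_def)
  have "e1 * (H + 1) = e / 2"
    unfolding e1_def using H_nn by (intro nonzero_eq_divide_eq[THEN iffD1]) auto
  then have e1': "e1 * H < e" using \<open>e > 0\<close> e1 by (simp add: algebra_simps)
  obtain \<delta> where \<delta>: "\<delta> > 0" "\<And>s t. s \<in> {0..1} \<Longrightarrow> t \<in> {0..1} \<Longrightarrow> \<bar>s - t\<bar> < \<delta> \<Longrightarrow> \<bar>\<gamma> s - \<gamma> t\<bar> < e1"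
    using unif_cont_01[OF \<gamma> e1] by blast
  have int: "(\<lambda>t. f t * \<gamma> t) integrable_on {0..1}" by (rule integrable_mult_cont[OF \<gamma>])
  have "norm ((\<Sum>j=1..n. incr n j * \<gamma> (real j / real n)) - integral {0..1} (\<lambda>t. f t * \<gamma> t)) < e"
    if n: "n \<ge> 1" "1 / real n < \<delta>" for n
  proof -
    have "integral {0..1} (\<lambda>t. f t * \<gamma> t) = (\<Sum>j=1..n. integral {real (j - 1) / real n..real j / real n} (\<lambda>t. f t * \<gamma> t))"
      using sum_integral_partition[OF int n(1), of n] n(1) by simp
    then have "\<bar>(\<Sum>j=1..n. incr n j * \<gamma> (real j / real n)) - integral {0..1} (\<lambda>t. f t * \<gamma> t)\<bar>
       \<le> (\<Sum>j=1..n. \<bar>incr n j * \<gamma> (real j / real n) - integral {real (j - 1) / real n..real j / real n} (\<lambda>t. f t * \<gamma> t)\<bar>)"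
      by (simp only: sum_subtractf[symmetric] sum_abs)
    also have "\<dots> \<le> (\<Sum>j=1..n. e1 * H / real n)"
    proof (rule sum_mono)
      fix j assume j: "j \<in> {1..n}"
      let ?I = "{real (j - 1) / real n..real j / real n}"
      note c = cell[OF j]
      have iI: "((\<lambda>t. f t * \<gamma> t) has_integral integral ?I (\<lambda>t. f t * \<gamma> t)) ?I"
        by (intro integrable_integral integrable_on_subinterval[OF int]) (use c in auto)
      have "((\<lambda>t. f t * \<gamma> (real j / real n) - f t * \<gamma> t) has_integral (incr n j * \<gamma> (real j / real n) - integral ?I (\<lambda>t. f t * \<gamma> t))) ?I"
        by (intro has_integral_diff has_integral_mult_left incr_integral j iI)
      moreover have "norm (f t * \<gamma> (real j / real n) - f t * \<gamma> t) \<le> e1 * H" if t: "t \<in> ?I" for t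
      proof -
        have "\<bar>\<gamma> (real j / real n) - \<gamma> t\<bar> < e1"
          by (rule \<delta>(2)) (use t[unfolded atLeastAtMost_iff] c n(2) in \<open>unfold atLeastAtMost_iff, linarith+\<close>)
        then have "\<bar>\<gamma> (real j / real n) - \<gamma> t\<bar> * \<bar>f t\<bar> \<le> e1 * H"
          using f0[of t] fH[of t] by (intro mult_mono) auto
        then show ?thesis unfolding right_diff_distrib[symmetric] real_norm_def abs_mult by (simp add: mult.commute)
      qed
      ultimately have "norm (incr n j * \<gamma> (real j / real n) - integral ?I (\<lambda>t. f t * \<gamma> t)) \<le> e1 * H * measure lborel ?I"
        using e1 H_nn by (intro has_integral_bound_real[where S = "{}"]) auto
      also have "measure lborel ?I = 1 / real n" using measure_lborel_Icc[OF c(2)] c(4) by simp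
      finally show "\<bar>incr n j * \<gamma> (real j / real n) - integral ?I (\<lambda>t. f t * \<gamma> t)\<bar> \<le> e1 * H / real n"
        by simp
    qed
    also have "\<dots> = e1 * H" using n(1) by simp
    finally show ?thesis using e1' by simp
  qed
  then show "\<exists>n0. \<forall>n\<ge>n0. norm ((\<Sum>j=1..n. incr n j * \<gamma> (real j / real n)) - integral {0..1} (\<lambda>t. f t * \<gamma> t)) < e"
    using eventually_inverse_less[OF \<delta>(1), of 1] unfolding eventually_sequentially by blast
qed

text \<open>In the step from j to j + 1 the weight carries the increment of h over the cell ending
  at j / n, while scale and variance are taken at (j + 1) / n. By uniform continuity this offset of
  at most 2 / n is harmless.\<close>

lemma discrepancy_sum:
  assumes kc: "continuous_on {0..1} k" and uc: "continuous_on {0..1} u" and "e > 0"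
  shows "\<forall>\<^sub>F n in sequentially. (\<Sum>j<n. \<bar>k (real (Suc j) / real n) / real n - incr n j * u (real (Suc j) / real n)\<bar>)
     \<le> integral {0..1} (\<lambda>t. \<bar>k t - f t * u t\<bar>) + e"
proof -
  define e1 where "e1 = e / 2 / (H + 1)"
  have e1: "e1 > 0" using \<open>e > 0\<close> H_nn by (simp add: e1_def)
  have e1': "e1 * (H + 1) = e / 2"
    unfolding e1_def using H_nn by (intro nonzero_eq_divide_eq[THEN iffD1]) auto
  obtain \<delta>1 where \<delta>1: "\<delta>1 > 0" "\<And>s t. s \<in> {0..1} \<Longrightarrow> t \<in> {0..1} \<Longrightarrow> \<bar>s - t\<bar> < \<delta>1 \<Longrightarrow> \<bar>k s - k t\<bar> < e1"
    using unif_cont_01[OF kc e1] by blast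
  obtain \<delta>2 where \<delta>2: "\<delta>2 > 0" "\<And>s t. s \<in> {0..1} \<Longrightarrow> t \<in> {0..1} \<Longrightarrow> \<bar>s - t\<bar> < \<delta>2 \<Longrightarrow> \<bar>u s - u t\<bar> < e1"
    using unif_cont_01[OF uc e1] by blast
  obtain K where "\<forall>t\<in>{0..1}. \<bar>k t\<bar> \<le> K"
    using compact_imp_bounded[OF compact_continuous_image[OF kc]] by (auto simp: bounded_iff)
  then have K: "\<bar>k t\<bar> \<le> K" if "t \<in> {0..1}" for t using that by blast
  let ?G = "\<lambda>t. \<bar>k t - f t * u t\<bar>"
  have int: "?G integrable_on {0..1}" by (rule integrable_absdiff[OF kc uc])
  have "(\<Sum>j<n. \<bar>k (real (Suc j) / real n) / real n - incr n j * u (real (Suc j) / real n)\<bar>) \<le> integral {0..1} ?G + e"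
    if n: "n \<ge> 1" "2 / real n < \<delta>1" "2 / real n < \<delta>2" "K / real n < e / 2" for n
  proof -
    define b where "b j = \<bar>k (real (Suc j) / real n) / real n - incr n j * u (real (Suc j) / real n)\<bar>" for j
    have b_le: "b j \<le> integral {real (j - 1) / real n..real j / real n} ?G + (e / 2) / real n" if j: "j \<in> {1..n - 1}" for j
    proof -
      have j': "j \<in> {1..n}" using j by auto
      let ?I = "{real (j - 1) / real n..real j / real n}"
      note c = cell[OF j']
      have s01: "real (Suc j) / real n \<in> {0..1}" using j by auto
      have iI: "(?G has_integral integral ?I ?G) ?I"
        by (intro integrable_integral integrable_on_subinterval[OF int]) (use c in auto)
      have len: "measure lborel ?I = 1 / real n" using measure_lborel_Icc[OF c(2)] c(4) by simp
      have 1: "((\<lambda>t. k (real (Suc j) / real n) - f t * u (real (Suc j) / real n)) has_integral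
          (k (real (Suc j) / real n) / real n - incr n j * u (real (Suc j) / real n))) ?I"
      proof (intro has_integral_diff has_integral_mult_left incr_integral j')
        show "((\<lambda>t. k (real (Suc j) / real n)) has_integral k (real (Suc j) / real n) / real n) ?I"
          using has_integral_const_real[of "k (real (Suc j) / real n)" "real (j - 1) / real n" "real j / real n"] len
          by simp
      qed
      have 2: "((\<lambda>t. ?G t + e1 * (H + 1)) has_integral (integral ?I ?G + (e / 2) / real n)) ?I"
        using has_integral_add[OF iI has_integral_const_real[of "e1 * (H + 1)" "real (j - 1) / real n" "real j / real n"]] len
        unfolding e1' by (simp add: mult.commute)
      have "norm (integral ?I (\<lambda>t. k (real (Suc j) / real n) - f t * u (real (Suc j) / real n))) \<le> integral ?I (\<lambda>t. ?G t + e1 * (H + 1))"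
      proof (rule integral_norm_bound_integral[OF has_integral_integrable[OF 1] has_integral_integrable[OF 2]])
        fix t assume t: "t \<in> ?I"
        have d: "\<bar>real (Suc j) / real n - t\<bar> \<le> 2 / real n"
        proof -
          have "real (Suc j) / real n = real j / real n + 1 / real n" by (simp add: add_divide_distrib)
          moreover have "2 / real n = 1 / real n + 1 / real n" by simp
          ultimately show ?thesis using t[unfolded atLeastAtMost_iff] c(4) by linarith
        qed
        have t01: "t \<in> {0..1}" using t[unfolded atLeastAtMost_iff] c unfolding atLeastAtMost_iff by linarith
        have "\<bar>k (real (Suc j) / real n) - k t\<bar> < e1" "\<bar>u (real (Suc j) / real n) - u t\<bar> < e1"
          by (rule \<delta>1(2)[OF s01 t01] \<delta>2(2)[OF s01 t01]; use d n in linarith)+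
        moreover from this(2) have "\<bar>f t * (u (real (Suc j) / real n) - u t)\<bar> \<le> H * e1"
          unfolding abs_mult using f0[of t] fH[of t] by (intro mult_mono) auto
        moreover have "k (real (Suc j) / real n) - f t * u (real (Suc j) / real n) =
            (k t - f t * u t) + (k (real (Suc j) / real n) - k t) - f t * (u (real (Suc j) / real n) - u t)"
          by (simp add: algebra_simps)
        moreover have "e1 * (H + 1) = e1 + H * e1" by (simp add: algebra_simps)
        ultimately show "norm (k (real (Suc j) / real n) - f t * u (real (Suc j) / real n)) \<le> ?G t + e1 * (H + 1)"
          unfolding real_norm_def by linarith
      qed
      then show ?thesis unfolding integral_unique[OF 1] integral_unique[OF 2] b_def by simp
    qed
    have G_nn: "0 \<le> integral {real (j - 1) / real n..real j / real n} ?G" if "j \<in> {1..n}" for j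
      by (intro integral_nonneg integrable_on_subinterval[OF int]) (use cell[OF that] in auto)
    \<comment> \<open>For j = 0 there is no cell to compare with; the increment is 0 and only a term
      of order 1 / n remains.\<close>
    have b0: "b 0 \<le> e / 2"
    proof -
      have "b 0 = \<bar>k (1 / real n)\<bar> / real n" by (simp add: b_def incr_0)
      also have "\<dots> \<le> K / real n" using K[of "1 / real n"] n(1) by (intro divide_right_mono) auto
      finally show ?thesis using n(4) by linarith
    qed
    have "(\<Sum>j<n. b j) = b 0 + (\<Sum>j=1..n - 1. b j)"
    proof -
      have "{..<n} = insert 0 {1..n - 1}" using n(1) by auto
      then show ?thesis by simp
    qed
    also have "\<dots> \<le> e / 2 + (\<Sum>j=1..n. integral {real (j - 1) / real n..real j / real n} ?G + (e / 2) / real n)"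
    proof (intro add_mono b0)
      have "(\<Sum>j=1..n - 1. b j) \<le> (\<Sum>j=1..n - 1. integral {real (j - 1) / real n..real j / real n} ?G + (e / 2) / real n)"
        by (rule sum_mono[OF b_le])
      also have "\<dots> \<le> (\<Sum>j=1..n. integral {real (j - 1) / real n..real j / real n} ?G + (e / 2) / real n)"
        by (rule sum_mono2) (use G_nn \<open>e > 0\<close> in \<open>auto intro!: add_nonneg_nonneg\<close>)
      finally show "(\<Sum>j=1..n - 1. b j) \<le> (\<Sum>j=1..n. integral {real (j - 1) / real n..real j / real n} ?G + (e / 2) / real n)" .
    qed
    also have "\<dots> = e / 2 + (integral {0..1} ?G + e / 2)"
      using sum_integral_partition[OF int n(1), of n] n(1) by (simp add: sum.distrib)
    finally show ?thesis by (simp add: b_def)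
  qed
  note main = this
  show ?thesis
    using eventually_inverse_less[OF \<delta>1(1), of 2] eventually_inverse_less[OF \<delta>2(1), of 2]
      eventually_inverse_less[OF half_gt_zero[OF \<open>e > 0\<close>], of K]
    by eventually_elim (intro main, simp_all)
qed

section \<open>Lipschitz barriers above and below g\<close>

lemma upper_barrier:
  assumes "continuous_on {0..1} g" "\<epsilon> > 0"
  obtains \<gamma> L where "L-lipschitz_on {0..1} \<gamma>" "\<And>t. t \<in> {0..1} \<Longrightarrow> g t \<le> \<gamma> t"
    "integral {0..1} (\<lambda>t. f t * \<gamma> t) \<le> integral {0..1} (\<lambda>t. f t * g t) + \<epsilon>"
proof -
  define \<eta> where "\<eta> = \<epsilon> / (2 * (H + 1))"
  have \<eta>: "\<eta> > 0" "2 * \<eta> * H \<le> \<epsilon>" using assms(2) H_nn by (auto simp: \<eta>_def field_simps)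
  have gc: "continuous_on {0..1} (\<lambda>t. g t + \<eta>)" by (intro continuous_intros assms)
  obtain p L where p: "L-lipschitz_on {0..1} p" "\<And>t. t \<in> {0..1} \<Longrightarrow> \<bar>g t + \<eta> - p t\<bar> < \<eta>"
    using continuous_lipschitz_approx[OF gc \<eta>(1)] by metis
  have pc: "continuous_on {0..1} p" by (rule lipschitz_on_continuous_on[OF p(1)])
  show ?thesis
  proof (rule that[OF p(1)])
    show "g t \<le> p t" if "t \<in> {0..1}" for t using p(2)[OF that] by linarith
    have "integral {0..1} (\<lambda>t. f t * p t) \<le> integral {0..1} (\<lambda>t. f t * g t + 2 * \<eta> * H)"
    proof (intro integral_le integrable_add integrable_mult_cont pc assms(1) integrable_const_ivl)
      fix t :: real assume t: "t \<in> {0..1}"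
      have "f t * p t \<le> f t * (g t + 2 * \<eta>)" using p(2)[OF t] by (intro mult_left_mono f0) linarith
      also have "\<dots> \<le> f t * g t + 2 * \<eta> * H" using fH[of t] \<eta>(1) by (simp add: algebra_simps)
      finally show "f t * p t \<le> f t * g t + 2 * \<eta> * H" .
    qed
    also have "\<dots> = integral {0..1} (\<lambda>t. f t * g t) + 2 * \<eta> * H"
      by (simp add: integral_add integrable_mult_cont assms(1) integrable_const_ivl)
    finally show "integral {0..1} (\<lambda>t. f t * p t) \<le> integral {0..1} (\<lambda>t. f t * g t) + \<epsilon>" using \<eta>(2) by linarith
  qed
qed

text \<open>The start \<gamma> 0 has to be small so that it falls into the support of the
  subsolution. A spike of width 1 / m is subtracted at time 0; as f is bounded, its integral against
  f tends to 0, and only the Lipschitz constant grows with m.\<close>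

lemma lower_barrier:
  assumes "continuous_on {0..1} g" "\<epsilon> > 0" "g 0 > 0" "s > 0"
  obtains \<gamma> L where "L-lipschitz_on {0..1} \<gamma>" "\<And>t. t \<in> {0..1} \<Longrightarrow> \<gamma> t \<le> g t" "0 < \<gamma> 0" "\<gamma> 0 < s"
    "integral {0..1} (\<lambda>t. f t * g t) - \<epsilon> \<le> integral {0..1} (\<lambda>t. f t * \<gamma> t)"
proof -
  \<comment> \<open>The second bound keeps p 0 > g 0 - 2 \<eta> positive.\<close>
  define \<eta> where "\<eta> = min (\<epsilon> / (4 * (H + 1))) (g 0 / 4)"
  have \<eta>: "\<eta> > 0" "\<eta> \<le> g 0 / 4" using assms H_nn unfolding \<eta>_def by (simp, intro min.cobounded2)
  have "\<eta> \<le> \<epsilon> / (4 * (H + 1))" by (simp add: \<eta>_def)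
  then have "4 * \<eta> * (H + 1) \<le> \<epsilon>" using H_nn by (simp add: field_simps)
  then have \<eta>H: "2 * \<eta> * H \<le> \<epsilon> / 2" using \<eta>(1) by (simp add: algebra_simps)
  have gc: "continuous_on {0..1} (\<lambda>t. g t - \<eta>)" by (intro continuous_intros assms)
  obtain p L where p: "L-lipschitz_on {0..1} p" "\<And>t. t \<in> {0..1} \<Longrightarrow> \<bar>g t - \<eta> - p t\<bar> < \<eta>"
    using continuous_lipschitz_approx[OF gc \<eta>(1)] by metis
  have pc: "continuous_on {0..1} p" by (rule lipschitz_on_continuous_on[OF p(1)])
  have p0: "p 0 > 0" using p(2)[of 0] \<eta> assms(3) by auto
  define v where "v = min (s / 2) (p 0)"
  have v: "0 < v" "v < s" "v \<le> p 0" using assms p0 by (auto simp: v_def)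
  define q where "q m t = max 0 (1 - real m * t)" for m t
  have q: "0 \<le> q m t" "q m t \<le> 1" if "0 \<le> t" for m t using that by (auto simp: q_def)
  have qc: "continuous_on {0..1} (q m)" for m unfolding q_def by (intro continuous_intros)
  have "(\<lambda>m. integral {0..1} (\<lambda>t. f t * q m t)) \<longlonglongrightarrow> integral {0..1} (\<lambda>t::real. 0::real)"
  proof (rule dominated_convergence_ae(2)[OF integrable_mult_cont[OF qc]])
    show "negligible {0::real}" by simp
    show "\<bar>f t * q m t\<bar> \<le> H" if "t \<in> {0..1} - {0}" for m t
      using q[of t m] f0[of t] fH[of t] that mult_mono[of "f t" H "q m t" 1] H_nn by (simp add: abs_mult)
    show "(\<lambda>m. f t * q m t) \<longlonglongrightarrow> 0" if "t \<in> {0..1} - {0}" for t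
    proof (rule tendsto_eventually)
      have "\<forall>\<^sub>F m in sequentially. 1 \<le> real m * t"
      proof -
        obtain m0 :: nat where m0: "1 / t \<le> real m0" using real_arch_simple by blast
        show ?thesis using eventually_ge_at_top[of m0]
        proof eventually_elim
          case (elim m)
          then have "1 / t \<le> real m" using m0 by simp
          then show ?case using that by (simp add: field_simps)
        qed
      qed
      then show "\<forall>\<^sub>F m in sequentially. f t * q m t = 0" by eventually_elim (simp add: q_def)
    qed
  qed
  then have "(\<lambda>m. (p 0 - v) * integral {0..1} (\<lambda>t. f t * q m t)) \<longlonglongrightarrow> 0"
    by (intro tendsto_mult_right_zero) simp
  then have "\<forall>\<^sub>F m in sequentially. (p 0 - v) * integral {0..1} (\<lambda>t. f t * q m t) < \<epsilon> / 2"
    using assms(2) by (intro order_tendstoD(2)) auto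
  from eventually_happens'[OF sequentially_bot this]
  obtain m where m: "(p 0 - v) * integral {0..1} (\<lambda>t. f t * q m t) < \<epsilon> / 2" by blast
  define \<gamma> where "\<gamma> t = p t - (p 0 - v) * q m t" for t
  show ?thesis
  proof (rule that)
    have ql: "(real m)-lipschitz_on {0..1} (q m)"
    proof (rule lipschitz_onI)
      fix x y :: real
      have "\<bar>max 0 (1 - real m * x) - max 0 (1 - real m * y)\<bar> \<le> \<bar>real m * x - real m * y\<bar>" by linarith
      then show "dist (q m x) (q m y) \<le> real m * dist x y"
        by (simp add: q_def dist_real_def right_diff_distrib[symmetric] abs_mult)
    qed simp
    have "(L + \<bar>p 0 - v\<bar> * real m)-lipschitz_on {0..1} (\<lambda>t. p t - (p 0 - v) * q m t)"
      using lipschitz_on_diff[OF p(1) lipschitz_on_cmult_real[OF ql, of "p 0 - v"]] .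
    then show "(L + \<bar>p 0 - v\<bar> * real m)-lipschitz_on {0..1} \<gamma>" unfolding \<gamma>_def .
    show "\<gamma> t \<le> g t" if "t \<in> {0..1}" for t
    proof -
      have "0 \<le> (p 0 - v) * q m t" using q(1)[of t m] that v(3) by (intro mult_nonneg_nonneg) auto
      then show ?thesis using p(2)[OF that] unfolding \<gamma>_def by linarith
    qed
    show "0 < \<gamma> 0" "\<gamma> 0 < s" using v by (auto simp: \<gamma>_def q_def)
    have "integral {0..1} (\<lambda>t. f t * g t) \<le> integral {0..1} (\<lambda>t. f t * p t + 2 * \<eta> * H)"
    proof (intro integral_le integrable_add integrable_mult_cont pc assms(1) integrable_const_ivl)
      fix t :: real assume t: "t \<in> {0..1}"
      have "f t * g t \<le> f t * (p t + 2 * \<eta>)" using p(2)[OF t] by (intro mult_left_mono f0) linarith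
      also have "\<dots> \<le> f t * p t + 2 * \<eta> * H" using fH[of t] \<eta>(1) by (simp add: algebra_simps)
      finally show "f t * g t \<le> f t * p t + 2 * \<eta> * H" .
    qed
    also have "\<dots> = integral {0..1} (\<lambda>t. f t * p t) + 2 * \<eta> * H"
      by (simp add: integral_add integrable_mult_cont pc integrable_const_ivl)
    finally have 1: "integral {0..1} (\<lambda>t. f t * g t) \<le> integral {0..1} (\<lambda>t. f t * p t) + \<epsilon> / 2" using \<eta>H by linarith
    have "integral {0..1} (\<lambda>t. f t * \<gamma> t) = integral {0..1} (\<lambda>t. f t * p t - f t * ((p 0 - v) * q m t))"
      by (simp add: \<gamma>_def right_diff_distrib)
    also have "\<dots> = integral {0..1} (\<lambda>t. f t * p t) - integral {0..1} (\<lambda>t. f t * ((p 0 - v) * q m t))"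
      by (intro integral_diff integrable_mult_cont continuous_intros pc qc)
    also have "integral {0..1} (\<lambda>t. f t * ((p 0 - v) * q m t)) = (p 0 - v) * integral {0..1} (\<lambda>t. f t * q m t)"
      unfolding mult.left_commute[of "f _"] by (rule integral_mult_right)
    finally show "integral {0..1} (\<lambda>t. f t * g t) - \<epsilon> \<le> integral {0..1} (\<lambda>t. f t * \<gamma> t)" using 1 m by linarith
  qed
qed

end

section \<open>Weighted random walks\<close>

context prob_space
begin

section \<open>Iteration of one-step inequalities along independent increments\<close>

lemma nn_integral_indep_var:
  assumes ind: "indep_var S Y T X" and f: "f \<in> borel_measurable (S \<Otimes>\<^sub>M T)"
  shows "(\<integral>\<^sup>+ w. f (Y w, X w) \<partial>M) = (\<integral>\<^sup>+ w. \<integral>\<^sup>+ w'. f (Y w, X w') \<partial>M \<partial>M)"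
proof -
  have Y: "Y \<in> measurable M S" and X: "X \<in> measurable M T"
    using indep_var_rv1[OF ind] indep_var_rv2[OF ind] by auto
  interpret X: prob_space "distr M T X" by (rule prob_space_distr[OF X])
  interpret Y: prob_space "distr M S Y" by (rule prob_space_distr[OF Y])
  have eq: "(\<integral>\<^sup>+ x. f (y, x) \<partial>distr M T X) = (\<integral>\<^sup>+ w'. f (y, X w') \<partial>M)" if "y \<in> space S" for y
  proof (rule nn_integral_distr[OF X])
    show "(\<lambda>x. f (y, x)) \<in> borel_measurable (distr M T X)"
      using measurable_compose[OF measurable_Pair1'[OF that] f] by simp
  qed
  have "(\<integral>\<^sup>+ w. f (Y w, X w) \<partial>M) = (\<integral>\<^sup>+ z. f z \<partial>distr M (S \<Otimes>\<^sub>M T) (\<lambda>w. (Y w, X w)))"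
    using X Y f by (subst nn_integral_distr) auto
  also have "\<dots> = (\<integral>\<^sup>+ z. f z \<partial>(distr M S Y \<Otimes>\<^sub>M distr M T X))"
    using ind by (simp add: indep_var_distribution_eq)
  also have "\<dots> = (\<integral>\<^sup>+ y. \<integral>\<^sup>+ x. f (y, x) \<partial>distr M T X \<partial>distr M S Y)"
    by (rule X.nn_integral_fst[symmetric]) (use f in simp)
  also have "\<dots> = (\<integral>\<^sup>+ y. \<integral>\<^sup>+ w'. f (y, X w') \<partial>M \<partial>distr M S Y)"
    by (intro nn_integral_cong eq) simp
  also have "\<dots> = (\<integral>\<^sup>+ w. \<integral>\<^sup>+ w'. f (Y w, X w') \<partial>M \<partial>M)"
  proof (rule nn_integral_distr[OF Y])
    have "(\<lambda>y. \<integral>\<^sup>+ x. f (y, x) \<partial>distr M T X) \<in> borel_measurable S"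
      by (rule X.borel_measurable_nn_integral_fst) (use f in simp)
    then have "(\<lambda>y. \<integral>\<^sup>+ w'. f (y, X w') \<partial>M) \<in> borel_measurable S"
      by (subst measurable_cong[OF eq[symmetric]])
    then show "(\<lambda>y. \<integral>\<^sup>+ w'. f (y, X w') \<partial>M) \<in> borel_measurable (distr M S Y)" by simp
  qed
  finally show ?thesis .
qed

context
  fixes X :: "nat \<Rightarrow> 'a \<Rightarrow> real" and n :: nat and w V :: "nat \<Rightarrow> real \<Rightarrow> ennreal"
  assumes ind: "indep_vars (\<lambda>_. borel) X {1..n}"
    and w [measurable]: "\<And>j. w j \<in> borel_measurable borel"
    and V [measurable]: "\<And>j. V j \<in> borel_measurable borel"
begin

text \<open>Conditioning on the first m increments: all weights depend on them alone, so the last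
  increment can be integrated out with the present position frozen.\<close>

lemma weighted_walk_step:
  assumes m: "m < n"
  shows "(\<integral>\<^sup>+ \<omega>. (\<Prod>i<Suc m. w i (\<Sum>k=1..i. X k \<omega>)) * V (Suc m) (\<Sum>k=1..Suc m. X k \<omega>) \<partial>M) =
    (\<integral>\<^sup>+ \<omega>. (\<Prod>i<m. w i (\<Sum>k=1..i. X k \<omega>)) *
       (w m (\<Sum>k=1..m. X k \<omega>) * (\<integral>\<^sup>+ \<omega>'. V (Suc m) ((\<Sum>k=1..m. X k \<omega>) + X (Suc m) \<omega>') \<partial>M)) \<partial>M)"
proof -
  define Y where "Y \<omega> = restrict (\<lambda>i. X i \<omega>) {1..m}" for \<omega>
  define X' where "X' \<omega> = restrict (\<lambda>i. X i \<omega>) {Suc m}" for \<omega>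
  have "indep_var (PiM {1..m} (\<lambda>_. borel)) (\<lambda>\<omega>. restrict (\<lambda>i. X i \<omega>) {1..m})
      (PiM {Suc m} (\<lambda>_. borel)) (\<lambda>\<omega>. restrict (\<lambda>i. X i \<omega>) {Suc m})"
    by (rule indep_var_restrict[OF ind]) (use m in auto)
  then have iv: "indep_var (PiM {1..m} (\<lambda>_. borel)) Y (PiM {Suc m} (\<lambda>_. borel)) X'"
    by (simp add: Y_def[abs_def] X'_def[abs_def])
  define s where "s i y = (\<Sum>k=1..i. y k)" for i and y :: "nat \<Rightarrow> real"
  have sY: "s i (Y \<omega>) = (\<Sum>k=1..i. X k \<omega>)" if "i \<le> m" for i \<omega>
    unfolding s_def Y_def using that by (intro sum.cong) auto
  have s_meas: "s i \<in> borel_measurable (PiM {1..m} (\<lambda>_. borel))" if "i \<le> m" for i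
    unfolding s_def using that by (intro borel_measurable_sum measurable_component_singleton) auto
  have prodY: "(\<Prod>i<j. w i (s i (Y \<omega>))) = (\<Prod>i<j. w i (\<Sum>k=1..i. X k \<omega>))" if "j \<le> Suc m" for j \<omega>
    using that by (intro prod.cong) (auto simp: sY)
  define f where "f z = (\<Prod>i<Suc m. w i (s i (fst z))) * V (Suc m) (s m (fst z) + snd z (Suc m))" for z
  have w_meas: "(\<lambda>y. w i (s i y)) \<in> borel_measurable (PiM {1..m} (\<lambda>_. borel))" if "i \<le> m" for i
    by (rule measurable_compose[OF s_meas[OF that] w])
  have f_meas: "f \<in> borel_measurable (PiM {1..m} (\<lambda>_. borel) \<Otimes>\<^sub>M PiM {Suc m} (\<lambda>_. borel))"
    unfolding f_def
  proof (intro borel_measurable_times_ennreal borel_measurable_prod_ennreal)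
    show "(\<lambda>z. w i (s i (fst z))) \<in> borel_measurable (PiM {1..m} (\<lambda>_. borel) \<Otimes>\<^sub>M PiM {Suc m} (\<lambda>_. borel))" if "i \<in> {..<Suc m}" for i
      by (rule measurable_compose[OF measurable_fst w_meas]) (use that in auto)
    have "(\<lambda>z. s m (fst z) + snd z (Suc m)) \<in> borel_measurable (PiM {1..m} (\<lambda>_. borel) \<Otimes>\<^sub>M PiM {Suc m} (\<lambda>_. borel))"
      by (intro borel_measurable_add measurable_compose[OF measurable_fst s_meas]
          measurable_compose[OF measurable_snd measurable_component_singleton]) auto
    then show "(\<lambda>z. V (Suc m) (s m (fst z) + snd z (Suc m))) \<in> borel_measurable (PiM {1..m} (\<lambda>_. borel) \<Otimes>\<^sub>M PiM {Suc m} (\<lambda>_. borel))"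
      by (rule measurable_compose[OF _ V])
  qed
  have "(\<integral>\<^sup>+ \<omega>. (\<Prod>i<Suc m. w i (\<Sum>k=1..i. X k \<omega>)) * V (Suc m) (\<Sum>k=1..Suc m. X k \<omega>) \<partial>M)
      = (\<integral>\<^sup>+ \<omega>. f (Y \<omega>, X' \<omega>) \<partial>M)"
    by (intro nn_integral_cong) (simp add: f_def prodY sY X'_def del: prod.lessThan_Suc)
  also have "\<dots> = (\<integral>\<^sup>+ \<omega>. \<integral>\<^sup>+ \<omega>'. f (Y \<omega>, X' \<omega>') \<partial>M \<partial>M)"
    by (rule nn_integral_indep_var[OF iv f_meas])
  also have "\<dots> = (\<integral>\<^sup>+ \<omega>. (\<Prod>i<Suc m. w i (s i (Y \<omega>))) * (\<integral>\<^sup>+ \<omega>'. V (Suc m) (s m (Y \<omega>) + X (Suc m) \<omega>') \<partial>M) \<partial>M)"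
  proof (rule nn_integral_cong)
    fix \<omega>
    have [measurable]: "X (Suc m) \<in> borel_measurable M"
      using measurable_compose[OF indep_var_rv2[OF iv] measurable_component_singleton[of "Suc m"]] by (simp add: X'_def)
    show "(\<integral>\<^sup>+ \<omega>'. f (Y \<omega>, X' \<omega>') \<partial>M) =
        (\<Prod>i<Suc m. w i (s i (Y \<omega>))) * (\<integral>\<^sup>+ \<omega>'. V (Suc m) (s m (Y \<omega>) + X (Suc m) \<omega>') \<partial>M)"
      unfolding f_def X'_def by (simp add: nn_integral_cmult del: prod.lessThan_Suc)
  qed
  also have "\<dots> = (\<integral>\<^sup>+ \<omega>. (\<Prod>i<m. w i (\<Sum>k=1..i. X k \<omega>)) *
       (w m (\<Sum>k=1..m. X k \<omega>) * (\<integral>\<^sup>+ \<omega>'. V (Suc m) ((\<Sum>k=1..m. X k \<omega>) + X (Suc m) \<omega>') \<partial>M)) \<partial>M)"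
    by (intro nn_integral_cong) (simp add: prodY sY mult.assoc)
  finally show ?thesis .
qed

lemma walk_measurable:
  assumes "m \<le> n"
  shows "(\<lambda>\<omega>. (\<Prod>i<m. w i (\<Sum>k=1..i. X k \<omega>)) * V m (\<Sum>k=1..m. X k \<omega>)) \<in> borel_measurable M"
proof -
  have X: "X k \<in> borel_measurable M" if "k \<in> {1..n}" for k
    using ind that by (auto simp: indep_vars_def)
  have "(\<lambda>\<omega>. \<Sum>k=1..i. X k \<omega>) \<in> borel_measurable M" if "i \<le> m" for i
    using that assms by (intro borel_measurable_sum X) auto
  then show ?thesis
    by (intro borel_measurable_times_ennreal borel_measurable_prod_ennreal measurable_compose[OF _ w] measurable_compose[OF _ V]) auto
qed

text \<open>A supermartingale argument without conditional expectations: a one-step inequality valid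
  at every position multiplies up along the path.\<close>

lemma weighted_walk_upper:
  assumes step: "\<And>j s. j < n \<Longrightarrow> w j s * (\<integral>\<^sup>+ \<omega>. V (Suc j) (s + X (Suc j) \<omega>) \<partial>M) \<le> \<rho> j * V j s"
    and "m \<le> n"
  shows "(\<integral>\<^sup>+ \<omega>. (\<Prod>i<m. w i (\<Sum>k=1..i. X k \<omega>)) * V m (\<Sum>k=1..m. X k \<omega>) \<partial>M) \<le> (\<Prod>j<m. \<rho> j) * V 0 0"
  using assms(2)
proof (induction m)
  case (Suc m)
  have "(\<integral>\<^sup>+ \<omega>. (\<Prod>i<Suc m. w i (\<Sum>k=1..i. X k \<omega>)) * V (Suc m) (\<Sum>k=1..Suc m. X k \<omega>) \<partial>M)
    \<le> (\<integral>\<^sup>+ \<omega>. (\<Prod>i<m. w i (\<Sum>k=1..i. X k \<omega>)) * (\<rho> m * V m (\<Sum>k=1..m. X k \<omega>)) \<partial>M)"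
    using Suc(2) by (subst weighted_walk_step) (auto intro!: nn_integral_mono mult_left_mono step)
  also have "\<dots> = \<rho> m * (\<integral>\<^sup>+ \<omega>. (\<Prod>i<m. w i (\<Sum>k=1..i. X k \<omega>)) * V m (\<Sum>k=1..m. X k \<omega>) \<partial>M)"
    using walk_measurable[of m] Suc(2) by (subst nn_integral_cmult[symmetric]) (auto simp: mult_ac)
  also have "\<dots> \<le> \<rho> m * ((\<Prod>j<m. \<rho> j) * V 0 0)"
    using Suc by (intro mult_left_mono) auto
  finally show ?case by (simp add: mult_ac)
qed (simp add: emeasure_space_1)

lemma weighted_walk_lower:
  assumes step: "\<And>j s. j < n \<Longrightarrow> \<rho> j * V j s \<le> w j s * (\<integral>\<^sup>+ \<omega>. V (Suc j) (s + X (Suc j) \<omega>) \<partial>M)"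
    and "m \<le> n"
  shows "(\<Prod>j<m. \<rho> j) * V 0 0 \<le> (\<integral>\<^sup>+ \<omega>. (\<Prod>i<m. w i (\<Sum>k=1..i. X k \<omega>)) * V m (\<Sum>k=1..m. X k \<omega>) \<partial>M)"
  using assms(2)
proof (induction m)
  case (Suc m)
  have "(\<Prod>j<Suc m. \<rho> j) * V 0 0 = \<rho> m * ((\<Prod>j<m. \<rho> j) * V 0 0)" by (simp add: mult_ac)
  also have "\<dots> \<le> \<rho> m * (\<integral>\<^sup>+ \<omega>. (\<Prod>i<m. w i (\<Sum>k=1..i. X k \<omega>)) * V m (\<Sum>k=1..m. X k \<omega>) \<partial>M)"
    using Suc by (intro mult_left_mono) auto
  also have "\<dots> = (\<integral>\<^sup>+ \<omega>. (\<Prod>i<m. w i (\<Sum>k=1..i. X k \<omega>)) * (\<rho> m * V m (\<Sum>k=1..m. X k \<omega>)) \<partial>M)"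
    using walk_measurable[of m] Suc(2) by (subst nn_integral_cmult[symmetric]) (auto simp: mult_ac)
  also have "\<dots> \<le> (\<integral>\<^sup>+ \<omega>. (\<Prod>i<Suc m. w i (\<Sum>k=1..i. X k \<omega>)) * V (Suc m) (\<Sum>k=1..Suc m. X k \<omega>) \<partial>M)"
    using Suc(2) by (subst weighted_walk_step) (auto intro!: nn_integral_mono mult_left_mono step)
  finally show ?case .
qed (simp add: emeasure_space_1)

end

section \<open>Moment estimates for a single increment\<close>

lemma cubic_polynomial_expectation:
  fixes X :: "'a \<Rightarrow> real"
  assumes "integrable M X" "integrable M (\<lambda>\<omega>. (X \<omega>)\<^sup>2)" "integrable M (\<lambda>\<omega>. \<bar>X \<omega>\<bar> ^ 3)"
    and "expectation X = 0"
  shows "integrable M (\<lambda>\<omega>. A0 + A1 * (t * X \<omega>) + A2 * (t * X \<omega>)\<^sup>2 / 2 + A3 * \<bar>t * X \<omega>\<bar> ^ 3)"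
    "expectation (\<lambda>\<omega>. A0 + A1 * (t * X \<omega>) + A2 * (t * X \<omega>)\<^sup>2 / 2 + A3 * \<bar>t * X \<omega>\<bar> ^ 3) =
      A0 + A2 * (t\<^sup>2 * expectation (\<lambda>\<omega>. (X \<omega>)\<^sup>2)) / 2 + A3 * (\<bar>t\<bar> ^ 3 * expectation (\<lambda>\<omega>. \<bar>X \<omega>\<bar> ^ 3))"
proof -
  have eq: "A0 + A1 * (t * x) + A2 * (t * x)\<^sup>2 / 2 + A3 * \<bar>t * x\<bar> ^ 3 =
      A0 + (A1 * t) * x + (A2 * t\<^sup>2 / 2) * x\<^sup>2 + (A3 * \<bar>t\<bar> ^ 3) * \<bar>x\<bar> ^ 3" for x
    by (simp add: abs_mult power_mult_distrib)
  show "integrable M (\<lambda>\<omega>. A0 + A1 * (t * X \<omega>) + A2 * (t * X \<omega>)\<^sup>2 / 2 + A3 * \<bar>t * X \<omega>\<bar> ^ 3)"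
    unfolding eq using assms
    by (intro Bochner_Integration.integrable_add integrable_const integrable_mult_right)
  show "expectation (\<lambda>\<omega>. A0 + A1 * (t * X \<omega>) + A2 * (t * X \<omega>)\<^sup>2 / 2 + A3 * \<bar>t * X \<omega>\<bar> ^ 3) =
      A0 + A2 * (t\<^sup>2 * expectation (\<lambda>\<omega>. (X \<omega>)\<^sup>2)) / 2 + A3 * (\<bar>t\<bar> ^ 3 * expectation (\<lambda>\<omega>. \<bar>X \<omega>\<bar> ^ 3))"
    unfolding eq using assms by (simp add: prob_space)
qed

lemma one_step_upper:
  fixes X :: "'a \<Rightarrow> real"
  assumes X: "integrable M X" "integrable M (\<lambda>\<omega>. (X \<omega>)\<^sup>2)" "integrable M (\<lambda>\<omega>. \<bar>X \<omega>\<bar> ^ 3)" "expectation X = 0"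
    and K: "expectation (\<lambda>\<omega>. \<bar>X \<omega>\<bar> ^ 3) \<le> K" and C: "C \<ge> 0"
    and \<Phi>: "\<And>d. 0 \<le> \<Phi> (z + d)" "\<And>d. \<Phi> (z + d) \<le> A0 + A1 * d + A2 * d\<^sup>2 / 2 + C * \<bar>d\<bar> ^ 3"
  shows "(\<integral>\<^sup>+ \<omega>. ennreal (\<Phi> (z + t * X \<omega>)) \<partial>M)
    \<le> ennreal (A0 + A2 * (t\<^sup>2 * expectation (\<lambda>\<omega>. (X \<omega>)\<^sup>2)) / 2 + C * (\<bar>t\<bar> ^ 3 * K))"
proof -
  define T where "T x = A0 + A1 * (t * x) + A2 * (t * x)\<^sup>2 / 2 + C * \<bar>t * x\<bar> ^ 3" for x
  have "(\<integral>\<^sup>+ \<omega>. ennreal (\<Phi> (z + t * X \<omega>)) \<partial>M) \<le> (\<integral>\<^sup>+ \<omega>. ennreal (T (X \<omega>)) \<partial>M)"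
    unfolding T_def by (intro nn_integral_mono ennreal_leI \<Phi>)
  also have "\<dots> = ennreal (expectation (\<lambda>\<omega>. T (X \<omega>)))"
    using order.trans[OF \<Phi>] unfolding T_def
    by (intro nn_integral_eq_integral cubic_polynomial_expectation X) auto
  also have "\<dots> \<le> ennreal (A0 + A2 * (t\<^sup>2 * expectation (\<lambda>\<omega>. (X \<omega>)\<^sup>2)) / 2 + C * (\<bar>t\<bar> ^ 3 * K))"
    unfolding T_def cubic_polynomial_expectation(2)[OF X] using C K
    by (intro ennreal_leI add_left_mono mult_left_mono) auto
  finally show ?thesis .
qed

lemma one_step_lower:
  fixes X :: "'a \<Rightarrow> real"
  assumes X: "integrable M X" "integrable M (\<lambda>\<omega>. (X \<omega>)\<^sup>2)" "integrable M (\<lambda>\<omega>. \<bar>X \<omega>\<bar> ^ 3)" "expectation X = 0"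
    and K: "expectation (\<lambda>\<omega>. \<bar>X \<omega>\<bar> ^ 3) \<le> K" and C: "C \<ge> 0"
    and \<Phi>: "\<And>d. A0 + A1 * d + A2 * d\<^sup>2 / 2 - C * \<bar>d\<bar> ^ 3 \<le> \<Phi> (z + d)"
  shows "ennreal (A0 + A2 * (t\<^sup>2 * expectation (\<lambda>\<omega>. (X \<omega>)\<^sup>2)) / 2 - C * (\<bar>t\<bar> ^ 3 * K))
    \<le> (\<integral>\<^sup>+ \<omega>. ennreal (\<Phi> (z + t * X \<omega>)) \<partial>M)"
proof -
  define T where "T x = A0 + A1 * (t * x) + A2 * (t * x)\<^sup>2 / 2 + (- C) * \<bar>t * x\<bar> ^ 3" for x
  have int: "integrable M (\<lambda>\<omega>. T (X \<omega>))" unfolding T_def by (intro cubic_polynomial_expectation X)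
  have "A0 + A2 * (t\<^sup>2 * expectation (\<lambda>\<omega>. (X \<omega>)\<^sup>2)) / 2 - C * (\<bar>t\<bar> ^ 3 * K) \<le>
     A0 + A2 * (t\<^sup>2 * expectation (\<lambda>\<omega>. (X \<omega>)\<^sup>2)) / 2 + (- C) * (\<bar>t\<bar> ^ 3 * expectation (\<lambda>\<omega>. \<bar>X \<omega>\<bar> ^ 3))"
    using mult_left_mono[OF mult_left_mono[OF K, of "\<bar>t\<bar> ^ 3"] C] by simp
  also have "\<dots> = expectation (\<lambda>\<omega>. T (X \<omega>))"
    unfolding T_def cubic_polynomial_expectation(2)[OF X] by (rule refl)
  \<comment> \<open>The cubic minorant may be negative, and \<open>ennreal\<close> sends negative
    numbers to 0; truncating at 0 first only increases the expectation and still stays below the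
    nonnegative integral of the test function.\<close>
  also have "\<dots> \<le> expectation (\<lambda>\<omega>. max 0 (T (X \<omega>)))"
    by (intro integral_mono integrable_max int integrable_const) auto
  finally have "ennreal (A0 + A2 * (t\<^sup>2 * expectation (\<lambda>\<omega>. (X \<omega>)\<^sup>2)) / 2 - C * (\<bar>t\<bar> ^ 3 * K))
     \<le> ennreal (expectation (\<lambda>\<omega>. max 0 (T (X \<omega>))))" by (rule ennreal_leI)
  also have "\<dots> = (\<integral>\<^sup>+ \<omega>. ennreal (max 0 (T (X \<omega>))) \<partial>M)"
    by (intro nn_integral_eq_integral[symmetric] integrable_max int integrable_const) auto
  also have "\<dots> \<le> (\<integral>\<^sup>+ \<omega>. ennreal (\<Phi> (z + t * X \<omega>)) \<partial>M)"
  proof (intro nn_integral_mono)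
    fix \<omega>
    have "T (X \<omega>) \<le> \<Phi> (z + t * X \<omega>)" using \<Phi>[of "t * X \<omega>"] by (simp add: T_def)
    then show "ennreal (max 0 (T (X \<omega>))) \<le> ennreal (\<Phi> (z + t * X \<omega>))"
      by (cases "T (X \<omega>) \<ge> 0") (auto simp: max_def ennreal_leI)
  qed
  finally show ?thesis .
qed

text \<open>Each power is dominated by a single term of the exponential series: |x|^k \<le> k!
  \<mu>^(-k) exp (\<mu> |x|).\<close>

lemma exponential_moment_bounds:
  fixes X :: "'a \<Rightarrow> real"
  assumes [measurable]: "X \<in> borel_measurable M" and "\<mu> > 0"
    and B: "(\<integral>\<^sup>+ \<omega>. ennreal (exp (\<mu> * \<bar>X \<omega>\<bar>)) \<partial>M) \<le> ennreal B" and "B \<ge> 0"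
  shows "integrable M X" "integrable M (\<lambda>\<omega>. (X \<omega>)\<^sup>2)" "integrable M (\<lambda>\<omega>. \<bar>X \<omega>\<bar> ^ 3)"
    "expectation (\<lambda>\<omega>. \<bar>X \<omega>\<bar> ^ 3) \<le> fact 3 / \<mu> ^ 3 * B"
proof -
  have int: "integrable M (\<lambda>\<omega>. exp (\<mu> * \<bar>X \<omega>\<bar>))"
    by (rule integrableI_nonneg) (use B order.strict_trans1[OF B ennreal_less_top] in auto)
  have pow: "\<bar>x\<bar> ^ k \<le> fact k / \<mu> ^ k * exp (\<mu> * \<bar>x\<bar>)" for x :: real and k
  proof -
    have "(\<mu> * \<bar>x\<bar>) ^ k \<le> fact k * exp (\<mu> * \<bar>x\<bar>)" using assms(2) by (intro power_le_fact_exp) simp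
    then show ?thesis using assms(2) by (simp add: field_simps power_mult_distrib)
  qed
  have ints: "integrable M (\<lambda>\<omega>. \<bar>X \<omega>\<bar> ^ k)" for k
    by (rule Bochner_Integration.integrable_bound[OF integrable_mult_right[OF int, of "fact k / \<mu> ^ k"]])
       (use pow assms(2) in \<open>auto simp: abs_mult power_abs intro!: AE_I2\<close>)
  show "integrable M X" using ints[of 1] by (simp add: integrable_abs_iff)
  show "integrable M (\<lambda>\<omega>. (X \<omega>)\<^sup>2)" using ints[of 2] by simp
  show "integrable M (\<lambda>\<omega>. \<bar>X \<omega>\<bar> ^ 3)" by (rule ints)
  have "expectation (\<lambda>\<omega>. \<bar>X \<omega>\<bar> ^ 3) \<le> expectation (\<lambda>\<omega>. fact 3 / \<mu> ^ 3 * exp (\<mu> * \<bar>X \<omega>\<bar>))"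
    by (intro integral_mono ints integrable_mult_right int pow)
  also have "\<dots> = fact 3 / \<mu> ^ 3 * expectation (\<lambda>\<omega>. exp (\<mu> * \<bar>X \<omega>\<bar>))"
    by (rule Bochner_Integration.integral_mult_right) (rule int)
  also have "\<dots> \<le> fact 3 / \<mu> ^ 3 * B"
  proof (rule mult_left_mono)
    have "ennreal (expectation (\<lambda>\<omega>. exp (\<mu> * \<bar>X \<omega>\<bar>))) \<le> ennreal B"
      using B int by (subst nn_integral_eq_integral[symmetric]) auto
    then show "expectation (\<lambda>\<omega>. exp (\<mu> * \<bar>X \<omega>\<bar>)) \<le> B" using assms(4) by (simp add: ennreal_le_iff)
  qed (use assms(2) in simp)
  finally show "expectation (\<lambda>\<omega>. \<bar>X \<omega>\<bar> ^ 3) \<le> fact 3 / \<mu> ^ 3 * B" .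
qed

end

section \<open>One-step estimates\<close>

text \<open>The change of the coordinate z = c y + const over one step, caused by the motion of
  scale and barrier while the walk stands still.\<close>

lemma frac_shift_bound:
  fixes c c' y :: real
  assumes "0 < cm" "cm \<le> c" "c' \<le> cM" "0 < c'" "\<bar>c' - c\<bar> \<le> Lc / n" "\<bar>\<Delta>\<bar> \<le> L\<gamma> / n" "0 \<le> y" "y \<le> Y"
  shows "\<bar>c' * (y + \<Delta>) - c * y\<bar> \<le> Lc / n * Y + cM * (L\<gamma> / n)"
proof -
  have "\<bar>c' * (y + \<Delta>) - c * y\<bar> = \<bar>(c' - c) * y + c' * \<Delta>\<bar>" by (simp add: algebra_simps)
  also have "\<dots> \<le> \<bar>c' - c\<bar> * y + c' * \<bar>\<Delta>\<bar>"
    using abs_triangle_ineq[of "(c' - c) * y" "c' * \<Delta>"] assms by (simp add: abs_mult)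
  also have "\<dots> \<le> Lc / n * Y + cM * (L\<gamma> / n)"
    using assms by (intro add_mono mult_mono) auto
  finally show ?thesis .
qed

text \<open>N stands for n^(1/3), y for the rescaled distance to the barrier, D for the increment of
  h. The left side is the weight times the expected Taylor majorant. Three bounds are multiplied:
  passing from z to z' costs exp (C K1 / (\<kappa> n)), the majorant is at most P z' exp (q (m + 2
  \<delta>) + O(1/n)), and the weight is rewritten through y = (z' - \<alpha>) / c' - \<Delta>. In
  the exponent the terms linear in m combine into the mismatch k / n - D / c'.\<close>

lemma upper_step_estimate:
  fixes P P2 :: "real \<Rightarrow> real"
  assumes pk: "\<kappa> > 0" "r > 0" "C \<ge> 0" "Z \<ge> 0"
    and low: "\<And>z. z \<ge> \<alpha> - r \<Longrightarrow> \<kappa> \<le> P z"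
    and super: "\<And>z. z \<ge> \<alpha> - r \<Longrightarrow> P2 z \<le> (min z Z + 2 * \<delta>) * P z"
    and lip: "\<And>z z' \<eta>. z \<ge> \<alpha> \<Longrightarrow> z' \<ge> \<alpha> - r \<Longrightarrow> \<eta> \<le> 1 / 2 \<Longrightarrow> \<bar>z' - z\<bar> \<le> \<eta> * (1 + \<bar>z\<bar>) \<Longrightarrow> P z' \<le> P z + C * \<eta>"
    and N: "N \<ge> 1" "n = N ^ 3"
    and c: "0 < cm" "cm \<le> c" "cm \<le> c'" "c' \<le> cM" "\<bar>c' - c\<bar> \<le> Lc / n" "\<bar>\<Delta>\<bar> \<le> L\<gamma> / n" "0 \<le> Lc" "0 \<le> L\<gamma>"
    and D: "0 \<le> D" "D \<le> H / n" and v: "0 \<le> v" and K3: "0 \<le> K3" and y: "0 \<le> y"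
    and K1: "K1 = Lc * (1 + \<bar>\<alpha>\<bar>) / cm + cM * L\<gamma>" "K1 / n \<le> 1 / 2" "cM * L\<gamma> / n \<le> r"
    and z: "z = c * y + \<alpha>" and z': "z' = c' * (y + \<Delta>) + \<alpha>" and k: "k = c'\<^sup>2 * v / 2"
  shows "exp (D * (N * (\<gamma> - y))) * (P z' + P2 z' * ((c' / N)\<^sup>2 * v) / 2 + C * ((c' / N) ^ 3 * K3))
    \<le> exp (N * (D * \<gamma> + (\<alpha> + 2 * \<delta>) * (k / n) + (Z + \<bar>\<alpha>\<bar> + r) * \<bar>k / n - D / c'\<bar>)
         + (C * cM ^ 3 * K3 / \<kappa> + C * K1 / \<kappa> + H * L\<gamma>) / n) * P z"
proof -
  have n0: "n > 0" "N \<le> n" using N power_increasing[of 1 3 N] by auto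
  have c'0: "c' > 0" "cM > 0" using c by auto
  have za: "z \<ge> \<alpha>" using y c by (simp add: z)
  have y_le: "y \<le> (1 + \<bar>\<alpha>\<bar>) * (1 + \<bar>z\<bar>) / cm"
  proof -
    have "y = (z - \<alpha>) / c" using c by (simp add: z)
    also have "\<dots> \<le> (z - \<alpha>) / cm" using za c by (intro divide_left_mono) auto
    also have "z - \<alpha> \<le> \<bar>z\<bar> + \<bar>\<alpha>\<bar>" by simp
    also have "\<bar>z\<bar> + \<bar>\<alpha>\<bar> \<le> (1 + \<bar>\<alpha>\<bar>) * (1 + \<bar>z\<bar>)" by (simp add: algebra_simps)
    finally show ?thesis using c by (simp add: divide_right_mono)
  qed
  have dz: "\<bar>z' - z\<bar> \<le> (K1 / n) * (1 + \<bar>z\<bar>)"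
  proof -
    have "\<bar>z' - z\<bar> \<le> Lc / n * ((1 + \<bar>\<alpha>\<bar>) * (1 + \<bar>z\<bar>) / cm) + cM * (L\<gamma> / n)"
      using frac_shift_bound[OF c(1,2,4) c'0(1) c(5,6) y y_le] by (simp add: z z')
    also have "cM * (L\<gamma> / n) \<le> cM * (L\<gamma> / n) * (1 + \<bar>z\<bar>)"
    proof -
      have "0 \<le> cM * (L\<gamma> / n)" using c'0 c n0 by simp
      then show ?thesis using mult_left_mono[of 1 "1 + \<bar>z\<bar>" "cM * (L\<gamma> / n)"] by simp
    qed
    finally have "\<bar>z' - z\<bar> \<le> Lc / n * ((1 + \<bar>\<alpha>\<bar>) * (1 + \<bar>z\<bar>) / cm) + cM * (L\<gamma> / n) * (1 + \<bar>z\<bar>)" by simp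
    also have "\<dots> = (K1 / n) * (1 + \<bar>z\<bar>)" using c n0 by (simp add: K1(1) field_simps)
    finally show ?thesis .
  qed
  have z'a: "z' \<ge> \<alpha> - r"
  proof -
    have "c' * (- \<Delta>) \<le> cM * (L\<gamma> / n)" using c c'0 n0 by (intro order.trans[OF mult_left_mono mult_right_mono]) auto
    moreover have "c' * y \<ge> 0" using c'0 y by simp
    ultimately show ?thesis using K1(3) by (simp add: z' distrib_left)
  qed
  have Pz: "P z > 0" "\<kappa> \<le> P z" and Pz': "P z' > 0" "\<kappa> \<le> P z'"
    using low[of z] low[OF z'a] za pk by auto
  \<comment> \<open>The capped coordinate: |m - \<alpha>| \<le> Z + |\<alpha>| + r, whatever the
    position of the walk.\<close>
  define m where "m = min z' Z"
  \<comment> \<open>Half the variance of one step in the coordinate z: (c' / N)^2 v / 2 = k / N^2 =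
    N k / n.\<close>
  define q where "q = N * (k / n)"
  define K2 where "K2 = C * cM ^ 3 * K3"
  have K2: "K2 \<ge> 0" using pk K3 c'0 by (simp add: K2_def)
  have q_eq: "((c' / N)\<^sup>2 * v) / 2 = q"
    using N by (simp add: q_def k power_divide power2_eq_square power3_eq_cube)
  have q0: "q \<ge> 0" using N n0 v by (simp add: q_def k)
  have 1: "P z' + P2 z' * ((c' / N)\<^sup>2 * v) / 2 + C * ((c' / N) ^ 3 * K3) \<le> P z' * exp (q * (m + 2 * \<delta>) + K2 / (\<kappa> * n))"
  proof -
    have "P2 z' * q \<le> ((m + 2 * \<delta>) * P z') * q" using super[OF z'a] q0 by (intro mult_right_mono) (auto simp: m_def)
    moreover have "C * ((c' / N) ^ 3 * K3) \<le> P z' * (K2 / (\<kappa> * n))"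
    proof -
      have "(c' / N) ^ 3 = c' ^ 3 / n" by (simp add: power_divide N)
      also have "\<dots> \<le> cM ^ 3 / n" using c c'0 n0 by (intro divide_right_mono power_mono) auto
      finally have "C * ((c' / N) ^ 3 * K3) \<le> C * (cM ^ 3 / n * K3)" using pk K3 by (intro mult_left_mono mult_right_mono) auto
      also have "\<dots> = \<kappa> * (K2 / (\<kappa> * n))" using pk n0 by (simp add: K2_def)
      also have "\<dots> \<le> P z' * (K2 / (\<kappa> * n))" using Pz' K2 pk n0 by (intro mult_right_mono) auto
      finally show ?thesis .
    qed
    moreover have eq: "P2 z' * ((c' / N)\<^sup>2 * v) / 2 = P2 z' * q" unfolding q_eq[symmetric] by simp
    ultimately have "P z' + P2 z' * ((c' / N)\<^sup>2 * v) / 2 + C * ((c' / N) ^ 3 * K3) \<le> P z' * (1 + (q * (m + 2 * \<delta>) + K2 / (\<kappa> * n)))"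
      unfolding eq by (simp add: algebra_simps)
    also have "\<dots> \<le> P z' * exp (q * (m + 2 * \<delta>) + K2 / (\<kappa> * n))" using Pz'(1) by (intro mult_left_mono exp_ge_add_one_self) auto
    finally show ?thesis .
  qed
  \<comment> \<open>The lower bound \<kappa> of P turns the additive error C K1 / n into a
    factor.\<close>
  have 2: "P z' \<le> P z * exp (C * K1 / (\<kappa> * n))"
  proof -
    have "P z' \<le> P z + C * (K1 / n)" by (rule lip[OF za z'a K1(2) dz])
    also have "C * (K1 / n) = \<kappa> * (C * K1 / (\<kappa> * n))" using pk by simp
    also have "\<dots> \<le> P z * (C * K1 / (\<kappa> * n))"
      using Pz pk n0 c c'0 by (intro mult_right_mono divide_nonneg_nonneg mult_nonneg_nonneg) (auto simp: K1(1))
    finally have "P z' \<le> P z * (1 + C * K1 / (\<kappa> * n))" by (simp add: algebra_simps)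
    also have "\<dots> \<le> P z * exp (C * K1 / (\<kappa> * n))" using Pz(1) by (intro mult_left_mono exp_ge_add_one_self) auto
    finally show ?thesis .
  qed
  \<comment> \<open>The weight decreases in z', so putting the smaller m in its place only enlarges
    the bound.\<close>
  have 3: "D * (N * (\<gamma> - y)) \<le> N * D * \<gamma> - N * (D / c') * (m - \<alpha>) + H * L\<gamma> / n"
  proof -
    have y_eq: "y = (z' - \<alpha>) / c' - \<Delta>" using c'0 by (simp add: z')
    have "N * (D / c') * (m - \<alpha>) \<le> N * (D / c') * (z' - \<alpha>)"
      using N D c'0 by (intro mult_left_mono) (auto simp: m_def)
    moreover have "N * D * \<Delta> \<le> H * L\<gamma> / n"
    proof -
      have "N * D * \<Delta> \<le> n * (H / n) * (L\<gamma> / n)"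
        using N D c n0 order.trans[OF D] by (intro order.trans[OF mult_left_mono[of \<Delta> "L\<gamma> / n" "N * D"]] mult_mono mult_right_mono) auto
      then show ?thesis using n0 by simp
    qed
    ultimately show ?thesis unfolding y_eq using c'0 by (simp add: algebra_simps)
  qed
  have W: "(k / n - D / c') * (m - \<alpha>) \<le> (Z + \<bar>\<alpha>\<bar> + r) * \<bar>k / n - D / c'\<bar>"
  proof -
    have "\<bar>m - \<alpha>\<bar> \<le> Z + \<bar>\<alpha>\<bar> + r" using z'a pk by (auto simp: m_def min_def)
    then have "\<bar>(k / n - D / c') * (m - \<alpha>)\<bar> \<le> (Z + \<bar>\<alpha>\<bar> + r) * \<bar>k / n - D / c'\<bar>"
      unfolding abs_mult mult.commute[of "Z + \<bar>\<alpha>\<bar> + r"] by (intro mult_left_mono) auto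
    then show ?thesis by (rule order.trans[OF abs_ge_self])
  qed
  have 4: "(N * D * \<gamma> - N * (D / c') * (m - \<alpha>) + H * L\<gamma> / n) + (q * (m + 2 * \<delta>) + K2 / (\<kappa> * n)) + C * K1 / (\<kappa> * n)
     \<le> N * (D * \<gamma> + (\<alpha> + 2 * \<delta>) * (k / n) + (Z + \<bar>\<alpha>\<bar> + r) * \<bar>k / n - D / c'\<bar>) + (K2 / \<kappa> + C * K1 / \<kappa> + H * L\<gamma>) / n"
  proof -
    have "(N * D * \<gamma> - N * u * (m - \<alpha>)) + N * l * (m + 2 * \<delta>) =
       N * (D * \<gamma> + (\<alpha> + 2 * \<delta>) * l + (l - u) * (m - \<alpha>))" for u l by (simp add: algebra_simps)
    then have "(N * D * \<gamma> - N * (D / c') * (m - \<alpha>)) + q * (m + 2 * \<delta>) =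
       N * (D * \<gamma> + (\<alpha> + 2 * \<delta>) * (k / n) + (k / n - D / c') * (m - \<alpha>))"
      unfolding q_def .
    also have "\<dots> \<le> N * (D * \<gamma> + (\<alpha> + 2 * \<delta>) * (k / n) + (Z + \<bar>\<alpha>\<bar> + r) * \<bar>k / n - D / c'\<bar>)"
      using W N by (intro mult_left_mono) auto
    finally show ?thesis by (simp add: add_divide_distrib)
  qed
  have "exp (D * (N * (\<gamma> - y))) * (P z' + P2 z' * ((c' / N)\<^sup>2 * v) / 2 + C * ((c' / N) ^ 3 * K3))
    \<le> exp (N * D * \<gamma> - N * (D / c') * (m - \<alpha>) + H * L\<gamma> / n) * ((P z * exp (C * K1 / (\<kappa> * n))) * exp (q * (m + 2 * \<delta>) + K2 / (\<kappa> * n)))"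
  proof (rule order.trans[OF mult_left_mono[OF 1]])
    show "exp (D * (N * (\<gamma> - y))) * (P z' * exp (q * (m + 2 * \<delta>) + K2 / (\<kappa> * n)))
      \<le> exp (N * D * \<gamma> - N * (D / c') * (m - \<alpha>) + H * L\<gamma> / n) * ((P z * exp (C * K1 / (\<kappa> * n))) * exp (q * (m + 2 * \<delta>) + K2 / (\<kappa> * n)))"
      using 2 3 Pz' by (intro mult_mono) (auto intro: mult_nonneg_nonneg less_imp_le)
  qed simp
  also have "\<dots> = exp ((N * D * \<gamma> - N * (D / c') * (m - \<alpha>) + H * L\<gamma> / n) + (q * (m + 2 * \<delta>) + K2 / (\<kappa> * n)) + C * K1 / (\<kappa> * n)) * P z"
    by (simp add: exp_add mult_ac)
  also have "\<dots> \<le> exp (N * (D * \<gamma> + (\<alpha> + 2 * \<delta>) * (k / n) + (Z + \<bar>\<alpha>\<bar> + r) * \<bar>k / n - D / c'\<bar>) + (K2 / \<kappa> + C * K1 / \<kappa> + H * L\<gamma>) / n) * P z"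
    using 4 Pz(1) by (intro mult_right_mono) auto
  finally show ?thesis by (simp add: K2_def)
qed

text \<open>The counterpart of the upper estimate, with two differences. The factor 1 + x is bounded
  below by exp (x - 2 x^2), where x = O(N / n) makes x^2 = O(1 / n). And P vanishes at the ends of
  its support, so additive errors of order 1 / n cannot be turned into a factor; they are paid by
  \<delta>' q, which is larger by a factor of order N.\<close>

lemma lower_step_estimate:
  fixes P P2 :: "real \<Rightarrow> real"
  assumes pk: "r > 0" "C \<ge> 0" "\<delta>' > 0" "a < B"
    and sub: "\<And>z. z \<in> {a - r..B + r} \<Longrightarrow> (z - \<delta>) * P z + \<delta>' \<le> P2 z"
    and lip: "\<And>z z'. z \<in> {a..B} \<Longrightarrow> z' \<in> {a - r..B + r} \<Longrightarrow> \<bar>P z' - P z\<bar> \<le> C * \<bar>z' - z\<bar>"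
    and nn: "\<And>z. z \<in> {a..B} \<Longrightarrow> 0 \<le> P z"
    and N: "N \<ge> 1" "n = N ^ 3"
    and c: "0 < cm" "cm \<le> c" "cm \<le> c'" "c' \<le> cM" "\<bar>c' - c\<bar> \<le> Lc / n" "\<bar>\<Delta>\<bar> \<le> L\<gamma> / n" "0 \<le> Lc" "0 \<le> L\<gamma>"
    and D: "0 \<le> D" "D \<le> H / n" and K3: "0 \<le> K3" and y: "0 \<le> y"
    and K1: "K1 = Lc * ((B - a) / cm) + cM * L\<gamma>" "K1 / n \<le> r"
    and z: "z = c * y + a" "z \<le> B" and z': "z' = c' * (y + \<Delta>) + a" and k: "k = c'\<^sup>2 * v / 2" "km \<le> k" "k \<le> kM" "0 < km"
    and X0: "X0 = \<bar>a\<bar> + \<bar>B\<bar> + r + \<bar>\<delta>\<bar>" "N * (kM / n) * X0 \<le> 1 / 2"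
    and big: "C * cM ^ 3 * K3 + 2 * C * K1 \<le> N * km * \<delta>'"
  shows "exp (N * (D * \<gamma> + (a - \<delta>) * (k / n) - (B - a + r) * \<bar>k / n - D / c'\<bar>)
         - (2 * (kM * X0)\<^sup>2 + H * L\<gamma>) / n) * P z
    \<le> exp (D * (N * (\<gamma> - y))) * (P z' + P2 z' * ((c' / N)\<^sup>2 * v) / 2 - C * ((c' / N) ^ 3 * K3))"
proof -
  have n0: "n > 0" "N \<le> n" using N power_increasing[of 1 3 N] by auto
  have c'0: "c' > 0" "cM > 0" using c by auto
  have za: "z \<in> {a..B}" using y c z by simp
  have y_le: "y \<le> (B - a) / cm"
  proof -
    have "cm * y \<le> c * y" using c y by (intro mult_right_mono) auto
    then show ?thesis using z c by (simp add: field_simps)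
  qed
  have dz: "\<bar>z' - z\<bar> \<le> K1 / n"
    using frac_shift_bound[OF c(1,2,4) c'0(1) c(5,6) y y_le] by (simp add: z z' K1(1) add_divide_distrib mult.commute[of n cm])
  have z'a: "z' \<in> {a - r..B + r}" using dz K1(2) za by auto
  define q where "q = N * (k / n)"
  define x where "x = q * (z' - \<delta>)"
  have q_eq: "P2 z' * ((c' / N)\<^sup>2 * v) / 2 = P2 z' * q"
    using N by (simp add: q_def k power_divide power2_eq_square power3_eq_cube)
  have q0: "q \<ge> 0" "q \<le> N * (kM / n)" using N n0 k by (auto simp: q_def divide_right_mono)
  have X0_nn: "X0 \<ge> 0" using pk by (simp add: X0)
  have "\<bar>z' - \<delta>\<bar> \<le> X0" using z'a pk by (auto simp: X0)
  then have x_abs: "\<bar>x\<bar> \<le> N * (kM / n) * X0" unfolding x_def abs_mult using q0 by (intro mult_mono) auto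
  then have x_half: "\<bar>x\<bar> \<le> 1 / 2" using X0(2) by linarith
  have x_sq: "x\<^sup>2 \<le> (kM * X0)\<^sup>2 / n"
  proof -
    have "\<bar>x\<bar>\<^sup>2 \<le> (N * (kM / n) * X0)\<^sup>2" using x_abs by (intro power_mono) auto
    also have "\<dots> = N\<^sup>2 * ((kM * X0)\<^sup>2 / n\<^sup>2)" by (simp add: power_mult_distrib power_divide)
    also have "\<dots> \<le> n * ((kM * X0)\<^sup>2 / n\<^sup>2)"
      using N power_increasing[of 2 3 N] by (intro mult_right_mono) auto
    also have "\<dots> = (kM * X0)\<^sup>2 / n" using n0 by (simp add: power2_eq_square)
    finally show ?thesis by simp
  qed
  have exp_x: "exp (x - 2 * x\<^sup>2) \<le> 1 + x"
  proof -
    have "x - 2 * x\<^sup>2 \<le> ln (1 + x)" using abs_ln_one_plus_x_minus_x_bound[OF x_half] by linarith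
    then have "exp (x - 2 * x\<^sup>2) \<le> exp (ln (1 + x))" by simp
    then show ?thesis using x_half by simp
  qed
  have 1: "P z * exp (x - 2 * x\<^sup>2) \<le> P z' + P2 z' * ((c' / N)\<^sup>2 * v) / 2 - C * ((c' / N) ^ 3 * K3)"
  proof -
    have "P2 z' * q \<ge> ((z' - \<delta>) * P z' + \<delta>') * q" using sub[OF z'a] q0 by (intro mult_right_mono) auto
    then have a1: "P2 z' * q \<ge> x * P z' + \<delta>' * q" by (simp add: x_def algebra_simps)
    have "(c' / N) ^ 3 = c' ^ 3 / n" by (simp add: power_divide N)
    also have "\<dots> \<le> cM ^ 3 / n" using c c'0 n0 by (intro divide_right_mono power_mono) auto
    finally have "C * ((c' / N) ^ 3 * K3) \<le> C * (cM ^ 3 / n * K3)" using pk K3 by (intro mult_left_mono mult_right_mono) auto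
    then have a2: "C * ((c' / N) ^ 3 * K3) \<le> C * cM ^ 3 * K3 / n" by (simp add: mult_ac)
    have a3: "\<bar>P z' - P z\<bar> \<le> C * (K1 / n)"
      using order.trans[OF lip[OF za z'a] mult_left_mono[OF dz pk(2)]] .
    \<comment> \<open>Exchanging P z for P z' costs at most 2 C K1 / n, as 1 + x \<le> 2.\<close>
    have a4: "(1 + x) * (P z' - P z) \<ge> - (2 * C * K1 / n)"
    proof -
      have "\<bar>(1 + x) * (P z' - P z)\<bar> \<le> 2 * (C * (K1 / n))" unfolding abs_mult
        using x_half a3 by (intro mult_mono) auto
      then show ?thesis by simp
    qed
    \<comment> \<open>The gap covers both the third-moment error and the cost of the exchange; this
      is where n has to be large.\<close>
    have a5: "(C * cM ^ 3 * K3 + 2 * C * K1) / n \<le> \<delta>' * q"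
    proof -
      have "(C * cM ^ 3 * K3 + 2 * C * K1) / n \<le> N * km * \<delta>' / n" using big n0 by (intro divide_right_mono) auto
      also have "\<dots> \<le> N * k * \<delta>' / n" using k N pk n0 by (intro divide_right_mono mult_right_mono mult_left_mono) auto
      finally show ?thesis by (simp add: q_def mult_ac)
    qed
    have "P z * exp (x - 2 * x\<^sup>2) \<le> P z * (1 + x)" using nn[OF za] exp_x by (intro mult_left_mono) auto
    also have "\<dots> = (1 + x) * P z' - (1 + x) * (P z' - P z)" by (simp add: algebra_simps)
    also have "\<dots> \<le> (1 + x) * P z' + 2 * C * K1 / n" using a4 by linarith
    also have "\<dots> \<le> P z' + P2 z' * q - C * ((c' / N) ^ 3 * K3)"
      using a1 a2 a5 by (simp add: add_divide_distrib algebra_simps)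
    finally show ?thesis unfolding q_eq .
  qed
  have 3: "N * D * \<gamma> - N * (D / c') * (z' - a) - H * L\<gamma> / n \<le> D * (N * (\<gamma> - y))"
  proof -
    have y_eq: "y = (z' - a) / c' - \<Delta>" using c'0 by (simp add: z')
    have "N * D * (- \<Delta>) \<le> H * L\<gamma> / n"
    proof -
      have "N * D * (- \<Delta>) \<le> n * (H / n) * (L\<gamma> / n)"
        using N D c n0 order.trans[OF D] by (intro order.trans[OF mult_left_mono[of "- \<Delta>" "L\<gamma> / n" "N * D"]] mult_mono mult_right_mono) auto
      then show ?thesis using n0 by simp
    qed
    then show ?thesis unfolding y_eq using c'0 by (simp add: algebra_simps)
  qed
  have W: "- ((B - a + r) * \<bar>k / n - D / c'\<bar>) \<le> (k / n - D / c') * (z' - a)"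
  proof -
    have "\<bar>z' - a\<bar> \<le> B - a + r" using z'a pk by auto
    then have "\<bar>(k / n - D / c') * (z' - a)\<bar> \<le> (B - a + r) * \<bar>k / n - D / c'\<bar>"
      unfolding abs_mult mult.commute[of "B - a + r"] by (intro mult_left_mono) auto
    then show ?thesis by (rule minus_le_iff[THEN iffD1, OF abs_le_D2])
  qed
  have 4: "N * (D * \<gamma> + (a - \<delta>) * (k / n) - (B - a + r) * \<bar>k / n - D / c'\<bar>) - (2 * (kM * X0)\<^sup>2 + H * L\<gamma>) / n
     \<le> (N * D * \<gamma> - N * (D / c') * (z' - a) - H * L\<gamma> / n) + (x - 2 * x\<^sup>2)"
  proof -
    have "N * (D * \<gamma> + (a - \<delta>) * (k / n) - (B - a + r) * \<bar>k / n - D / c'\<bar>)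
      \<le> N * (D * \<gamma> + (a - \<delta>) * (k / n) + (k / n - D / c') * (z' - a))"
      using W N by (intro mult_left_mono) auto
    also have "\<dots> = (N * D * \<gamma> - N * (D / c') * (z' - a)) + x"
    proof -
      have "N * (D * \<gamma> + (a - \<delta>) * l + (l - u) * (z' - a)) = (N * D * \<gamma> - N * u * (z' - a)) + N * l * (z' - \<delta>)" for u l
        by (simp add: algebra_simps)
      then show ?thesis unfolding x_def q_def .
    qed
    finally show ?thesis using x_sq by (simp add: add_divide_distrib)
  qed
  have "exp (N * (D * \<gamma> + (a - \<delta>) * (k / n) - (B - a + r) * \<bar>k / n - D / c'\<bar>) - (2 * (kM * X0)\<^sup>2 + H * L\<gamma>) / n) * P z
    \<le> exp ((N * D * \<gamma> - N * (D / c') * (z' - a) - H * L\<gamma> / n) + (x - 2 * x\<^sup>2)) * P z"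
    using 4 nn[OF za] by (intro mult_right_mono) auto
  also have "\<dots> = exp (N * D * \<gamma> - N * (D / c') * (z' - a) - H * L\<gamma> / n) * (P z * exp (x - 2 * x\<^sup>2))"
    by (simp only: exp_add mult_ac)
  also have "\<dots> \<le> exp (D * (N * (\<gamma> - y))) * (P z * exp (x - 2 * x\<^sup>2))"
    using 3 nn[OF za] by (intro mult_right_mono) auto
  also have "\<dots> \<le> exp (D * (N * (\<gamma> - y))) * (P z' + P2 z' * ((c' / N)\<^sup>2 * v) / 2 - C * ((c' / N) ^ 3 * K3))"
    using 1 by (intro mult_left_mono) auto
  finally show ?thesis .
qed

section \<open>Asymptotic bounds\<close>

text \<open>The Stieltjes sum for h t = t and f = 1.\<close>

lemma riemann_sum_right:
  fixes k :: "real \<Rightarrow> real"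
  assumes "continuous_on {0..1} k"
  shows "(\<lambda>n. \<Sum>j<n. k (real (Suc j) / real n) / real n) \<longlonglongrightarrow> integral {0..1} k"
proof -
  interpret I: derivative_approx_fun "\<lambda>_. 1" 1 "{}" "\<lambda>_ _. 1" "\<lambda>t. t"
  proof
    show "((\<lambda>_. 1) has_integral t - s) {s..t}" if "s \<le> t" for s t :: real
      using has_integral_const_real[of "1::real" s t] that by simp
  qed auto
  have "I.incr n j = 1 / real n" if "j \<in> {1..n}" for n j
    using I.cell(4)[OF that] by (simp add: I.incr_def)
  then have "(\<Sum>j=1..n. I.incr n j * k (real j / real n)) = (\<Sum>j=1..n. k (real j / real n) / real n)" for n
    by (intro sum.cong) auto
  moreover have "(\<Sum>j=1..n. k (real j / real n) / real n) = (\<Sum>j<n. k (real (Suc j) / real n) / real n)" for n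
    by (rule sum.reindex_bij_witness[of _ Suc "\<lambda>j. j - 1"]) auto
  ultimately show ?thesis using I.stieltjes_sum[OF assms] by simp
qed

definition cbrt :: "nat \<Rightarrow> real" where "cbrt n = real n powr (1 / 3)"

lemma cbrt:
  assumes "n \<ge> 1" shows "cbrt n \<ge> 1" "cbrt n ^ 3 = real n"
proof -
  show "cbrt n \<ge> 1" unfolding cbrt_def using assms by (simp add: ge_one_powr_ge_zero)
  have "cbrt n ^ 3 = real n powr (1 / 3 * real 3)"
    unfolding cbrt_def using assms by (subst powr_powr[symmetric], subst powr_realpow) auto
  then show "cbrt n ^ 3 = real n" using assms by simp
qed

lemma cbrt_at_top: "filterlim cbrt at_top sequentially"
  unfolding cbrt_def by real_asymp

lemma eventually_cbrt: "e > 0 \<Longrightarrow> \<forall>\<^sub>F n in sequentially. K / cbrt n < e"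
  by (rule order_tendstoD(2)[OF tendsto_divide_0[OF tendsto_const filterlim_at_top_imp_at_infinity[OF cbrt_at_top]]])

lemma positive_continuous_bounds:
  fixes c :: "real \<Rightarrow> real"
  assumes "continuous_on {0..1} c" "\<And>t. t \<in> {0..1} \<Longrightarrow> 0 < c t"
  obtains cm cM where "0 < cm" "\<And>t. t \<in> {0..1} \<Longrightarrow> cm \<le> c t" "\<And>t. t \<in> {0..1} \<Longrightarrow> c t \<le> cM"
proof -
  obtain t1 where "t1 \<in> {0..1}" "\<And>t. t \<in> {0..1} \<Longrightarrow> c t \<le> c t1"
    using continuous_attains_sup[of "{0..1::real}" c] assms(1) by auto
  moreover obtain t0 where "t0 \<in> {0..1}" "\<And>t. t \<in> {0..1} \<Longrightarrow> c t0 \<le> c t"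
    using continuous_attains_inf[of "{0..1::real}" c] assms(1) by auto
  ultimately show ?thesis using that[of "c t0" "c t1"] assms(2) by auto
qed

section \<open>The killed walk, its partition function and the two asymptotic bounds\<close>

locale killed_walk = prob_space M + derivative_approx_fun f H N a h
  for M :: "'a measure" and f H N a h +
  fixes X :: "nat \<Rightarrow> nat \<Rightarrow> 'a \<Rightarrow> real" and \<sigma> g :: "real \<Rightarrow> real" and K3 :: real
  assumes indep: "\<And>n. n \<ge> 1 \<Longrightarrow> indep_vars (\<lambda>_. borel) (X n) {1..n}"
    and X_int: "\<And>n k. 1 \<le> k \<Longrightarrow> k \<le> n \<Longrightarrow> integrable M (X n k)"
      "\<And>n k. 1 \<le> k \<Longrightarrow> k \<le> n \<Longrightarrow> integrable M (\<lambda>w. (X n k w)\<^sup>2)"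
      "\<And>n k. 1 \<le> k \<Longrightarrow> k \<le> n \<Longrightarrow> integrable M (\<lambda>w. \<bar>X n k w\<bar> ^ 3)"
    and centred: "\<And>n k. 1 \<le> k \<Longrightarrow> k \<le> n \<Longrightarrow> expectation (X n k) = 0"
    and variance: "\<And>n k. 1 \<le> k \<Longrightarrow> k \<le> n \<Longrightarrow> expectation (\<lambda>w. (X n k w)\<^sup>2) = (\<sigma> (real k / real n))\<^sup>2"
    and third: "\<And>n k. 1 \<le> k \<Longrightarrow> k \<le> n \<Longrightarrow> expectation (\<lambda>w. \<bar>X n k w\<bar> ^ 3) \<le> K3" and K3: "0 \<le> K3"
    and \<sigma>c: "continuous_on {0..1} \<sigma>" and \<sigma>0: "\<And>t. t \<in> {0..1} \<Longrightarrow> 0 < \<sigma> t"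
    and gc: "continuous_on {0..1} g" and g0: "0 < g 0"
begin

definition Zn :: "nat \<Rightarrow> real" where
  "Zn n = (LINT w : {w \<in> space M. \<forall>j\<in>{1..n}. row_sum X n j w \<le> g (real j / real n) * cbrt n} | M.
     exp (\<Sum>j=1..n. incr n j * row_sum X n j w))"

text \<open>One factor of the exponential weight together with the killing at time j, so that the
  expectation becomes a product along the path.\<close>

definition wt :: "nat \<Rightarrow> nat \<Rightarrow> real \<Rightarrow> ennreal" where
  "wt n j s = ennreal (if s \<le> g (real j / real n) * cbrt n then exp (incr n j * s) else 0)"

lemma wt_measurable [measurable]: "wt n j \<in> borel_measurable borel"
  unfolding wt_def by measurable

lemma row_sum_measurable: "j \<le> n \<Longrightarrow> row_sum X n j \<in> borel_measurable M"
  unfolding row_sum_def[abs_def]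
  by (intro borel_measurable_sum borel_measurable_integrable X_int) auto

text \<open>The product is split into the times before n, which the iteration consumes, and the last
  time, which is compared with the test function at the end.\<close>

lemma Zn_eq:
  assumes n: "n \<ge> 1"
  shows "0 \<le> Zn n"
    "ennreal (Zn n) = (\<integral>\<^sup>+ w. (\<Prod>i<n. wt n i (\<Sum>k=1..i. X n k w)) * wt n n (\<Sum>k=1..n. X n k w) \<partial>M)"
proof -
  define A where "A w \<longleftrightarrow> (\<forall>j\<in>{1..n}. row_sum X n j w \<le> g (real j / real n) * cbrt n)" for w
  define G where "G w = (if A w then exp (\<Sum>j=1..n. incr n j * row_sum X n j w) else 0)" for w
  have meas: "G \<in> borel_measurable M"
  proof -
    have "{w \<in> space M. A w} = (\<Inter>j\<in>{1..n}. {w \<in> space M. row_sum X n j w \<le> g (real j / real n) * cbrt n})"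
      using n by (auto simp: A_def)
    also have "\<dots> \<in> sets M"
    proof (intro sets.finite_INT)
      fix j assume "j \<in> {1..n}"
      then have [measurable]: "row_sum X n j \<in> borel_measurable M" by (intro row_sum_measurable) auto
      show "{w \<in> space M. row_sum X n j w \<le> g (real j / real n) * cbrt n} \<in> sets M" by measurable
    qed (use n in auto)
    finally have "{w \<in> space M. A w} \<in> sets M" .
    moreover have "(\<lambda>w. exp (\<Sum>j=1..n. incr n j * row_sum X n j w)) \<in> borel_measurable M"
      by (rule measurable_compose[OF _ borel_measurable_exp])
         (intro borel_measurable_sum borel_measurable_times row_sum_measurable, auto)
    ultimately show ?thesis unfolding G_def by (intro measurable_If) auto
  qed
  have Zn: "Zn n = expectation G"
    unfolding Zn_def set_lebesgue_integral_def
    by (intro Bochner_Integration.integral_cong) (auto simp: G_def A_def indicator_def)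
  have Gnn: "0 \<le> G w" for w by (simp add: G_def)
  have int: "integrable M G"
  proof (rule integrable_const_bound)
    \<comment> \<open>The increments of h are nonnegative, so on the event the exponent is bounded
      by its value on the barrier.\<close>
    show "AE w in M. norm (G w) \<le> exp (\<Sum>j=1..n. incr n j * (g (real j / real n) * cbrt n))"
    proof (intro AE_I2)
      fix w
      have "(\<Sum>j=1..n. incr n j * row_sum X n j w) \<le> (\<Sum>j=1..n. incr n j * (g (real j / real n) * cbrt n))" if "A w"
        using that n incr_bounds(1) by (intro sum_mono mult_left_mono) (auto simp: A_def)
      then show "norm (G w) \<le> exp (\<Sum>j=1..n. incr n j * (g (real j / real n) * cbrt n))"
        by (auto simp: G_def)
    qed
  qed (rule meas)
  show "0 \<le> Zn n" unfolding Zn by (intro integral_nonneg_AE) (auto simp: Gnn)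
  have "ennreal (Zn n) = (\<integral>\<^sup>+ w. ennreal (G w) \<partial>M)"
    unfolding Zn by (intro nn_integral_eq_integral[symmetric] int) (auto simp: Gnn)
  also have "\<dots> = (\<integral>\<^sup>+ w. (\<Prod>i<n. wt n i (\<Sum>k=1..i. X n k w)) * wt n n (\<Sum>k=1..n. X n k w) \<partial>M)"
  proof (intro nn_integral_cong)
    fix w
    \<comment> \<open>The factor at time 0 may be inserted: the increment there is 0, and g 0 > 0
      lets the walk start alive.\<close>
    have w0: "wt n 0 (\<Sum>k=1..0. X n k w) = 1"
      using g0 cbrt(1)[OF n] by (simp add: wt_def incr_0)
    have "(\<Prod>i<n. wt n i (\<Sum>k=1..i. X n k w)) * wt n n (\<Sum>k=1..n. X n k w) = (\<Prod>i\<le>n. wt n i (\<Sum>k=1..i. X n k w))"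
      by (simp add: lessThan_Suc_atMost[symmetric])
    also have "\<dots> = (\<Prod>i\<in>insert 0 {1..n}. wt n i (\<Sum>k=1..i. X n k w))"
      by (intro prod.cong) auto
    also have "\<dots> = (\<Prod>i=1..n. wt n i (\<Sum>k=1..i. X n k w))"
      using w0 by (subst prod.insert) auto
    also have "\<dots> = (\<Prod>i=1..n. ennreal (if row_sum X n i w \<le> g (real i / real n) * cbrt n then exp (incr n i * row_sum X n i w) else 0))"
      unfolding wt_def row_sum_def by (rule refl)
    also have "\<dots> = ennreal (\<Prod>i=1..n. if row_sum X n i w \<le> g (real i / real n) * cbrt n then exp (incr n i * row_sum X n i w) else 0)"
      by (intro prod_ennreal) auto
    also have "(\<Prod>i=1..n. if row_sum X n i w \<le> g (real i / real n) * cbrt n then exp (incr n i * row_sum X n i w) else 0) = G w"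
    proof (cases "A w")
      case True
      then show ?thesis by (simp add: G_def exp_sum A_def)
    next
      case False
      then obtain i where "i \<in> {1..n}" "\<not> row_sum X n i w \<le> g (real i / real n) * cbrt n" by (auto simp: A_def)
      then have "(\<Prod>i=1..n. if row_sum X n i w \<le> g (real i / real n) * cbrt n then exp (incr n i * row_sum X n i w) else 0) = 0"
        by (intro prod_zero) auto
      then show ?thesis using False by (simp add: G_def)
    qed
    finally show "ennreal (G w) = (\<Prod>i<n. wt n i (\<Sum>k=1..i. X n k w)) * wt n n (\<Sum>k=1..n. X n k w)" by simp
  qed
  finally show "ennreal (Zn n) = (\<integral>\<^sup>+ w. (\<Prod>i<n. wt n i (\<Sum>k=1..i. X n k w)) * wt n n (\<Sum>k=1..n. X n k w) \<partial>M)" .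
qed

lemma grid_lipschitz:
  assumes "L-lipschitz_on {0..1} c" "j < n"
  shows "\<bar>c (real (Suc j) / real n) - c (real j / real n)\<bar> \<le> L / real n"
proof -
  have "dist (c (real (Suc j) / real n)) (c (real j / real n)) \<le> L * dist (real (Suc j) / real n) (real j / real n)"
    by (rule lipschitz_onD[OF assms(1)]) (use assms(2) in auto)
  also have "dist (real (Suc j) / real n) (real j / real n) = 1 / real n"
    by (simp add: dist_real_def diff_divide_distrib[symmetric])
  finally show ?thesis by (simp add: dist_real_def)
qed

text \<open>The order of quantifiers matters: W comes from the supersolution and depends on \<delta>
  alone, so the scale can be chosen afterwards with a mismatch that is small compared with 1 /
  W.\<close>

lemma upper_bound:
  assumes "\<delta> > 0"
  shows "\<exists>W\<ge>0. \<forall>c \<gamma> Lc L\<gamma> \<epsilon>. Lc-lipschitz_on {0..1} c \<longrightarrow> L\<gamma>-lipschitz_on {0..1} \<gamma> \<longrightarrow> (\<forall>t\<in>{0..1}. 0 < c t) \<longrightarrow>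
     (\<forall>t\<in>{0..1}. g t \<le> \<gamma> t) \<longrightarrow> \<epsilon> > 0 \<longrightarrow>
     (\<forall>\<^sub>F n in sequentially. Zn n \<le> exp (cbrt n * (integral {0..1} (\<lambda>t. f t * \<gamma> t)
        + (airy_\<alpha>\<^sub>1 + 2 * \<delta>) * integral {0..1} (\<lambda>t. (c t)\<^sup>2 * (\<sigma> t)\<^sup>2 / 2)
        + W * integral {0..1} (\<lambda>t. \<bar>(c t)\<^sup>2 * (\<sigma> t)\<^sup>2 / 2 - f t / c t\<bar>) + \<epsilon>)))"
proof -
  define \<alpha> where "\<alpha> = airy_\<alpha>\<^sub>1"
  obtain P P1 P2 :: "real \<Rightarrow> real" and \<kappa> C Z r where
    pk: "\<kappa> > 0" "r > 0" "C \<ge> 0" "Z \<ge> 0" and Pc: "\<And>x. isCont P x"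
    and t1: "\<And>z d. z \<ge> \<alpha> - r \<Longrightarrow> z + d \<ge> \<alpha> \<Longrightarrow> P (z + d) \<le> P z + P1 z * d + P2 z * d\<^sup>2 / 2 + C * \<bar>d\<bar> ^ 3"
    and t2: "\<And>z d. z \<ge> \<alpha> - r \<Longrightarrow> z + d < \<alpha> \<Longrightarrow> 0 \<le> P z + P1 z * d + P2 z * d\<^sup>2 / 2 + C * \<bar>d\<bar> ^ 3"
    and low: "\<And>z. z \<ge> \<alpha> - r \<Longrightarrow> \<kappa> \<le> P z"
    and super: "\<And>z. z \<ge> \<alpha> - r \<Longrightarrow> P2 z \<le> (min z Z + 2 * \<delta>) * P z"
    and lip: "\<And>z z' \<eta>. z \<ge> \<alpha> \<Longrightarrow> z' \<ge> \<alpha> - r \<Longrightarrow> \<eta> \<le> 1 / 2 \<Longrightarrow> \<bar>z' - z\<bar> \<le> \<eta> * (1 + \<bar>z\<bar>) \<Longrightarrow> P z' \<le> P z + C * \<eta>"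
    by (rule airy_supersolution[OF assms, folded \<alpha>_def]) (rule that; assumption)
  define W where "W = Z + \<bar>\<alpha>\<bar> + r"
  have W: "W \<ge> 0" using pk by (simp add: W_def)
  \<comment> \<open>Killing is built into the test function, which is cut to 0 below
    \<alpha>.\<close>
  define \<Phi> where "\<Phi> z = (if \<alpha> \<le> z then P z else 0)" for z
  have [measurable]: "P \<in> borel_measurable borel"
    using Pc by (intro borel_measurable_continuous_onI continuous_at_imp_continuous_on) auto
  have \<Phi>_meas [measurable]: "\<Phi> \<in> borel_measurable borel" unfolding \<Phi>_def by measurable
  have \<Phi>_nn: "0 \<le> \<Phi> z" for z using low[of z] pk by (auto simp: \<Phi>_def)
  have \<Phi>_taylor: "\<Phi> (z + d) \<le> P z + P1 z * d + P2 z * d\<^sup>2 / 2 + C * \<bar>d\<bar> ^ 3" if "z \<ge> \<alpha> - r" for z d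
    using t1[of z d] t2[of z d] that by (auto simp: \<Phi>_def)
  show ?thesis
  proof (intro exI[of _ W] conjI W allI impI)
    fix c \<gamma> :: "real \<Rightarrow> real" and Lc L\<gamma> \<epsilon> :: real
    assume Lc: "Lc-lipschitz_on {0..1} c" and L\<gamma>: "L\<gamma>-lipschitz_on {0..1} \<gamma>" and c0: "\<forall>t\<in>{0..1}. 0 < c t"
      and g\<gamma>: "\<forall>t\<in>{0..1}. g t \<le> \<gamma> t" and \<epsilon>: "\<epsilon> > 0"
    have cc: "continuous_on {0..1} c" and \<gamma>c: "continuous_on {0..1} \<gamma>"
      using lipschitz_on_continuous_on Lc L\<gamma> by blast+
    have L0: "0 \<le> Lc" "0 \<le> L\<gamma>" using Lc L\<gamma> lipschitz_on_nonneg by blast+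
    obtain cm cM where cm: "0 < cm" "\<And>t. t \<in> {0..1} \<Longrightarrow> cm \<le> c t" "\<And>t. t \<in> {0..1} \<Longrightarrow> c t \<le> cM"
      using positive_continuous_bounds[OF cc] c0 by blast
    define k where "k t = (c t)\<^sup>2 * (\<sigma> t)\<^sup>2 / 2" for t
    have kc: "continuous_on {0..1} k" unfolding k_def by (intro continuous_intros cc \<sigma>c) auto
    have ic: "continuous_on {0..1} (\<lambda>t. 1 / c t)" using c0 by (intro continuous_intros cc) force
    define K1 where "K1 = Lc * (1 + \<bar>\<alpha>\<bar>) / cm + cM * L\<gamma>"
    define K' where "K' = C * cM ^ 3 * K3 / \<kappa> + C * K1 / \<kappa> + H * L\<gamma>"
    define z0 where "z0 = c 0 * \<gamma> 0 + \<alpha>"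
    have z0: "z0 \<ge> \<alpha>"
    proof -
      have "0 < c 0" "g 0 \<le> \<gamma> 0" using c0 g\<gamma> by auto
      then have "0 \<le> c 0 * \<gamma> 0" using g0 by (intro mult_nonneg_nonneg) auto
      then show ?thesis by (simp add: z0_def)
    qed
    define S1 where "S1 n = (\<Sum>j=1..n. incr n j * \<gamma> (real j / real n))" for n
    define S2 where "S2 n = (\<Sum>j<n. k (real (Suc j) / real n) / real n)" for n
    define S3 where "S3 n = (\<Sum>j<n. \<bar>k (real (Suc j) / real n) / real n - incr n j * (1 / c (real (Suc j) / real n))\<bar>)" for n
    define I1 where "I1 = integral {0..1} (\<lambda>t. f t * \<gamma> t)"
    define I2 where "I2 = integral {0..1} k"
    define I3 where "I3 = integral {0..1} (\<lambda>t. \<bar>k t - f t * (1 / c t)\<bar>)"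
    have I2': "I2 = integral {0..1} (\<lambda>t. (c t)\<^sup>2 * (\<sigma> t)\<^sup>2 / 2)"
      unfolding I2_def k_def[abs_def] by (rule refl)
    have I3': "I3 = integral {0..1} (\<lambda>t. \<bar>(c t)\<^sup>2 * (\<sigma> t)\<^sup>2 / 2 - f t / c t\<bar>)"
      by (simp add: I3_def k_def)
    have main: "Zn n \<le> exp (cbrt n * (S1 n + (\<alpha> + 2 * \<delta>) * S2 n + W * S3 n) + K') * (P z0 / \<kappa>)"
      if n: "n \<ge> 1" "K1 / real n \<le> 1 / 2" "cM * L\<gamma> / real n \<le> r" for n
    proof -
      define C' where "C' = cbrt n"
      have C': "C' \<ge> 1" "real n = C' ^ 3" using cbrt[OF n(1)] by (auto simp: C'_def)
      define cj where "cj j = c (real j / real n)" for j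
      define gj where "gj j = \<gamma> (real j / real n)" for j
      define kj where "kj j = k (real j / real n)" for j
      define V where "V j s = ennreal (\<Phi> (cj j * (gj j - s / C') + \<alpha>))" for j s
      \<comment> \<open>The exponent gained in the step from j to j + 1: the increment of h belongs
        to time j, variance and scale to time j + 1.\<close>
      define \<beta> where "\<beta> j = C' * (incr n j * gj j + (\<alpha> + 2 * \<delta>) * (kj (Suc j) / real n)
          + W * \<bar>kj (Suc j) / real n - incr n j / cj (Suc j)\<bar>) + K' / real n" for j
      have V_meas: "V j \<in> borel_measurable borel" for j unfolding V_def by measurable
      have in01: "real j / real n \<in> {0..1}" if "j \<le> n" for j
        using that n(1) by (auto simp: divide_le_eq)
      have cjb: "cm \<le> cj j" "cj j \<le> cM" if "j \<le> n" for j using cm(2,3)[OF in01[OF that]] by (auto simp: cj_def)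
      have step: "wt n j s * (\<integral>\<^sup>+ \<omega>. V (Suc j) (s + X n (Suc j) \<omega>) \<partial>M) \<le> ennreal (exp (\<beta> j)) * V j s" if j: "j < n" for j s
      proof (cases "s \<le> g (real j / real n) * cbrt n")
        case False
        then show ?thesis by (simp add: wt_def)
      next
        case True
        define y where "y = gj j - s / C'"
        have s_eq: "s = C' * (gj j - y)" using C' by (simp add: y_def)
        have y: "y \<ge> 0"
        proof -
          have "g (real j / real n) * C' \<le> gj j * C'"
            using g\<gamma> in01[of j] j C' unfolding gj_def by (intro mult_right_mono) auto
          then have "s \<le> gj j * C'" using True by (simp add: C'_def)
          then show ?thesis using C' by (simp add: y_def field_simps)
        qed
        define \<Delta> where "\<Delta> = gj (Suc j) - gj j"
        define z where "z = cj j * y + \<alpha>"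
        define z' where "z' = cj (Suc j) * (y + \<Delta>) + \<alpha>"
        have cc': "\<bar>cj (Suc j) - cj j\<bar> \<le> Lc / real n" unfolding cj_def by (rule grid_lipschitz[OF Lc j])
        have \<Delta>: "\<bar>\<Delta>\<bar> \<le> L\<gamma> / real n" unfolding \<Delta>_def gj_def by (rule grid_lipschitz[OF L\<gamma> j])
        have cpos: "0 < cj (Suc j)" "0 < cj j" using cjb(1)[of "Suc j"] cjb(1)[of j] cm(1) j by auto
        have z'a: "z' \<ge> \<alpha> - r"
        proof -
          have "cj (Suc j) * (- \<Delta>) \<le> cj (Suc j) * (L\<gamma> / real n)" using \<Delta> cpos by (intro mult_left_mono) auto
          also have "\<dots> \<le> cM * (L\<gamma> / real n)" using cjb(2)[of "Suc j"] j L0 by (intro mult_right_mono) auto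
          finally have "- (cj (Suc j) * \<Delta>) \<le> r" using n(3) by simp
          moreover have "0 \<le> cj (Suc j) * y" using cpos y by simp
          ultimately show ?thesis by (simp add: z'_def distrib_left)
        qed
        define E where "E = P z' + P2 z' * ((cj (Suc j) / C')\<^sup>2 * (\<sigma> (real (Suc j) / real n))\<^sup>2) / 2 + C * ((cj (Suc j) / C') ^ 3 * K3)"
        have "V (Suc j) (s + X n (Suc j) \<omega>) = ennreal (\<Phi> (z' + (- (cj (Suc j) / C')) * X n (Suc j) \<omega>))" for \<omega>
          unfolding V_def z'_def y_def \<Delta>_def
          by (intro arg_cong[of _ _ ennreal] arg_cong[of _ _ \<Phi>]) (simp add: add_divide_distrib algebra_simps)
        then have "(\<integral>\<^sup>+ \<omega>. V (Suc j) (s + X n (Suc j) \<omega>) \<partial>M) = (\<integral>\<^sup>+ \<omega>. ennreal (\<Phi> (z' + (- (cj (Suc j) / C')) * X n (Suc j) \<omega>)) \<partial>M)"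
          by simp
        also have "\<dots> \<le> ennreal (P z' + P2 z' * ((- (cj (Suc j) / C'))\<^sup>2 * expectation (\<lambda>\<omega>. (X n (Suc j) \<omega>)\<^sup>2)) / 2
            + C * (\<bar>- (cj (Suc j) / C')\<bar> ^ 3 * K3))"
          by (rule one_step_upper[of "X n (Suc j)" K3 C \<Phi> z' "P z'" "P1 z'" "P2 z'"])
             (use j X_int centred third pk \<Phi>_nn \<Phi>_taylor[OF z'a] in auto)
        also have "P z' + P2 z' * ((- (cj (Suc j) / C'))\<^sup>2 * expectation (\<lambda>\<omega>. (X n (Suc j) \<omega>)\<^sup>2)) / 2
            + C * (\<bar>- (cj (Suc j) / C')\<bar> ^ 3 * K3) = E"
          using variance[of "Suc j" n] j cpos C' by (simp add: E_def)
        finally have "wt n j s * (\<integral>\<^sup>+ \<omega>. V (Suc j) (s + X n (Suc j) \<omega>) \<partial>M) \<le> ennreal (exp (incr n j * s)) * ennreal E"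
          using True by (simp add: wt_def mult_left_mono)
        also have "\<dots> = ennreal (exp (incr n j * s) * E)" by (simp add: ennreal_mult')
        also have "\<dots> \<le> ennreal (exp (\<beta> j) * P z)"
        proof (rule ennreal_leI)
          show "exp (incr n j * s) * E \<le> exp (\<beta> j) * P z"
            unfolding s_eq E_def \<beta>_def W_def K'_def
          proof (rule upper_step_estimate[where cm = cm and Lc = Lc and c = "cj j" and y = y and \<Delta> = \<Delta> and ?K1.0 = K1,
                OF pk low super lip C' cm(1)])
            show "kj (Suc j) = (cj (Suc j))\<^sup>2 * (\<sigma> (real (Suc j) / real n))\<^sup>2 / 2" by (simp add: kj_def k_def cj_def)
          qed (use cjb[of j] cjb[of "Suc j"] j cc' \<Delta> L0 incr_bounds[of j n] n K3 y K1_def z_def z'_def in auto)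
        qed
        also have "\<dots> = ennreal (exp (\<beta> j)) * V j s"
          using y cpos by (simp add: V_def \<Phi>_def z_def y_def ennreal_mult')
        finally show ?thesis .
      qed
      have pos: "0 \<le> exp (C' * (incr n n * gj n)) / \<kappa>" using pk by simp
      \<comment> \<open>The iteration leaves the weight at time n over. At a living position P \<ge>
        \<kappa>, so this weight is at most a constant times the test function.\<close>
      have wn: "wt n n s \<le> ennreal (exp (C' * (incr n n * gj n)) / \<kappa>) * V n s" for s
      proof (cases "s \<le> g (real n / real n) * cbrt n")
        case False
        then show ?thesis by (simp add: wt_def)
      next
        case True
        have "g (real n / real n) * C' \<le> gj n * C'"
          using g\<gamma> in01[of n] C' unfolding gj_def by (intro mult_right_mono) auto
        then have s_le: "s \<le> gj n * C'" using True by (simp add: C'_def)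
        then have "0 \<le> gj n - s / C'" using C' by (simp add: field_simps)
        then have z\<alpha>: "cj n * (gj n - s / C') + \<alpha> \<ge> \<alpha>" using cjb(1)[of n] cm(1) by simp
        have "exp (incr n n * s) \<le> exp (C' * (incr n n * gj n))"
          using mult_left_mono[OF s_le incr_bounds(1)[of n n]] n(1) by (simp add: mult_ac)
        also have "\<dots> * 1 \<le> exp (C' * (incr n n * gj n)) * (\<Phi> (cj n * (gj n - s / C') + \<alpha>) / \<kappa>)"
        proof (rule mult_left_mono)
          show "1 \<le> \<Phi> (cj n * (gj n - s / C') + \<alpha>) / \<kappa>"
            using low[of "cj n * (gj n - s / C') + \<alpha>"] z\<alpha> pk by (simp add: \<Phi>_def)
        qed simp
        finally have le: "ennreal (exp (incr n n * s)) \<le> ennreal (exp (C' * (incr n n * gj n)) / \<kappa> * \<Phi> (cj n * (gj n - s / C') + \<alpha>))"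
          by (intro ennreal_leI) simp
        have wt_eq: "wt n n s = ennreal (exp (incr n n * s))" using True by (simp only: wt_def if_True)
        show ?thesis unfolding wt_eq V_def ennreal_mult'[OF pos, symmetric] by (rule le)
      qed
      have "ennreal (Zn n) = (\<integral>\<^sup>+ w. (\<Prod>i<n. wt n i (\<Sum>k=1..i. X n k w)) * wt n n (\<Sum>k=1..n. X n k w) \<partial>M)"
        by (rule Zn_eq(2)[OF n(1)])
      also have "\<dots> \<le> (\<integral>\<^sup>+ w. (\<Prod>i<n. wt n i (\<Sum>k=1..i. X n k w)) * (ennreal (exp (C' * (incr n n * gj n)) / \<kappa>) * V n (\<Sum>k=1..n. X n k w)) \<partial>M)"
        by (intro nn_integral_mono mult_left_mono wn) auto
      also have "\<dots> = ennreal (exp (C' * (incr n n * gj n)) / \<kappa>) * (\<integral>\<^sup>+ w. (\<Prod>i<n. wt n i (\<Sum>k=1..i. X n k w)) * V n (\<Sum>k=1..n. X n k w) \<partial>M)"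
        using walk_measurable[OF indep[OF n(1)] wt_measurable V_meas order_refl]
        by (subst nn_integral_cmult[symmetric]) (auto simp: mult_ac)
      also have "\<dots> \<le> ennreal (exp (C' * (incr n n * gj n)) / \<kappa>) * ((\<Prod>j<n. ennreal (exp (\<beta> j))) * V 0 0)"
        by (intro mult_left_mono weighted_walk_upper[OF indep[OF n(1)] wt_measurable V_meas step order_refl]) auto
      also have "(\<Prod>j<n. ennreal (exp (\<beta> j))) = ennreal (exp (\<Sum>j<n. \<beta> j))"
        by (simp add: prod_ennreal exp_sum)
      also have "V 0 0 = ennreal (P z0)" using z0 by (simp add: V_def \<Phi>_def z0_def cj_def gj_def)
      also have "ennreal (exp (C' * (incr n n * gj n)) / \<kappa>) * (ennreal (exp (\<Sum>j<n. \<beta> j)) * ennreal (P z0))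
          = ennreal (exp (C' * (incr n n * gj n)) / \<kappa> * (exp (\<Sum>j<n. \<beta> j) * P z0))"
        by (simp only: ennreal_mult'[OF exp_ge_zero, symmetric] ennreal_mult'[OF pos, symmetric])
      finally have "Zn n \<le> exp (C' * (incr n n * gj n)) / \<kappa> * (exp (\<Sum>j<n. \<beta> j) * P z0)"
        using low[of z0] z0 pk by (subst (asm) ennreal_le_iff) auto
      also have "\<dots> = exp (C' * (incr n n * gj n) + (\<Sum>j<n. \<beta> j)) * (P z0 / \<kappa>)" by (simp add: exp_add)
      also have "C' * (incr n n * gj n) + (\<Sum>j<n. \<beta> j) = C' * (S1 n + (\<alpha> + 2 * \<delta>) * S2 n + W * S3 n) + K'"
      proof -
        have "(\<Sum>j<n. \<beta> j) = C' * ((\<Sum>j<n. incr n j * gj j) + (\<alpha> + 2 * \<delta>) * S2 n + W * S3 n) + K'"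
          using n(1) unfolding \<beta>_def S2_def S3_def kj_def cj_def
          by (simp add: sum.distrib sum_distrib_left distrib_left)
        moreover have "(\<Sum>j<n. incr n j * gj j) + incr n n * gj n = S1 n"
        proof -
          have "(\<Sum>j<n. incr n j * gj j) + incr n n * gj n = (\<Sum>j\<in>insert 0 {1..n}. incr n j * gj j)"
          proof -
            have "insert 0 {1..n} = {..<Suc n}" by auto
            then show ?thesis by simp
          qed
          also have "\<dots> = S1 n" by (simp add: S1_def incr_0 gj_def)
          finally show ?thesis .
        qed
        moreover have "C' * v + (C' * (u + A + B) + K') = C' * ((u + v) + A + B) + K'" for u v A B
          by (simp add: algebra_simps)
        ultimately show ?thesis by simp
      qed
      finally show ?thesis unfolding C'_def .
    qed
    \<comment> \<open>A quarter of \<epsilon> each goes to the Stieltjes sum, the Riemann sum, the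
      mismatch multiplied by W, and the bounded constants divided by n^(1/3).\<close>
    define \<epsilon>' where "\<epsilon>' = \<epsilon> / (4 * (W + 1))"
    have \<epsilon>': "\<epsilon>' > 0" "\<epsilon>' \<le> \<epsilon> / 4" "W * \<epsilon>' \<le> \<epsilon> / 4"
      using \<epsilon> W by (auto simp: \<epsilon>'_def field_simps)
    have S1l: "S1 \<longlonglongrightarrow> I1" unfolding S1_def I1_def by (rule stieltjes_sum[OF \<gamma>c])
    have S2l: "(\<lambda>n. (\<alpha> + 2 * \<delta>) * S2 n) \<longlonglongrightarrow> (\<alpha> + 2 * \<delta>) * I2" unfolding S2_def I2_def by (intro tendsto_mult tendsto_const riemann_sum_right kc)
    have S3l: "\<forall>\<^sub>F n in sequentially. S3 n \<le> I3 + \<epsilon>'" unfolding S3_def I3_def by (rule discrepancy_sum[OF kc ic \<epsilon>'(1)])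
    have "\<forall>\<^sub>F n in sequentially. Zn n \<le> exp (cbrt n * (I1 + (\<alpha> + 2 * \<delta>) * I2 + W * I3 + \<epsilon>))"
      using order_tendstoD(2)[OF S1l, of "I1 + \<epsilon> / 4", simplified, OF \<epsilon>]
        order_tendstoD(2)[OF S2l, of "(\<alpha> + 2 * \<delta>) * I2 + \<epsilon> / 4", simplified, OF \<epsilon>]
        S3l eventually_cbrt[of "\<epsilon> / 4" "K' + ln (P z0 / \<kappa>)", simplified, OF \<epsilon>]
        eventually_inverse_less[of "1 / 2" K1, simplified] eventually_inverse_less[OF pk(2), of "cM * L\<gamma>"]
    proof eventually_elim
      case (elim n)
      have n1: "n \<ge> 1" using elim by auto
      have Pz0: "P z0 / \<kappa> > 0" using low[of z0] z0 pk by auto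
      have "Zn n \<le> exp (cbrt n * (S1 n + (\<alpha> + 2 * \<delta>) * S2 n + W * S3 n) + K') * (P z0 / \<kappa>)"
        by (rule main) (use elim in auto)
      also have "\<dots> = exp (cbrt n * (S1 n + (\<alpha> + 2 * \<delta>) * S2 n + W * S3 n) + (K' + ln (P z0 / \<kappa>)))"
        using Pz0 by (simp add: exp_add)
      also have "\<dots> \<le> exp (cbrt n * (I1 + (\<alpha> + 2 * \<delta>) * I2 + W * I3 + \<epsilon>))"
      proof -
        have cb: "cbrt n > 0" using cbrt(1)[OF n1] by simp
        have "K' + ln (P z0 / \<kappa>) \<le> cbrt n * (\<epsilon> / 4)" using elim(4) cb by (simp add: field_simps)
        moreover have "cbrt n * (S1 n + (\<alpha> + 2 * \<delta>) * S2 n + W * S3 n) \<le> cbrt n * ((I1 + \<epsilon> / 4) + ((\<alpha> + 2 * \<delta>) * I2 + \<epsilon> / 4) + (W * I3 + \<epsilon> / 4))"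
        proof (intro mult_left_mono add_mono)
          have "W * S3 n \<le> W * (I3 + \<epsilon>')" using elim(3) W by (intro mult_left_mono) auto
          then show "W * S3 n \<le> W * I3 + \<epsilon> / 4" using \<epsilon>'(3) by (simp add: distrib_left)
        qed (use elim cb in auto)
        ultimately show ?thesis unfolding exp_le_cancel_iff by (simp add: distrib_left)
      qed
      finally show ?case .
    qed
    then show "\<forall>\<^sub>F n in sequentially. Zn n \<le> exp (cbrt n * (integral {0..1} (\<lambda>t. f t * \<gamma> t)
        + (airy_\<alpha>\<^sub>1 + 2 * \<delta>) * integral {0..1} (\<lambda>t. (c t)\<^sup>2 * (\<sigma> t)\<^sup>2 / 2)
        + W * integral {0..1} (\<lambda>t. \<bar>(c t)\<^sup>2 * (\<sigma> t)\<^sup>2 / 2 - f t / c t\<bar>) + \<epsilon>))"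
      unfolding I1_def[symmetric] I2'[symmetric] I3'[symmetric] \<alpha>_def[symmetric] .
  qed
qed

end

context killed_walk
begin

text \<open>As in the upper bound, W depends on \<delta> alone. So does w, which is the width of the
  support of the subsolution; the condition on c 0 and \<gamma> 0 places the starting point inside
  it, where P is positive.\<close>

lemma lower_bound:
  assumes "\<delta> > 0"
  shows "\<exists>W\<ge>0. \<exists>w>0. \<forall>c \<gamma> Lc L\<gamma> \<epsilon>. Lc-lipschitz_on {0..1} c \<longrightarrow> L\<gamma>-lipschitz_on {0..1} \<gamma> \<longrightarrow> (\<forall>t\<in>{0..1}. 0 < c t) \<longrightarrow>
     (\<forall>t\<in>{0..1}. \<gamma> t \<le> g t) \<longrightarrow> 0 < \<gamma> 0 \<longrightarrow> c 0 * \<gamma> 0 < w \<longrightarrow> \<epsilon> > 0 \<longrightarrow>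
     (\<forall>\<^sub>F n in sequentially. exp (cbrt n * (integral {0..1} (\<lambda>t. f t * \<gamma> t)
        + (airy_\<alpha>\<^sub>1 - 2 * \<delta>) * integral {0..1} (\<lambda>t. (c t)\<^sup>2 * (\<sigma> t)\<^sup>2 / 2)
        - W * integral {0..1} (\<lambda>t. \<bar>(c t)\<^sup>2 * (\<sigma> t)\<^sup>2 / 2 - f t / c t\<bar>) - \<epsilon>)) \<le> Zn n)"
proof -
  define b where "b = airy_\<alpha>\<^sub>1 - \<delta>"
  obtain P P1 P2 :: "real \<Rightarrow> real" and B C r \<delta>' where
    pk: "b < B" "r > 0" "C \<ge> 0" "\<delta>' > 0" and Pc: "\<And>x. isCont P x"
    and t1: "\<And>z d. z \<in> {b - r..B + r} \<Longrightarrow> z + d \<in> {b..B} \<Longrightarrow> P z + P1 z * d + P2 z * d\<^sup>2 / 2 - C * \<bar>d\<bar> ^ 3 \<le> P (z + d)"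
    and t2: "\<And>z d. z \<in> {b - r..B + r} \<Longrightarrow> z + d \<notin> {b..B} \<Longrightarrow> P z + P1 z * d + P2 z * d\<^sup>2 / 2 - C * \<bar>d\<bar> ^ 3 \<le> 0"
    and bd: "\<And>z. z \<in> {b - r..B + r} \<Longrightarrow> \<bar>P z\<bar> \<le> C"
    and pos: "\<And>z. z \<in> {b<..<B} \<Longrightarrow> 0 < P z" "P b = 0" "P B = 0"
    and sub: "\<And>z. z \<in> {b - r..B + r} \<Longrightarrow> (z - \<delta>) * P z + \<delta>' \<le> P2 z"
    and lip: "\<And>z z'. z \<in> {b..B} \<Longrightarrow> z' \<in> {b - r..B + r} \<Longrightarrow> \<bar>P z' - P z\<bar> \<le> C * \<bar>z' - z\<bar>"
    by (rule airy_subsolution[OF assms b_def]) (rule that; assumption)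
  define W where "W = B - b + r"
  have W: "W \<ge> 0" using pk by (simp add: W_def)
  define \<Phi> where "\<Phi> z = (if z \<in> {b..B} then P z else 0)" for z
  have [measurable]: "P \<in> borel_measurable borel"
    using Pc by (intro borel_measurable_continuous_onI continuous_at_imp_continuous_on) auto
  have \<Phi>_meas [measurable]: "\<Phi> \<in> borel_measurable borel" unfolding \<Phi>_def by measurable
  have P_nn: "0 \<le> P z" if "z \<in> {b..B}" for z
    using pos(1)[of z] pos(2,3) that by (cases "z = b \<or> z = B") auto
  have \<Phi>_taylor: "P z + P1 z * d + P2 z * d\<^sup>2 / 2 - C * \<bar>d\<bar> ^ 3 \<le> \<Phi> (z + d)" if "z \<in> {b - r..B + r}" for z d
    unfolding \<Phi>_def using t1[OF that, of d] t2[OF that, of d] by (cases "z + d \<in> {b..B}") auto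
  have \<Phi>_le: "\<Phi> z \<le> C + 1" for z
    using bd[of z] pk by (auto simp: \<Phi>_def)
  show ?thesis
  proof (rule exI[of _ W], rule conjI[OF W], rule exI[of _ "B - b"], intro conjI allI impI)
    show "0 < B - b" using pk by simp
    fix c \<gamma> :: "real \<Rightarrow> real" and Lc L\<gamma> \<epsilon> :: real
    assume Lc: "Lc-lipschitz_on {0..1} c" and L\<gamma>: "L\<gamma>-lipschitz_on {0..1} \<gamma>" and c0: "\<forall>t\<in>{0..1}. 0 < c t"
      and g\<gamma>: "\<forall>t\<in>{0..1}. \<gamma> t \<le> g t" and \<gamma>0: "0 < \<gamma> 0" "c 0 * \<gamma> 0 < B - b" and \<epsilon>: "\<epsilon> > 0"
    have cc: "continuous_on {0..1} c" and \<gamma>c: "continuous_on {0..1} \<gamma>"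
      using lipschitz_on_continuous_on Lc L\<gamma> by blast+
    have L0: "0 \<le> Lc" "0 \<le> L\<gamma>" using Lc L\<gamma> lipschitz_on_nonneg by blast+
    obtain cm cM where cm: "0 < cm" "\<And>t. t \<in> {0..1} \<Longrightarrow> cm \<le> c t" "\<And>t. t \<in> {0..1} \<Longrightarrow> c t \<le> cM"
      using positive_continuous_bounds[OF cc] c0 by blast
    define k where "k t = (c t)\<^sup>2 * (\<sigma> t)\<^sup>2 / 2" for t
    have kc: "continuous_on {0..1} k" unfolding k_def by (intro continuous_intros cc \<sigma>c) auto
    have k0: "0 < k t" if "t \<in> {0..1}" for t
    proof -
      have "0 < c t" "0 < \<sigma> t" using c0 \<sigma>0 that by auto
      then show ?thesis by (simp add: k_def)
    qed
    obtain km kM where km: "0 < km" "\<And>t. t \<in> {0..1} \<Longrightarrow> km \<le> k t" "\<And>t. t \<in> {0..1} \<Longrightarrow> k t \<le> kM"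
      using positive_continuous_bounds[OF kc k0] by blast
    have ic: "continuous_on {0..1} (\<lambda>t. 1 / c t)" using c0 by (intro continuous_intros cc) force
    define K1 where "K1 = Lc * ((B - b) / cm) + cM * L\<gamma>"
    define X0 where "X0 = \<bar>b\<bar> + \<bar>B\<bar> + r + \<bar>\<delta>\<bar>"
    define K' where "K' = 2 * (kM * X0)\<^sup>2 + H * L\<gamma>"
    \<comment> \<open>The loss in the last weight: n^(1/3) times the last increment is at most H,
      and y is at most (B - b) / cm on the support.\<close>
    define T where "T = H * ((B - b) / cm)"
    define z0 where "z0 = c 0 * \<gamma> 0 + b"
    have z0: "z0 \<in> {b<..<B}"
    proof -
      have "0 < c 0 * \<gamma> 0" using c0 \<gamma>0 by (intro mult_pos_pos) auto
      then show ?thesis using \<gamma>0 by (simp add: z0_def)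
    qed
    define S1 where "S1 n = (\<Sum>j=1..n. incr n j * \<gamma> (real j / real n))" for n
    define S2 where "S2 n = (\<Sum>j<n. k (real (Suc j) / real n) / real n)" for n
    define S3 where "S3 n = (\<Sum>j<n. \<bar>k (real (Suc j) / real n) / real n - incr n j * (1 / c (real (Suc j) / real n))\<bar>)" for n
    define I1 where "I1 = integral {0..1} (\<lambda>t. f t * \<gamma> t)"
    define I2 where "I2 = integral {0..1} k"
    define I3 where "I3 = integral {0..1} (\<lambda>t. \<bar>k t - f t * (1 / c t)\<bar>)"
    have I2': "I2 = integral {0..1} (\<lambda>t. (c t)\<^sup>2 * (\<sigma> t)\<^sup>2 / 2)"
      unfolding I2_def k_def[abs_def] by (rule refl)
    have I3': "I3 = integral {0..1} (\<lambda>t. \<bar>(c t)\<^sup>2 * (\<sigma> t)\<^sup>2 / 2 - f t / c t\<bar>)"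
      by (simp add: I3_def k_def)
    have main: "exp (cbrt n * (S1 n + (b - \<delta>) * S2 n - W * S3 n) - K' - T) * (P z0 / (C + 1)) \<le> Zn n"
      if n: "n \<ge> 1" "K1 / real n \<le> r" "cbrt n * (kM / real n) * X0 \<le> 1 / 2"
        "C * cM ^ 3 * K3 + 2 * C * K1 \<le> cbrt n * km * \<delta>'" for n
    proof -
      define C' where "C' = cbrt n"
      have C': "C' \<ge> 1" "real n = C' ^ 3" using cbrt[OF n(1)] by (auto simp: C'_def)
      define cj where "cj j = c (real j / real n)" for j
      define gj where "gj j = \<gamma> (real j / real n)" for j
      define kj where "kj j = k (real j / real n)" for j
      define V where "V j s = ennreal (\<Phi> (cj j * (gj j - s / C') + b))" for j s
      define \<beta> where "\<beta> j = C' * (incr n j * gj j + (b - \<delta>) * (kj (Suc j) / real n)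
          - W * \<bar>kj (Suc j) / real n - incr n j / cj (Suc j)\<bar>) - K' / real n" for j
      have V_meas: "V j \<in> borel_measurable borel" for j unfolding V_def by measurable
      have in01: "real j / real n \<in> {0..1}" if "j \<le> n" for j
        using that n(1) by (auto simp: divide_le_eq)
      have cjb: "cm \<le> cj j" "cj j \<le> cM" if "j \<le> n" for j using cm(2,3)[OF in01[OF that]] by (auto simp: cj_def)
      have kjb: "km \<le> kj j" "kj j \<le> kM" if "j \<le> n" for j using km(2,3)[OF in01[OF that]] by (auto simp: kj_def)
      \<comment> \<open>A position below the barrier \<gamma> is also below g, so the killing
        indicator is 1 wherever the test function is positive.\<close>
      have wt_eq: "wt n j s = ennreal (exp (incr n j * s))" if "j \<le> n" "gj j - s / C' \<ge> 0" for j s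
      proof -
        have "s \<le> gj j * C'" using that(2) C' by (simp add: field_simps)
        also have "\<dots> \<le> g (real j / real n) * C'"
          using g\<gamma> in01[OF that(1)] C' unfolding gj_def by (intro mult_right_mono) auto
        finally show ?thesis by (simp only: wt_def C'_def if_True)
      qed
      have y_nn: "gj j - s / C' \<ge> 0" if "j \<le> n" "cj j * (gj j - s / C') + b \<in> {b..B}" for j s
      proof -
        have "0 \<le> cj j * (gj j - s / C')" using that(2) by simp
        then show ?thesis using cjb(1)[OF that(1)] cm(1) by (simp add: zero_le_mult_iff)
      qed
      have y_le: "gj j - s / C' \<le> (B - b) / cm" if "j \<le> n" "cj j * (gj j - s / C') + b \<in> {b..B}" for j s
      proof -
        have "cm * (gj j - s / C') \<le> cj j * (gj j - s / C')"
          using cjb(1)[OF that(1)] y_nn[OF that] by (intro mult_right_mono) auto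
        also have "\<dots> \<le> B - b" using that(2) by simp
        finally show ?thesis using cm(1) by (simp add: pos_le_divide_eq mult.commute)
      qed
      have step: "ennreal (exp (\<beta> j)) * V j s \<le> wt n j s * (\<integral>\<^sup>+ \<omega>. V (Suc j) (s + X n (Suc j) \<omega>) \<partial>M)" if j: "j < n" for j s
      proof (cases "cj j * (gj j - s / C') + b \<in> {b..B}")
        case False
        then have "V j s = 0" unfolding V_def \<Phi>_def by (simp only: if_False ennreal_0)
        then show ?thesis by simp
      next
        case True
        define y where "y = gj j - s / C'"
        have s_eq: "s = C' * (gj j - y)" using C' by (simp add: y_def)
        have y: "y \<ge> 0" "y \<le> (B - b) / cm" using y_nn[OF _ True] y_le[OF _ True] j by (auto simp: y_def)
        define \<Delta> where "\<Delta> = gj (Suc j) - gj j"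
        define z where "z = cj j * y + b"
        define z' where "z' = cj (Suc j) * (y + \<Delta>) + b"
        have zB: "z \<in> {b..B}" using True by (simp add: z_def y_def)
        have cc': "\<bar>cj (Suc j) - cj j\<bar> \<le> Lc / real n" unfolding cj_def by (rule grid_lipschitz[OF Lc j])
        have \<Delta>: "\<bar>\<Delta>\<bar> \<le> L\<gamma> / real n" unfolding \<Delta>_def gj_def by (rule grid_lipschitz[OF L\<gamma> j])
        have cpos: "0 < cj (Suc j)" "0 < cj j" using cjb(1)[of "Suc j"] cjb(1)[of j] cm(1) j by auto
        have z'a: "z' \<in> {b - r..B + r}"
        proof -
          have "\<bar>cj (Suc j) * (y + \<Delta>) - cj j * y\<bar> \<le> Lc / real n * ((B - b) / cm) + cM * (L\<gamma> / real n)"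
            by (rule frac_shift_bound[OF cm(1) cjb(1) cjb(2) cpos(1) cc' \<Delta> y]) (use j in auto)
          also have "\<dots> = K1 / real n" by (simp add: K1_def add_divide_distrib mult.commute[of "real n" cm])
          finally have "\<bar>z' - z\<bar> \<le> r" using n(2) by (simp add: z_def z'_def)
          then show ?thesis using zB by auto
        qed
        define E where "E = P z' + P2 z' * ((cj (Suc j) / C')\<^sup>2 * (\<sigma> (real (Suc j) / real n))\<^sup>2) / 2 - C * ((cj (Suc j) / C') ^ 3 * K3)"
        have V_eq: "V (Suc j) (s + X n (Suc j) \<omega>) = ennreal (\<Phi> (z' + (- (cj (Suc j) / C')) * X n (Suc j) \<omega>))" for \<omega>
          unfolding V_def z'_def y_def \<Delta>_def
          by (intro arg_cong[of _ _ ennreal] arg_cong[of _ _ \<Phi>]) (simp add: add_divide_distrib algebra_simps)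
        have "ennreal (exp (\<beta> j)) * V j s = ennreal (exp (\<beta> j) * P z)"
          using zB by (simp add: V_def \<Phi>_def z_def y_def ennreal_mult')
        also have "\<dots> \<le> ennreal (exp (incr n j * s) * E)"
        proof (rule ennreal_leI)
          show "exp (\<beta> j) * P z \<le> exp (incr n j * s) * E"
            unfolding s_eq E_def \<beta>_def W_def K'_def
          proof (rule lower_step_estimate[where cm = cm and cM = cM and Lc = Lc and c = "cj j" and y = y and \<Delta> = \<Delta> and ?K1.0 = K1 and km = km,
                OF pk(2,3,4,1) sub lip P_nn C' cm(1)])
            show "kj (Suc j) = (cj (Suc j))\<^sup>2 * (\<sigma> (real (Suc j) / real n))\<^sup>2 / 2" by (simp add: kj_def k_def cj_def)
            show "C * cM ^ 3 * K3 + 2 * C * K1 \<le> C' * km * \<delta>'" using n(4) by (simp add: C'_def)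
            show "C' * (kM / real n) * X0 \<le> 1 / 2" using n(3) by (simp add: C'_def)
          qed (use cjb[of j] cjb[of "Suc j"] kjb[of "Suc j"] j cc' \<Delta> L0 incr_bounds[of j n] n(1,2) K3 y K1_def z_def z'_def zB km X0_def in auto)
        qed
        also have "\<dots> = ennreal (exp (incr n j * s)) * ennreal E" by (simp add: ennreal_mult')
        also have "\<dots> \<le> wt n j s * (\<integral>\<^sup>+ \<omega>. V (Suc j) (s + X n (Suc j) \<omega>) \<partial>M)"
        proof -
          have "ennreal E = ennreal (P z' + P2 z' * ((- (cj (Suc j) / C'))\<^sup>2 * expectation (\<lambda>\<omega>. (X n (Suc j) \<omega>)\<^sup>2)) / 2
              - C * (\<bar>- (cj (Suc j) / C')\<bar> ^ 3 * K3))"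
            using variance[of "Suc j" n] j cpos C' by (simp add: E_def)
          also have "\<dots> \<le> (\<integral>\<^sup>+ \<omega>. ennreal (\<Phi> (z' + (- (cj (Suc j) / C')) * X n (Suc j) \<omega>)) \<partial>M)"
            by (rule one_step_lower[of "X n (Suc j)" K3 C "P z'" "P1 z'" "P2 z'" \<Phi> z'])
               (use j X_int centred third pk \<Phi>_taylor[OF z'a] in auto)
          finally have "ennreal E \<le> (\<integral>\<^sup>+ \<omega>. V (Suc j) (s + X n (Suc j) \<omega>) \<partial>M)" unfolding V_eq .
          then show ?thesis using wt_eq[of j s] j y(1) by (simp add: y_def mult_left_mono)
        qed
        finally show ?thesis .
      qed
      have pos': "0 \<le> exp (C' * (incr n n * gj n) - T) / (C + 1)" using pk by simp
      \<comment> \<open>Here the leftover weight must dominate the test function: P is at most C +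
        1, and y is bounded on the support.\<close>
      have wn: "ennreal (exp (C' * (incr n n * gj n) - T) / (C + 1)) * V n s \<le> wt n n s" for s
      proof (cases "cj n * (gj n - s / C') + b \<in> {b..B}")
        case False
        then have "V n s = 0" unfolding V_def \<Phi>_def by (simp only: if_False ennreal_0)
        then show ?thesis by simp
      next
        case True
        define y where "y = gj n - s / C'"
        have y: "y \<ge> 0" "y \<le> (B - b) / cm" using y_nn[OF _ True] y_le[OF _ True] by (auto simp: y_def)
        have "C' * incr n n * y \<le> T"
        proof -
          have "C' \<le> real n" using C' power_increasing[of 1 3 C'] by simp
          then have "C' * incr n n \<le> real n * (H / real n)" using incr_bounds[of n n] n(1) C' by (intro mult_mono) auto
          then have "C' * incr n n \<le> H" using n(1) by simp
          then show ?thesis unfolding T_def using y H_nn by (intro mult_mono) auto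
        qed
        moreover have "incr n n * s = C' * (incr n n * gj n) - C' * incr n n * y"
          using C' by (simp add: y_def algebra_simps)
        ultimately have "exp (C' * (incr n n * gj n) - T) \<le> exp (incr n n * s)" by simp
        then have "exp (C' * (incr n n * gj n) - T) * (\<Phi> (cj n * (gj n - s / C') + b) / (C + 1)) \<le> exp (incr n n * s) * 1"
          using \<Phi>_le[of "cj n * (gj n - s / C') + b"] P_nn pk by (intro mult_mono) (auto simp: \<Phi>_def)
        then have le: "ennreal (exp (C' * (incr n n * gj n) - T) / (C + 1) * \<Phi> (cj n * (gj n - s / C') + b)) \<le> ennreal (exp (incr n n * s))"
          by (intro ennreal_leI) simp
        have w: "wt n n s = ennreal (exp (incr n n * s))" by (rule wt_eq) (use y in \<open>auto simp: y_def\<close>)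
        show ?thesis unfolding w V_def ennreal_mult'[OF pos', symmetric] by (rule le)
      qed
      have "ennreal (exp (C' * (incr n n * gj n) - T) / (C + 1) * (exp (\<Sum>j<n. \<beta> j) * P z0))
         = ennreal (exp (C' * (incr n n * gj n) - T) / (C + 1)) * (ennreal (exp (\<Sum>j<n. \<beta> j)) * ennreal (P z0))"
        by (simp only: ennreal_mult'[OF exp_ge_zero, symmetric] ennreal_mult'[OF pos', symmetric])
      also have "ennreal (P z0) = V 0 0" using z0 by (simp add: V_def \<Phi>_def z0_def cj_def gj_def)
      also have "ennreal (exp (\<Sum>j<n. \<beta> j)) = (\<Prod>j<n. ennreal (exp (\<beta> j)))"
        by (simp add: prod_ennreal exp_sum)
      also have "ennreal (exp (C' * (incr n n * gj n) - T) / (C + 1)) * ((\<Prod>j<n. ennreal (exp (\<beta> j))) * V 0 0)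
         \<le> ennreal (exp (C' * (incr n n * gj n) - T) / (C + 1)) * (\<integral>\<^sup>+ w. (\<Prod>i<n. wt n i (\<Sum>k=1..i. X n k w)) * V n (\<Sum>k=1..n. X n k w) \<partial>M)"
        by (intro mult_left_mono weighted_walk_lower[OF indep[OF n(1)] wt_measurable V_meas step order_refl]) auto
      also have "\<dots> = (\<integral>\<^sup>+ w. (\<Prod>i<n. wt n i (\<Sum>k=1..i. X n k w)) * (ennreal (exp (C' * (incr n n * gj n) - T) / (C + 1)) * V n (\<Sum>k=1..n. X n k w)) \<partial>M)"
        using walk_measurable[OF indep[OF n(1)] wt_measurable V_meas order_refl]
        by (subst nn_integral_cmult[symmetric]) (auto simp: mult_ac)
      also have "\<dots> \<le> (\<integral>\<^sup>+ w. (\<Prod>i<n. wt n i (\<Sum>k=1..i. X n k w)) * wt n n (\<Sum>k=1..n. X n k w) \<partial>M)"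
        by (intro nn_integral_mono mult_left_mono wn) auto
      also have "\<dots> = ennreal (Zn n)" by (rule Zn_eq(2)[OF n(1), symmetric])
      finally have "exp (C' * (incr n n * gj n) - T) / (C + 1) * (exp (\<Sum>j<n. \<beta> j) * P z0) \<le> Zn n"
        using Zn_eq(1)[OF n(1)] by (subst (asm) ennreal_le_iff) auto
      moreover have "exp (C' * (incr n n * gj n) - T) / (C + 1) * (exp (\<Sum>j<n. \<beta> j) * P z0)
          = exp ((C' * (incr n n * gj n) - T) + (\<Sum>j<n. \<beta> j)) * (P z0 / (C + 1))" by (simp only: exp_add) simp
      moreover have "(C' * (incr n n * gj n) - T) + (\<Sum>j<n. \<beta> j) = C' * (S1 n + (b - \<delta>) * S2 n - W * S3 n) - K' - T"
      proof -
        have "(\<Sum>j<n. \<beta> j) = C' * ((\<Sum>j<n. incr n j * gj j) + (b - \<delta>) * S2 n - W * S3 n) - K'"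
          using n(1) unfolding \<beta>_def S2_def S3_def kj_def cj_def
          by (simp add: sum.distrib sum_subtractf sum_distrib_left distrib_left right_diff_distrib)
        moreover have "(\<Sum>j<n. incr n j * gj j) + incr n n * gj n = S1 n"
        proof -
          have "(\<Sum>j<n. incr n j * gj j) + incr n n * gj n = (\<Sum>j\<in>insert 0 {1..n}. incr n j * gj j)"
          proof -
            have "insert 0 {1..n} = {..<Suc n}" by auto
            then show ?thesis by simp
          qed
          also have "\<dots> = S1 n" by (simp add: S1_def incr_0 gj_def)
          finally show ?thesis .
        qed
        moreover have "(C' * v - T) + (C' * (u + A - D) - K') = C' * ((u + v) + A - D) - K' - T" for u v A D
          by (simp add: algebra_simps)
        ultimately show ?thesis by simp
      qed
      ultimately show ?thesis by (simp only: C'_def)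
    qed
    define \<epsilon>' where "\<epsilon>' = \<epsilon> / (4 * (W + 1))"
    have \<epsilon>': "\<epsilon>' > 0" "W * \<epsilon>' \<le> \<epsilon> / 4"
      using \<epsilon> W by (auto simp: \<epsilon>'_def field_simps)
    have S1l: "S1 \<longlonglongrightarrow> I1" unfolding S1_def I1_def by (rule stieltjes_sum[OF \<gamma>c])
    have S2l: "(\<lambda>n. (b - \<delta>) * S2 n) \<longlonglongrightarrow> (b - \<delta>) * I2" unfolding S2_def I2_def by (intro tendsto_mult tendsto_const riemann_sum_right kc)
    have S3l: "\<forall>\<^sub>F n in sequentially. S3 n \<le> I3 + \<epsilon>'" unfolding S3_def I3_def by (rule discrepancy_sum[OF kc ic \<epsilon>'(1)])
    have "\<forall>\<^sub>F n in sequentially. exp (cbrt n * (I1 + (b - \<delta>) * I2 - W * I3 - \<epsilon>)) \<le> Zn n"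
      using order_tendstoD(1)[OF S1l, of "I1 - \<epsilon> / 4", simplified, OF \<epsilon>]
        order_tendstoD(1)[OF S2l, of "(b - \<delta>) * I2 - \<epsilon> / 4", simplified, OF \<epsilon>]
        S3l eventually_cbrt[of "\<epsilon> / 4" "K' + T - ln (P z0 / (C + 1))", simplified, OF \<epsilon>]
        eventually_inverse_less[OF pk(2), of K1]
        eventually_cbrt[OF half_gt_zero[OF zero_less_one], of "kM * X0"]
        eventually_cbrt[of 1 "(C * cM ^ 3 * K3 + 2 * C * K1) / (km * \<delta>')", simplified]
    proof eventually_elim
      case (elim n)
      have n1: "n \<ge> 1" using elim by auto
      have cb: "cbrt n \<ge> 1" "cbrt n ^ 3 = real n" using cbrt[OF n1] by auto
      have Pz0: "P z0 / (C + 1) > 0" using pos(1)[OF z0] pk by auto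
      have "exp (cbrt n * (I1 + (b - \<delta>) * I2 - W * I3 - \<epsilon>)) \<le>
          exp (cbrt n * (S1 n + (b - \<delta>) * S2 n - W * S3 n) - K' - T + ln (P z0 / (C + 1)))"
      proof -
        have "K' + T - ln (P z0 / (C + 1)) \<le> cbrt n * (\<epsilon> / 4)" using elim(4) cb by (simp add: field_simps)
        moreover have "cbrt n * ((I1 - \<epsilon> / 4) + ((b - \<delta>) * I2 - \<epsilon> / 4) - (W * I3 + \<epsilon> / 4)) \<le> cbrt n * (S1 n + (b - \<delta>) * S2 n - W * S3 n)"
        proof (intro mult_left_mono add_mono diff_mono)
          have "W * S3 n \<le> W * (I3 + \<epsilon>')" using elim(3) W by (intro mult_left_mono) auto
          then show "W * S3 n \<le> W * I3 + \<epsilon> / 4" using \<epsilon>'(2) by (simp add: distrib_left)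
        qed (use elim cb in auto)
        moreover have "cbrt n * (I1 + (b - \<delta>) * I2 - W * I3 - \<epsilon>) =
            cbrt n * ((I1 - \<epsilon> / 4) + ((b - \<delta>) * I2 - \<epsilon> / 4) - (W * I3 + \<epsilon> / 4)) - cbrt n * (\<epsilon> / 4)"
          by (simp add: algebra_simps)
        ultimately show ?thesis unfolding exp_le_cancel_iff by linarith
      qed
      also have "\<dots> = exp (cbrt n * (S1 n + (b - \<delta>) * S2 n - W * S3 n) - K' - T) * (P z0 / (C + 1))"
        unfolding exp_add using Pz0 by simp
      also have "\<dots> \<le> Zn n"
      proof (rule main[OF n1])
        show "K1 / real n \<le> r" using elim by simp
        have X0_nn: "X0 \<ge> 0" and kM_nn: "kM \<ge> 0"
          using pk km(1) km(2,3)[of 0] by (auto simp: X0_def)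
        have "cbrt n * (kM / real n) * X0 = kM * X0 / (cbrt n)\<^sup>2"
          using cb unfolding cb(2)[symmetric] by (simp add: power2_eq_square power3_eq_cube)
        also have "\<dots> \<le> kM * X0 / cbrt n"
          using cb power_increasing[of 1 2 "cbrt n"] X0_nn kM_nn by (intro divide_left_mono) auto
        finally show "cbrt n * (kM / real n) * X0 \<le> 1 / 2" using elim(6) by linarith
        have "(C * cM ^ 3 * K3 + 2 * C * K1) / (km * \<delta>') < cbrt n"
          using elim(7) cb km(1) pk(4) by (simp add: divide_less_eq mult_ac split: if_splits)
        then have "C * cM ^ 3 * K3 + 2 * C * K1 < cbrt n * (km * \<delta>')"
          using km(1) pk(4) by (subst (asm) pos_divide_less_eq) auto
        then show "C * cM ^ 3 * K3 + 2 * C * K1 \<le> cbrt n * km * \<delta>'" by (simp add: mult_ac)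
      qed
      finally show ?case .
    qed
    moreover have "b - \<delta> = airy_\<alpha>\<^sub>1 - 2 * \<delta>" by (simp add: b_def)
    ultimately show "\<forall>\<^sub>F n in sequentially. exp (cbrt n * (integral {0..1} (\<lambda>t. f t * \<gamma> t)
        + (airy_\<alpha>\<^sub>1 - 2 * \<delta>) * integral {0..1} (\<lambda>t. (c t)\<^sup>2 * (\<sigma> t)\<^sup>2 / 2)
        - W * integral {0..1} (\<lambda>t. \<bar>(c t)\<^sup>2 * (\<sigma> t)\<^sup>2 / 2 - f t / c t\<bar>) - \<epsilon>)) \<le> Zn n"
      unfolding I1_def[symmetric] I2'[symmetric] I3'[symmetric] by simp
  qed
qed

end

section \<open>The limit\<close>

context killed_walk
begin

definition limit_value :: real where
  "limit_value = integral {0..1} (\<lambda>t. f t * g t) + airy_\<alpha>\<^sub>1 * integral {0..1} (\<lambda>t. (f t * \<sigma> t) powr (2 / 3) / 2 powr (1 / 3))"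

text \<open>The parameters are fixed in the order \<delta>, W, \<eta>, c, \<gamma>, as each depends
  on the previous ones or is free of them. Four errors of e / 8 arise: from \<delta>, from the
  scale, from the barrier and from the passage to the limit.\<close>

lemma upper_limit:
  assumes "e > 0"
  shows "\<forall>\<^sub>F n in sequentially. Zn n \<le> exp (cbrt n * (limit_value + e))"
proof -
  define Q where "Q = integral {0..1} (\<lambda>t. (f t * \<sigma> t) powr (2 / 3) / 2 powr (1 / 3))"
  have e8: "e / 8 > 0" using assms by simp
  \<comment> \<open>Since \<eta> \<le> 1 the integral K will be at most |Q| + 1, so the eigenvalue
    loss 2 \<delta> K is at most e / 8.\<close>
  define \<delta> where "\<delta> = e / 16 / (\<bar>Q\<bar> + 1)"
  have *: "\<delta> * (\<bar>Q\<bar> + 1) = e / 16" unfolding \<delta>_def by (intro nonzero_eq_divide_eq[THEN iffD1]) auto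
  have \<delta>: "\<delta> > 0" "2 * \<delta> * (\<bar>Q\<bar> + 1) = e / 8"
    unfolding mult.assoc * using assms by (auto simp: \<delta>_def)
  obtain W where W: "W \<ge> 0" "\<forall>c \<gamma> Lc L\<gamma> \<epsilon>. Lc-lipschitz_on {0..1} c \<longrightarrow> L\<gamma>-lipschitz_on {0..1} \<gamma> \<longrightarrow> (\<forall>t\<in>{0..1}. 0 < c t) \<longrightarrow>
     (\<forall>t\<in>{0..1}. g t \<le> \<gamma> t) \<longrightarrow> \<epsilon> > 0 \<longrightarrow>
     (\<forall>\<^sub>F n in sequentially. Zn n \<le> exp (cbrt n * (integral {0..1} (\<lambda>t. f t * \<gamma> t)
        + (airy_\<alpha>\<^sub>1 + 2 * \<delta>) * integral {0..1} (\<lambda>t. (c t)\<^sup>2 * (\<sigma> t)\<^sup>2 / 2)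
        + W * integral {0..1} (\<lambda>t. \<bar>(c t)\<^sup>2 * (\<sigma> t)\<^sup>2 / 2 - f t / c t\<bar>) + \<epsilon>)))"
    using upper_bound[OF \<delta>(1)] by (elim exE conjE) (rule that)
  \<comment> \<open>The quality of the scale: it must offset both W in front of the mismatch and the
    eigenvalue in front of K - Q.\<close>
  define \<eta> where "\<eta> = min 1 (e / (8 * (\<bar>airy_\<alpha>\<^sub>1\<bar> + W + 1)))"
  have \<eta>: "\<eta> > 0" "\<eta> \<le> 1" "(\<bar>airy_\<alpha>\<^sub>1\<bar> + W) * \<eta> \<le> e / 8"
  proof -
    show "\<eta> > 0" "\<eta> \<le> 1" using assms W(1) by (auto simp: \<eta>_def intro!: divide_pos_pos mult_pos_pos add_nonneg_pos)
    have "(\<bar>airy_\<alpha>\<^sub>1\<bar> + W) * \<eta> \<le> (\<bar>airy_\<alpha>\<^sub>1\<bar> + W + 1) * (e / (8 * (\<bar>airy_\<alpha>\<^sub>1\<bar> + W + 1)))"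
      using W(1) \<open>\<eta> > 0\<close> by (intro mult_mono) (auto simp: \<eta>_def)
    also have "\<dots> = e / 8" using W(1) by (simp add: field_simps add_nonneg_eq_0_iff)
    finally show "(\<bar>airy_\<alpha>\<^sub>1\<bar> + W) * \<eta> \<le> e / 8" .
  qed
  obtain c Lc where c: "Lc-lipschitz_on {0..1} c" "\<And>t. t \<in> {0..1} \<Longrightarrow> c t > 0"
    "integral {0..1} (\<lambda>t. \<bar>(c t)\<^sup>2 * (\<sigma> t)\<^sup>2 / 2 - f t / c t\<bar>) < \<eta>"
    "\<bar>integral {0..1} (\<lambda>t. (c t)\<^sup>2 * (\<sigma> t)\<^sup>2 / 2) - Q\<bar> < \<eta>"
    by (rule exists_scale[OF \<sigma>c \<sigma>0 \<eta>(1), folded Q_def]; (assumption | (rule that; assumption)))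
  define K where "K = integral {0..1} (\<lambda>t. (c t)\<^sup>2 * (\<sigma> t)\<^sup>2 / 2)"
  define I where "I = integral {0..1} (\<lambda>t. \<bar>(c t)\<^sup>2 * (\<sigma> t)\<^sup>2 / 2 - f t / c t\<bar>)"
  obtain \<gamma> L\<gamma> where \<gamma>: "L\<gamma>-lipschitz_on {0..1} \<gamma>" "\<And>t. t \<in> {0..1} \<Longrightarrow> g t \<le> \<gamma> t"
    "integral {0..1} (\<lambda>t. f t * \<gamma> t) \<le> integral {0..1} (\<lambda>t. f t * g t) + e / 8"
    by (rule upper_barrier[OF gc e8]; (rule that; assumption))
  have "integral {0..1} (\<lambda>t. f t * \<gamma> t) + (airy_\<alpha>\<^sub>1 + 2 * \<delta>) * K + W * I + e / 8 \<le> limit_value + e"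
  proof -
    have KQ: "\<bar>K - Q\<bar> \<le> \<eta>" "K \<le> \<bar>Q\<bar> + 1" using c(4) \<eta>(2) by (auto simp: K_def)
    have "airy_\<alpha>\<^sub>1 * (K - Q) \<le> \<bar>airy_\<alpha>\<^sub>1\<bar> * \<eta>"
      using mult_mono[OF order_refl[of "\<bar>airy_\<alpha>\<^sub>1\<bar>"] KQ(1)] abs_ge_self[of "airy_\<alpha>\<^sub>1 * (K - Q)"] by (simp add: abs_mult)
    moreover have "2 * \<delta> * K \<le> 2 * \<delta> * (\<bar>Q\<bar> + 1)" using KQ(2) \<delta>(1) by (intro mult_left_mono) auto
    moreover have "W * I \<le> W * \<eta>" using c(3) W(1) by (intro mult_left_mono) (auto simp: I_def)
    moreover have "(airy_\<alpha>\<^sub>1 + 2 * \<delta>) * K = airy_\<alpha>\<^sub>1 * Q + airy_\<alpha>\<^sub>1 * (K - Q) + 2 * \<delta> * K" by (simp add: algebra_simps)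
    moreover have "(\<bar>airy_\<alpha>\<^sub>1\<bar> + W) * \<eta> = \<bar>airy_\<alpha>\<^sub>1\<bar> * \<eta> + W * \<eta>" by (simp add: algebra_simps)
    moreover have "limit_value = integral {0..1} (\<lambda>t. f t * g t) + airy_\<alpha>\<^sub>1 * Q" by (simp only: limit_value_def Q_def)
    ultimately show ?thesis using \<gamma>(3) \<eta>(3) \<delta>(2) assms by argo
  qed
  then have le: "exp (cbrt n * (integral {0..1} (\<lambda>t. f t * \<gamma> t) + (airy_\<alpha>\<^sub>1 + 2 * \<delta>) * K + W * I + e / 8)) \<le> exp (cbrt n * (limit_value + e))" for n
    unfolding exp_le_cancel_iff by (intro mult_left_mono) (auto simp: cbrt_def)
  have "\<forall>\<^sub>F n in sequentially. Zn n \<le> exp (cbrt n * (integral {0..1} (\<lambda>t. f t * \<gamma> t) + (airy_\<alpha>\<^sub>1 + 2 * \<delta>) * K + W * I + e / 8))"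
    unfolding K_def I_def by (rule W(2)[rule_format, OF c(1) \<gamma>(1) c(2) \<gamma>(2) e8])
  then show ?thesis by eventually_elim (rule order.trans[OF _ le])
qed

text \<open>The same budget as above, but the barrier has to be chosen after the scale, since its
  height at time 0 is limited by w / c 0.\<close>

lemma lower_limit:
  assumes "e > 0"
  shows "\<forall>\<^sub>F n in sequentially. exp (cbrt n * (limit_value - e)) \<le> Zn n"
proof -
  define Q where "Q = integral {0..1} (\<lambda>t. (f t * \<sigma> t) powr (2 / 3) / 2 powr (1 / 3))"
  have e8: "e / 8 > 0" using assms by simp
  define \<delta> where "\<delta> = e / 16 / (\<bar>Q\<bar> + 1)"
  have *: "\<delta> * (\<bar>Q\<bar> + 1) = e / 16" unfolding \<delta>_def by (intro nonzero_eq_divide_eq[THEN iffD1]) auto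
  have \<delta>: "\<delta> > 0" "2 * \<delta> * (\<bar>Q\<bar> + 1) = e / 8"
    unfolding mult.assoc * using assms by (auto simp: \<delta>_def)
  obtain W w where W: "W \<ge> 0" "w > 0" "\<forall>c \<gamma> Lc L\<gamma> \<epsilon>. Lc-lipschitz_on {0..1} c \<longrightarrow> L\<gamma>-lipschitz_on {0..1} \<gamma> \<longrightarrow> (\<forall>t\<in>{0..1}. 0 < c t) \<longrightarrow>
     (\<forall>t\<in>{0..1}. \<gamma> t \<le> g t) \<longrightarrow> 0 < \<gamma> 0 \<longrightarrow> c 0 * \<gamma> 0 < w \<longrightarrow> \<epsilon> > 0 \<longrightarrow>
     (\<forall>\<^sub>F n in sequentially. exp (cbrt n * (integral {0..1} (\<lambda>t. f t * \<gamma> t)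
        + (airy_\<alpha>\<^sub>1 - 2 * \<delta>) * integral {0..1} (\<lambda>t. (c t)\<^sup>2 * (\<sigma> t)\<^sup>2 / 2)
        - W * integral {0..1} (\<lambda>t. \<bar>(c t)\<^sup>2 * (\<sigma> t)\<^sup>2 / 2 - f t / c t\<bar>) - \<epsilon>)) \<le> Zn n)"
    using lower_bound[OF \<delta>(1)] by (elim exE conjE) (rule that)
  define \<eta> where "\<eta> = min 1 (e / (8 * (\<bar>airy_\<alpha>\<^sub>1\<bar> + W + 1)))"
  have \<eta>: "\<eta> > 0" "\<eta> \<le> 1" "(\<bar>airy_\<alpha>\<^sub>1\<bar> + W) * \<eta> \<le> e / 8"
  proof -
    show "\<eta> > 0" "\<eta> \<le> 1" using assms W(1) by (auto simp: \<eta>_def intro!: divide_pos_pos mult_pos_pos add_nonneg_pos)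
    have "(\<bar>airy_\<alpha>\<^sub>1\<bar> + W) * \<eta> \<le> (\<bar>airy_\<alpha>\<^sub>1\<bar> + W + 1) * (e / (8 * (\<bar>airy_\<alpha>\<^sub>1\<bar> + W + 1)))"
      using W(1) \<open>\<eta> > 0\<close> by (intro mult_mono) (auto simp: \<eta>_def)
    also have "\<dots> = e / 8" using W(1) by (simp add: field_simps add_nonneg_eq_0_iff)
    finally show "(\<bar>airy_\<alpha>\<^sub>1\<bar> + W) * \<eta> \<le> e / 8" .
  qed
  obtain c Lc where c: "Lc-lipschitz_on {0..1} c" "\<And>t. t \<in> {0..1} \<Longrightarrow> c t > 0"
    "integral {0..1} (\<lambda>t. \<bar>(c t)\<^sup>2 * (\<sigma> t)\<^sup>2 / 2 - f t / c t\<bar>) < \<eta>"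
    "\<bar>integral {0..1} (\<lambda>t. (c t)\<^sup>2 * (\<sigma> t)\<^sup>2 / 2) - Q\<bar> < \<eta>"
    by (rule exists_scale[OF \<sigma>c \<sigma>0 \<eta>(1), folded Q_def]; (assumption | (rule that; assumption)))
  define K where "K = integral {0..1} (\<lambda>t. (c t)\<^sup>2 * (\<sigma> t)\<^sup>2 / 2)"
  define I where "I = integral {0..1} (\<lambda>t. \<bar>(c t)\<^sup>2 * (\<sigma> t)\<^sup>2 / 2 - f t / c t\<bar>)"
  have c0: "c 0 > 0" using c(2)[of 0] by simp
  obtain \<gamma> L\<gamma> where \<gamma>: "L\<gamma>-lipschitz_on {0..1} \<gamma>" "\<And>t. t \<in> {0..1} \<Longrightarrow> \<gamma> t \<le> g t" "0 < \<gamma> 0" "\<gamma> 0 < w / c 0"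
    "integral {0..1} (\<lambda>t. f t * g t) - e / 8 \<le> integral {0..1} (\<lambda>t. f t * \<gamma> t)"
    by (rule lower_barrier[OF gc e8 g0 divide_pos_pos[OF W(2) c0]]; (rule that; assumption))
  have "limit_value - e \<le> integral {0..1} (\<lambda>t. f t * \<gamma> t) + (airy_\<alpha>\<^sub>1 - 2 * \<delta>) * K - W * I - e / 8"
  proof -
    have KQ: "\<bar>K - Q\<bar> \<le> \<eta>" "K \<le> \<bar>Q\<bar> + 1" using c(4) \<eta>(2) by (auto simp: K_def)
    have "- (\<bar>airy_\<alpha>\<^sub>1\<bar> * \<eta>) \<le> airy_\<alpha>\<^sub>1 * (K - Q)"
      using mult_mono[OF order_refl[of "\<bar>airy_\<alpha>\<^sub>1\<bar>"] KQ(1)] abs_ge_minus_self[of "airy_\<alpha>\<^sub>1 * (K - Q)"] by (simp add: abs_mult)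
    moreover have "2 * \<delta> * K \<le> 2 * \<delta> * (\<bar>Q\<bar> + 1)" using KQ(2) \<delta>(1) by (intro mult_left_mono) auto
    moreover have "W * I \<le> W * \<eta>" using c(3) W(1) by (intro mult_left_mono) (auto simp: I_def)
    moreover have "(airy_\<alpha>\<^sub>1 - 2 * \<delta>) * K = airy_\<alpha>\<^sub>1 * Q + airy_\<alpha>\<^sub>1 * (K - Q) - 2 * \<delta> * K" by (simp add: algebra_simps)
    moreover have "(\<bar>airy_\<alpha>\<^sub>1\<bar> + W) * \<eta> = \<bar>airy_\<alpha>\<^sub>1\<bar> * \<eta> + W * \<eta>" by (simp add: algebra_simps)
    moreover have "limit_value = integral {0..1} (\<lambda>t. f t * g t) + airy_\<alpha>\<^sub>1 * Q" by (simp only: limit_value_def Q_def)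
    ultimately show ?thesis using \<gamma>(5) \<eta>(3) \<delta>(2) assms by argo
  qed
  then have le: "exp (cbrt n * (limit_value - e)) \<le> exp (cbrt n * (integral {0..1} (\<lambda>t. f t * \<gamma> t) + (airy_\<alpha>\<^sub>1 - 2 * \<delta>) * K - W * I - e / 8))" for n
    unfolding exp_le_cancel_iff by (intro mult_left_mono) (auto simp: cbrt_def)
  have c\<gamma>: "c 0 * \<gamma> 0 < w" using \<gamma>(4) c0 by (simp add: pos_less_divide_eq mult.commute)
  have "\<forall>\<^sub>F n in sequentially. exp (cbrt n * (integral {0..1} (\<lambda>t. f t * \<gamma> t) + (airy_\<alpha>\<^sub>1 - 2 * \<delta>) * K - W * I - e / 8)) \<le> Zn n"
    unfolding K_def I_def by (rule W(3)[rule_format, OF c(1) \<gamma>(1) c(2) \<gamma>(2) \<gamma>(3) c\<gamma> e8])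
  then show ?thesis by eventually_elim (rule order.trans[OF le])
qed

lemma log_limit: "(\<lambda>n. 1 / cbrt n * ln (Zn n)) \<longlonglongrightarrow> limit_value"
proof (rule tendstoI)
  fix e :: real assume "e > 0"
  then have e2: "e / 2 > 0" by simp
  show "\<forall>\<^sub>F n in sequentially. dist (1 / cbrt n * ln (Zn n)) limit_value < e"
    using upper_limit[OF e2] lower_limit[OF e2] eventually_ge_at_top[of 1]
  proof eventually_elim
    case (elim n)
    have cb: "cbrt n \<ge> 1" using cbrt(1)[OF elim(3)] .
    have Z: "Zn n > 0" using elim(2) exp_gt_zero order.strict_trans2 by blast
    have "cbrt n * (limit_value - e / 2) \<le> ln (Zn n)" using elim(2) Z by (simp add: ln_ge_iff)
    moreover have "ln (Zn n) \<le> ln (exp (cbrt n * (limit_value + e / 2)))"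
      using elim(1) Z by (subst ln_le_cancel_iff) auto
    ultimately have "limit_value - e / 2 \<le> 1 / cbrt n * ln (Zn n)" "1 / cbrt n * ln (Zn n) \<le> limit_value + e / 2"
      using cb by (simp_all add: pos_le_divide_eq pos_divide_le_eq mult.commute)
    then show ?case using \<open>e > 0\<close> unfolding dist_real_def by linarith
  qed
qed

end

theorem theorem1p6:
  fixes M :: "'a measure"
    and X :: "nat \<Rightarrow> nat \<Rightarrow> 'a \<Rightarrow> real"
    and \<sigma> g h h' :: "real \<Rightarrow> real"
  assumes "prob_space M"
    and indep: "\<And>n. n \<ge> 1 \<Longrightarrow> prob_space.indep_vars M (\<lambda>_. borel) (X n) {1..n}"
    and centred: "\<And>n k. 1 \<le> k \<Longrightarrow> k \<le> n \<Longrightarrow> prob_space.expectation M (X n k) = 0"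
    and "continuous_on {0..1} \<sigma>" and "\<And>t. t \<in> {0..1} \<Longrightarrow> \<sigma> t > 0"
    and variance: "\<And>n k. 1 \<le> k \<Longrightarrow> k \<le> n \<Longrightarrow>
           prob_space.expectation M (\<lambda>w. (X n k w)\<^sup>2) = (\<sigma> (real k / real n))\<^sup>2"
    and exp_moment: "\<exists>\<mu>>0. (SUP (n, k) \<in> {(n, k). 1 \<le> k \<and> k \<le> n}.
           \<integral>\<^sup>+ w. ennreal (exp (\<mu> * \<bar>X n k w\<bar>)) \<partial>M) < \<infinity>"
    and "continuous_on {0..1} g" and "g 0 > 0"
    and "absolutely_continuous_fun 0 1 h" and "mono_on {0..1} h"
    and "ae_derivative 0 1 h h'" and "riemann_integrable 0 1 h'"
  shows "(\<lambda>n. 1 / real n powr (1/3) *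
            ln (LINT w : {w \<in> space M. \<forall>j\<in>{1..n}. row_sum X n j w \<le> g (real j / real n) * real n powr (1/3)} | M.
                  exp (\<Sum>j=1..n. (h (real j / real n) - h (real (j - 1) / real n)) * row_sum X n j w)))
         \<longlonglongrightarrow> integral {0..1} (\<lambda>s. h' s * g s + airy_\<alpha>\<^sub>1 / 2 powr (1/3) * (h' s * \<sigma> s) powr (2/3))"
proof -
  interpret prob_space M by fact
  obtain f H N and a :: "nat \<Rightarrow> real \<Rightarrow> real" where fH: "H \<ge> 0" "negligible N" "\<And>t. 0 \<le> f t" "\<And>t. f t \<le> H"
    and f_eq: "\<And>t. t \<in> {0..1} - N \<Longrightarrow> f t = h' t"
    and int: "\<And>s t. 0 \<le> s \<Longrightarrow> s \<le> t \<Longrightarrow> t \<le> 1 \<Longrightarrow> (f has_integral (h t - h s)) {s..t}"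
    and a: "\<And>m. continuous_on {0..1} (a m)" "\<And>m t. t \<in> {0..1} \<Longrightarrow> 0 \<le> a m t"
    "\<And>m t. t \<in> {0..1} \<Longrightarrow> a m t \<le> H" "\<And>t. t \<in> {0..1} - N \<Longrightarrow> (\<lambda>m. a m t) \<longlonglongrightarrow> f t"
    by (rule bounded_derivative_version[OF assms(10-13)]) (rule that; assumption)
  obtain \<mu> where \<mu>: "\<mu> > 0" "(SUP (n, k) \<in> {(n, k). 1 \<le> k \<and> k \<le> n}. \<integral>\<^sup>+ w. ennreal (exp (\<mu> * \<bar>X n k w\<bar>)) \<partial>M) < \<infinity>"
    using exp_moment by blast
  define B where "B = enn2real (SUP (n, k) \<in> {(n, k). 1 \<le> k \<and> k \<le> n}. \<integral>\<^sup>+ w. ennreal (exp (\<mu> * \<bar>X n k w\<bar>)) \<partial>M)"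
  have B: "(\<integral>\<^sup>+ w. ennreal (exp (\<mu> * \<bar>X n k w\<bar>)) \<partial>M) \<le> ennreal B" if "1 \<le> k" "k \<le> n" for n k
  proof -
    have "(\<integral>\<^sup>+ w. ennreal (exp (\<mu> * \<bar>X n k w\<bar>)) \<partial>M) \<le> (SUP (n, k) \<in> {(n, k). 1 \<le> k \<and> k \<le> n}. \<integral>\<^sup>+ w. ennreal (exp (\<mu> * \<bar>X n k w\<bar>)) \<partial>M)"
      by (rule SUP_upper2[of "(n, k)"]) (use that in auto)
    also have "\<dots> = ennreal B" unfolding B_def using \<mu>(2) by (simp add: ennreal_enn2real)
    finally show ?thesis .
  qed
  have rv: "X n k \<in> borel_measurable M" if "1 \<le> k" "k \<le> n" for n k
    using indep[of n] that by (auto simp: indep_vars_def)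
  have B0: "B \<ge> 0" by (simp add: B_def)
  note moments = exponential_moment_bounds[OF rv \<mu>(1) B B0]
  interpret killed_walk M f H N a h X \<sigma> g "fact 3 / \<mu> ^ 3 * B"
  proof unfold_locales
    show "negligible N" "\<And>t. 0 \<le> f t" "\<And>t. f t \<le> H" by fact+
    show "\<And>m. continuous_on {0..1} (a m)" "\<And>m t. t \<in> {0..1} \<Longrightarrow> 0 \<le> a m t" "\<And>m t. t \<in> {0..1} \<Longrightarrow> a m t \<le> H"
      "\<And>t. t \<in> {0..1} - N \<Longrightarrow> (\<lambda>m. a m t) \<longlonglongrightarrow> f t" by fact+
    show "\<And>s t. 0 \<le> s \<Longrightarrow> s \<le> t \<Longrightarrow> t \<le> 1 \<Longrightarrow> (f has_integral h t - h s) {s..t}" by fact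
    show "0 \<le> fact 3 / \<mu> ^ 3 * B" using B0 \<mu>(1) by simp
    fix n k :: nat assume "1 \<le> k" "k \<le> n"
    note nk = this
    show "integrable M (X n k)" "integrable M (\<lambda>w. (X n k w)\<^sup>2)" "integrable M (\<lambda>w. \<bar>X n k w\<bar> ^ 3)"
      "expectation (\<lambda>w. \<bar>X n k w\<bar> ^ 3) \<le> fact 3 / \<mu> ^ 3 * B"
      by (rule moments[OF nk nk])+
    show "expectation (X n k) = 0" "expectation (\<lambda>w. (X n k w)\<^sup>2) = (\<sigma> (real k / real n))\<^sup>2"
      by (rule centred[OF nk] variance[OF nk])+
  qed (fact assms)+
  \<comment> \<open>The integrability clause is extracted from the existence of a scale with the
    arbitrary choice \<epsilon> = 1.\<close>
  have Q_int: "(\<lambda>t. (f t * \<sigma> t) powr (2 / 3) / 2 powr (1 / 3)) integrable_on {0..1}"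
    by (rule exists_scale[OF \<sigma>c \<sigma>0 zero_less_one])
  \<comment> \<open>\<open>h'\<close> and its bounded version f agree off the negligible set N, so
    the integral of the statement may be written with f.\<close>
  have "integral {0..1} (\<lambda>s. h' s * g s + airy_\<alpha>\<^sub>1 / 2 powr (1/3) * (h' s * \<sigma> s) powr (2/3))
      = integral {0..1} (\<lambda>s. f s * g s + airy_\<alpha>\<^sub>1 * ((f s * \<sigma> s) powr (2 / 3) / 2 powr (1 / 3)))"
    by (rule integral_spike[OF neg]) (simp add: f_eq)
  also have "\<dots> = limit_value"
    unfolding limit_value_def integral_mult_right[symmetric]
    by (intro integral_add integrable_mult_cont gc integrable_on_mult_right Q_int)
  finally show ?thesis using log_limit unfolding Zn_def incr_def cbrt_def by simp
qed

end
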